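(* Let $d>2$ be an integer, let $c$ be a legal coloring of the $d$-regular tree, and let $F'\leq \mathrm{Sym}(d)$ be such that the action of $F'$ on $[d]=\{1,\dots,d\}$ is not free. If $F\leq F'\leq \widehat{F}$, then $G_c(F,F')$ is virtually simple if and only if $F'$ is transitive and generated by its point stabilizers.
   Context: Let $T$ be the $d$-regular tree with $d$ finite, with vertex set $VT$ and set $ET$ of directed edges; each edge $e$ has an initial vertex $o(e)$ and a reverse edge $\overline{e}$, and $E(v)=\{e\in ET\mid o(e)=v\}$. A coloring of $T$ is a map $c\colon ET\to[d]$ such that, for each $v\in VT$, the restriction $c_v:=c|_{E(v)}\colon E(v)\to[d]$ is a bijection. It is legal if $c(e)=c(\overline{e})$ for every edge $e$. The local action of $g\in\mathrm{Aut}(T)$ at $v$ is $\sigma_c(g,v):=c_{g(v)}\circ g\circ c_v^{-1}\in\mathrm{Sym}(d)$. For $F\leq F'\leq\mathrm{Sym}(d)$, the restricted Burger--Mozes group is $$G_c(F,F')=\{g\in\mathrm{Aut}(T)\mid \sigma_c(g,v)\in F' \text{ for all } v\in VT,\text{ and } \sigma_c(g,v)\in F\text{ for all but finitely many } v\in VT\}.$$ $\widehat{F}$ is the Young group of the orbit partition of $F$: the set of all $\sigma\in\mathrm{Sym}(d)$ that setwise preserve each orbit of $F$ on $[d]$. Virtually simple means having a finite-index subgroup that is simple as an abstract group. A permutation group acts freely if all its point stabilizers are trivial. *)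

theory Defs
  imports
    "Graph_Theory.Digraph_Component"
    "HOL-Algebra.Group_Action"
    "HOL-Algebra.Sym_Groups"
begin

section \<open>Regular trees and their automorphisms\<close>

text \<open>
  A tree has no loops and no parallel edges, so a directed edge \<open>e\<close> is represented by the pair of
  its endpoints: \<open>o(e) = fst e\<close>, the reverse edge is \<open>prod.swap e\<close>, and \<open>E(v)\<close> is
  \<open>out_arcs T v\<close>.

  The constant \<^const>\<open>tree\<close> of the digraph library is not applicable to symmetric digraphs, where
  traversing an edge and its reverse already counts as a \<^const>\<open>pre_digraph.cycle\<close>. Cycles of the
  underlying undirected graph are those of length at least 3.
\<close>

definition undirected_tree :: "'v pair_pre_digraph \<Rightarrow> bool" where
  "undirected_tree T \<longleftrightarrow>
     pair_bidirected_digraph T \<and> connected (with_proj T) \<and>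
     \<not> (\<exists>p. pre_digraph.cycle (with_proj T) p \<and> length p \<ge> 3)"

definition regular_tree :: "nat \<Rightarrow> 'v pair_pre_digraph \<Rightarrow> bool" where
  "regular_tree d T \<longleftrightarrow>
     undirected_tree T \<and>
     (\<forall>v\<in>pverts T. finite (out_arcs (with_proj T) v) \<and> out_degree (with_proj T) v = d)"

text \<open>
  Automorphisms are permutations of the vertex set, extended by the identity outside of it;
  such a \<open>g\<close> maps a directed edge \<open>e\<close> to \<open>map_prod g g e\<close>.
\<close>

definition tree_aut :: "'v pair_pre_digraph \<Rightarrow> ('v \<Rightarrow> 'v) set" where
  "tree_aut T = {g. g permutes pverts T \<and>
     (\<forall>u\<in>pverts T. \<forall>v\<in>pverts T. (g u, g v) \<in> parcs T \<longleftrightarrow> (u, v) \<in> parcs T)}"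

definition tree_aut_group :: "'v pair_pre_digraph \<Rightarrow> ('v \<Rightarrow> 'v) monoid" where
  "tree_aut_group T = \<lparr>carrier = tree_aut T, mult = (\<circ>), one = id\<rparr>"

section \<open>Colorings and local actions\<close>

definition coloring :: "nat \<Rightarrow> 'v pair_pre_digraph \<Rightarrow> ('v \<times> 'v \<Rightarrow> nat) \<Rightarrow> bool" where
  "coloring d T c \<longleftrightarrow> (\<forall>v\<in>pverts T. bij_betw c (out_arcs (with_proj T) v) {1..d})"

definition legal_coloring :: "nat \<Rightarrow> 'v pair_pre_digraph \<Rightarrow> ('v \<times> 'v \<Rightarrow> nat) \<Rightarrow> bool" where
  "legal_coloring d T c \<longleftrightarrow> coloring d T c \<and> (\<forall>e\<in>parcs T. c e = c (prod.swap e))"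

text \<open>
  Elements of \<^term>\<open>sym_group d\<close> are the identity outside of \<open>{1..d}\<close>.
\<close>

definition local_action ::
    "nat \<Rightarrow> 'v pair_pre_digraph \<Rightarrow> ('v \<times> 'v \<Rightarrow> nat) \<Rightarrow> ('v \<Rightarrow> 'v) \<Rightarrow> 'v \<Rightarrow> nat \<Rightarrow> nat" where
  "local_action d T c g v = (\<lambda>i.
     if i \<in> {1..d} then c (map_prod g g (inv_into (out_arcs (with_proj T) v) c i)) else i)"

section \<open>Permutation groups on \<open>{1..d}\<close>\<close>

definition perm_group :: "nat \<Rightarrow> (nat \<Rightarrow> nat) set \<Rightarrow> (nat \<Rightarrow> nat) monoid" where
  "perm_group d F = (sym_group d)\<lparr>carrier := F\<rparr>"

text \<open>
  Restricting makes the natural action extensional, as \<^const>\<open>group_action\<close> requires.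
\<close>

definition nat_action :: "nat \<Rightarrow> (nat \<Rightarrow> nat) \<Rightarrow> nat \<Rightarrow> nat" where
  "nat_action d g = restrict g {1..d}"

definition acts_freely :: "nat \<Rightarrow> (nat \<Rightarrow> nat) set \<Rightarrow> bool" where
  "acts_freely d F \<longleftrightarrow> (\<forall>i\<in>{1..d}. stabilizer (perm_group d F) (nat_action d) i = {id})"

definition acts_transitively :: "nat \<Rightarrow> (nat \<Rightarrow> nat) set \<Rightarrow> bool" where
  "acts_transitively d F \<longleftrightarrow> transitive_action (perm_group d F) {1..d} (nat_action d)"

definition generated_by_point_stabilizers :: "nat \<Rightarrow> (nat \<Rightarrow> nat) set \<Rightarrow> bool" where
  "generated_by_point_stabilizers d F \<longleftrightarrow>
     generate (perm_group d F) (\<Union>i\<in>{1..d}. stabilizer (perm_group d F) (nat_action d) i) = F"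

definition young_group :: "nat \<Rightarrow> (nat \<Rightarrow> nat) set \<Rightarrow> (nat \<Rightarrow> nat) set" where
  "young_group d F =
     {\<sigma> \<in> carrier (sym_group d). \<forall>Y\<in>orbits (perm_group d F) {1..d} (nat_action d). \<sigma> ` Y = Y}"

section \<open>Restricted Burger--Mozes groups\<close>

definition restricted_burger_mozes ::
    "nat \<Rightarrow> 'v pair_pre_digraph \<Rightarrow> ('v \<times> 'v \<Rightarrow> nat) \<Rightarrow> (nat \<Rightarrow> nat) set \<Rightarrow> (nat \<Rightarrow> nat) set
      \<Rightarrow> ('v \<Rightarrow> 'v) monoid" where
  "restricted_burger_mozes d T c F F' = (tree_aut_group T)\<lparr>carrier :=
     {g \<in> tree_aut T.
        (\<forall>v\<in>pverts T. local_action d T c g v \<in> F') \<and>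
        finite {v \<in> pverts T. local_action d T c g v \<notin> F}}\<rparr>"

section \<open>Virtually simple groups\<close>

text \<open>
  The library's \<open>simple_group\<close> requires \<open>order G > 1\<close>, which excludes all infinite groups
  because \<^const>\<open>card\<close> is 0 on infinite sets.
\<close>

definition abstractly_simple :: "('a, 'b) monoid_scheme \<Rightarrow> bool" where
  "abstractly_simple G \<longleftrightarrow>
     group G \<and> carrier G \<noteq> {\<one>\<^bsub>G\<^esub>} \<and> (\<forall>N. N \<lhd> G \<longrightarrow> N = carrier G \<or> N = {\<one>\<^bsub>G\<^esub>})"

definition virtually_simple :: "('a, 'b) monoid_scheme \<Rightarrow> bool" where
  "virtually_simple G \<longleftrightarrow>
     (\<exists>H. subgroup H G \<and> finite (rcosets\<^bsub>G\<^esub> H) \<and> abstractly_simple (G\<lparr>carrier := H\<rparr>))"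

end

theory Submission
  imports Defs
begin

text \<open>
  Write \<open>G\<close> for the group, \<open>\<sigma>(g,v)\<close> for the local actions, and call a vertex \<open>v\<close> singular for \<open>g\<close>
  if \<open>\<sigma>(g,v) \<notin> F\<close>. Let \<open>N\<close> be the subgroup of \<open>F'\<close> generated by the point stabilizers. If \<open>N\<close> is
  transitive, then any element of \<open>F'\<close> agrees with some element of \<open>N\<close> at a point, so it differs from it
  by an element of a point stabilizer and lies in \<open>N\<close>. Hence the right-hand side of the theorem says that
  \<open>N\<close> is transitive (\<open>transitive_stab_group\<close>).

  If \<open>N\<close> is not transitive, let \<open>B\<close> be one of its orbits. Local actions of \<open>g\<close> at the ends of an edge agree
  on the color of that edge, so all local actions of \<open>g\<close> lie in one coset of the normal subgroup \<open>N\<close>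
  (\<open>local_actions_one_coset\<close>). The elements with local actions in \<open>N\<close> form a normal subgroup and preserve
  the property of an edge that its color lies in \<open>B\<close>. Folding the tree along this property gives a
  line, the Cayley graph of the infinite dihedral group, on which these elements act by isometries. The
  kernel of this action contains all elements supported in a half-tree, and since \<open>F'\<close> is not free it
  is infinite. A simple subgroup \<open>H\<close> of finite index meets the kernel nontrivially and is therefore
  contained in it. Then \<open>G\<close>, which is transitive on the vertices, moves a point of the line to finitely
  many points only, although the line is infinite (\<open>no_simple_finite_index\<close>).

  If \<open>N\<close> is transitive, let \<open>G\<^sup>+\<close> be generated by the subgroups \<open>R(X)\<close> of the elements supported in a
  half-tree \<open>X\<close>. It contains all vertex stabilizers, since \<open>F'\<close> is generated by point stabilizers, and
  has index at most 2. It need not be simple: if \<open>F\<close> is normal in \<open>F'\<close> with abelian quotient, the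
  product of the classes of \<open>\<sigma>(g,v)\<close> over all \<open>v\<close> is a homomorphism to \<open>F'/F\<close>, and it is not trivial on
  \<open>G\<^sup>+\<close> for \<open>F = Alt(3)\<close> and \<open>F' = Sym(3)\<close>. The simple group of finite index is the group generated by all
  commutators \<open>[a,b]\<close> with \<open>a, b \<in> R(X)\<close>, called the core here.

  The core is simple. Let \<open>L\<close> be a nontrivial normal subgroup of it. Some \<open>l \<in> L\<close> moves a given half-tree \<open>Y\<close>
  off itself (\<open>normal_displaces\<close>), because the core contains powers of enough translations. If \<open>a, b\<close> are
  supported in \<open>Y\<close>, then \<open>[[a,l],b] = [a,b]\<close>, since \<open>l a\<^sup>-\<^sup>1 l\<^sup>-\<^sup>1\<close> is supported off \<open>Y\<close>. This would put
  \<open>[a,b]\<close> in \<open>L\<close> if \<open>a, b\<close> belonged to the core; this is arranged by multiplying them by conjugates of their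
  inverses supported elsewhere (\<open>core_minimal\<close>).

  The core has finite index. First, \<open>G\<^sup>+\<close> is abelian modulo the core (\<open>commut_Gplus_core\<close>): two half-trees are
  nested, or disjoint, or cover the tree, and in the last case one of them can be replaced by a disjoint
  translate of itself inside the other. Next, an element \<open>r \<in> R(X)\<close> without singular vertices lies in the
  core (\<open>regular_rigid_core\<close>): it is the commutator of a translation that moves \<open>X\<close> to infinitely many disjoint
  half-trees and of the product of the conjugates of \<open>r\<close> on these half-trees, which is again without
  singular vertices. (With singular vertices this product would leave \<open>G\<close>.) Finally, every element of
  \<open>R(X)\<close> is a product of such elements and of elements \<open>z \<in> R(X')\<close> whose only singular vertex is the
  root of \<open>X'\<close> (\<open>rigid_generated\<close>). Modulo the core, such a \<open>z\<close> depends only on its local action at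
  the root and on \<open>X'\<close> up to \<open>G\<^sup>+\<close>, so there are finitely many of them. A group that is abelian modulo the
  core and generated by finitely many subgroups finite over the core is finite over the core.
\<close>

section \<open>Groups of bijections\<close>

text \<open>Groups of bijections are handled as plain sets of functions, with composition and \<open>inv'\<close> as
  operations; their members will be bijections of the vertices or of the colors.\<close>

definition perm_closed :: "('a \<Rightarrow> 'a) set \<Rightarrow> bool" where
  "perm_closed S \<longleftrightarrow> id \<in> S \<and> (\<forall>f\<in>S. \<forall>g\<in>S. f \<circ> g \<in> S) \<and> (\<forall>f\<in>S. inv' f \<in> S)"

definition commut :: "('a \<Rightarrow> 'a) \<Rightarrow> ('a \<Rightarrow> 'a) \<Rightarrow> 'a \<Rightarrow> 'a" where
  "commut f g = f \<circ> g \<circ> inv' f \<circ> inv' g"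

lemma perm_closedI:
  assumes "id \<in> S" "\<And>f g. f \<in> S \<Longrightarrow> g \<in> S \<Longrightarrow> f \<circ> g \<in> S" "\<And>f. f \<in> S \<Longrightarrow> inv' f \<in> S"
  shows "perm_closed S"
  using assms by (auto simp: perm_closed_def)

lemma perm_closedD:
  assumes "perm_closed S"
  shows "id \<in> S" "\<And>f g. f \<in> S \<Longrightarrow> g \<in> S \<Longrightarrow> f \<circ> g \<in> S" "\<And>f. f \<in> S \<Longrightarrow> inv' f \<in> S"
  using assms by (auto simp: perm_closed_def)

lemma perm_closed_hull: "perm_closed (perm_closed hull S)"
  by (rule hull_in) (auto simp: perm_closed_def)

lemma perm_closed_hull_least: "S \<subseteq> K \<Longrightarrow> perm_closed K \<Longrightarrow> perm_closed hull S \<subseteq> K"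
  by (rule hull_minimal)

lemma bij_inv_simps:
  assumes "bij f"
  shows "inv' f (f x) = x" "f (inv' f x) = x" "inv' f \<circ> f = id" "f \<circ> inv' f = id" "bij (inv' f)"
    "inv' (inv' f) = f"
  using assms by (auto simp: bij_is_inj bij_is_surj surj_f_inv_f bij_imp_bij_inv inv_inv_eq fun_eq_iff)

lemma inv_compose: "bij f \<Longrightarrow> bij g \<Longrightarrow> inv' (f \<circ> g) = inv' g \<circ> inv' f"
  by (rule o_inv_distrib)

lemma perm_closed_bij: "perm_closed {f. bij f}"
  by (auto simp: perm_closed_def bij_comp bij_imp_bij_inv)

lemma conj_hull:
  assumes "bij g" "\<And>s. s \<in> S \<Longrightarrow> bij s" "\<And>s. s \<in> S \<Longrightarrow> g \<circ> s \<circ> inv' g \<in> perm_closed hull S"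
    and "k \<in> perm_closed hull S"
  shows "g \<circ> k \<circ> inv' g \<in> perm_closed hull S"
proof -
  let ?K = "{k. bij k \<and> g \<circ> k \<circ> inv' g \<in> perm_closed hull S}"
  note D = perm_closedD[OF perm_closed_hull[of S]]
  have "perm_closed ?K"
  proof (rule perm_closedI)
    show "id \<in> ?K" using D(1) assms(1) by (simp add: bij_inv_simps)
  next
    fix a b assume "a \<in> ?K" "b \<in> ?K"
    moreover have "g \<circ> (a \<circ> b) \<circ> inv' g = (g \<circ> a \<circ> inv' g) \<circ> (g \<circ> b \<circ> inv' g)"
      using assms(1) by (simp add: fun_eq_iff bij_inv_simps)
    ultimately show "a \<circ> b \<in> ?K" using D(2) by (auto intro: bij_comp)
  next
    fix a assume a: "a \<in> ?K"
    moreover have "g \<circ> inv' a \<circ> inv' g = inv' (g \<circ> a \<circ> inv' g)"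
      using assms(1) a by (simp add: inv_compose bij_inv_simps bij_comp o_assoc)
    ultimately show "inv' a \<in> ?K" using D(3) by (auto simp: bij_inv_simps)
  qed
  then show ?thesis using perm_closed_hull_least[of S ?K] assms by auto
qed

lemma commut_inverse: "bij f \<Longrightarrow> bij g \<Longrightarrow> inv' (commut f g) = commut g f"
  by (simp add: commut_def inv_compose bij_comp bij_inv_simps o_assoc)

lemma commut_id: "bij f \<Longrightarrow> commut f id = id" "bij f \<Longrightarrow> commut id f = id"
  by (simp_all add: commut_def bij_inv_simps)

lemma commut_comp:
  assumes "bij f" "bij g" "bij h"
  shows "commut f (g \<circ> h) = commut f g \<circ> (g \<circ> commut f h \<circ> inv' g)"
  using assms by (simp add: commut_def inv_compose fun_eq_iff bij_inv_simps)

lemma commut_inv_right: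
  assumes "bij f" "bij g"
  shows "commut f (inv' g) = inv' g \<circ> inv' (commut f g) \<circ> g"
  using assms by (simp add: commut_inverse) (simp add: commut_def fun_eq_iff bij_inv_simps)

lemma inv_conj:
  fixes g :: "'a \<Rightarrow> 'a"
  assumes "bij g" "bij a"
  shows "inv' (g \<circ> a \<circ> inv' g) = g \<circ> inv' a \<circ> inv' g"
  using assms by (simp add: inv_compose bij_comp bij_inv_simps o_assoc)

lemma commut_conj:
  fixes g :: "'a \<Rightarrow> 'a"
  assumes "bij g" "bij a" "bij b"
  shows "g \<circ> commut a b \<circ> inv' g = commut (g \<circ> a \<circ> inv' g) (g \<circ> b \<circ> inv' g)"
  using assms by (simp add: commut_def inv_conj fun_eq_iff bij_inv_simps)

text \<open>Commutators with a fixed element lie in a normal subgroup \<open>M\<close> for all elements of a group: by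
  the commutator identities \<open>[f,gh] = [f,g] \<cdot> g[f,h]g\<^sup>-\<^sup>1\<close> and \<open>[f,g\<^sup>-\<^sup>1] = g\<^sup>-\<^sup>1[f,g]\<^sup>-\<^sup>1g\<close> this
  passes from generators to the group, in one argument and then in the other.\<close>

lemma commut_hull_mem:
  assumes M: "perm_closed M" and bij: "\<And>s. s \<in> S \<Longrightarrow> bij s"
    and norm: "\<And>a m. a \<in> perm_closed hull S \<Longrightarrow> m \<in> M \<Longrightarrow> a \<circ> m \<circ> inv' a \<in> M"
    and gen: "\<And>s t. s \<in> S \<Longrightarrow> t \<in> S \<Longrightarrow> commut s t \<in> M"
    and a: "a \<in> perm_closed hull S" and b: "b \<in> perm_closed hull S"
  shows "commut a b \<in> M"
proof -
  let ?A = "perm_closed hull S"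
  note A = perm_closedD[OF perm_closed_hull[of S]] and M' = perm_closedD[OF M]
  have bijA: "bij x" if "x \<in> ?A" for x
    using perm_closed_hull_least[of S "{f. bij f}"] bij perm_closed_bij that by auto
  have right: "?A \<subseteq> {b \<in> ?A. commut f b \<in> M}" 
    if f: "f \<in> ?A" and fS: "\<And>s. s \<in> S \<Longrightarrow> commut f s \<in> M" for f
  proof (rule perm_closed_hull_least)
    show "S \<subseteq> {b \<in> ?A. commut f b \<in> M}" using fS by (auto simp: hull_inc)
    show "perm_closed {b \<in> ?A. commut f b \<in> M}"
    proof (rule perm_closedI)
      show "id \<in> {b \<in> ?A. commut f b \<in> M}" using A(1) M'(1) f by (simp add: commut_id bijA)
    next
      fix g h assume "g \<in> {b \<in> ?A. commut f b \<in> M}" "h \<in> {b \<in> ?A. commut f b \<in> M}"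
      then show "g \<circ> h \<in> {b \<in> ?A. commut f b \<in> M}"
        using A(2) M'(2) norm f bijA by (auto simp: commut_comp)
    next
      fix g assume g: "g \<in> {b \<in> ?A. commut f b \<in> M}"
      then have "inv' g \<circ> inv' (commut f g) \<circ> inv' (inv' g) \<in> M"
        using A(3) M'(3) norm by auto
      then show "inv' g \<in> {b \<in> ?A. commut f b \<in> M}"
        using A(3) g f bijA by (auto simp: commut_inv_right bij_inv_simps)
    qed
  qed
  have "commut a s \<in> M" if s: "s \<in> S" for s
  proof -
    have "commut s a \<in> M" using right[of s] s gen a by (auto simp: hull_inc)
    then have "inv' (commut s a) \<in> M" by (rule M'(3))
    then show ?thesis using commut_inverse s a bij bijA by metis
  qed
  then show ?thesis using right[OF a] b by auto
qed

text \<open>A commutator depends only on what happens where the supports meet: \<open>c\<close> and \<open>e\<close> look like \<open>a\<close> and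
  \<open>b\<close> on \<open>X\<close>, and whatever \<open>e\<close> does outside of \<open>X\<close> takes place on a set \<open>D\<close> that \<open>c\<close> fixes.\<close>

lemma commut_local:
  assumes bij: "bij a" "bij b" "bij c" "bij e"
    and a: "\<And>x. x \<notin> X \<Longrightarrow> a x = x" and b: "\<And>x. x \<notin> X \<Longrightarrow> b x = x"
    and c: "\<And>x. x \<in> X \<Longrightarrow> c x = a x" "\<And>x. x \<in> D \<Longrightarrow> c x = x"
    and e: "\<And>x. x \<in> X \<Longrightarrow> e x = b x" "\<And>x. x \<in> D \<Longrightarrow> e x \<in> D" "\<And>x. x \<notin> X \<Longrightarrow> x \<notin> D \<Longrightarrow> e x = x"
    and XD: "X \<inter> D = {}"
  shows "commut c e = commut a b"
proof -
  note ba = bij_inv_simps[OF bij(1)] and bb = bij_inv_simps[OF bij(2)]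
    and bc = bij_inv_simps[OF bij(3)] and be = bij_inv_simps[OF bij(4)]
  have aX: "a x \<in> X" if "x \<in> X" for x using a ba(1) that by metis
  have bX: "b x \<in> X" if "x \<in> X" for x using b bb(1) that by metis
  have "c (e x) = commut a b (e (c x))" for x
  proof -
    have cm: "commut a b (b (a y)) = a (b y)" for y by (simp add: commut_def ba bb)
    consider "x \<in> X" | "x \<in> D" "x \<notin> X" | "x \<notin> X" "x \<notin> D" by blast
    then show ?thesis
    proof cases
      case 1
      then show ?thesis using c(1) e(1) aX bX cm by simp
    next
      case 2
      have eD: "e x \<in> D" "e x \<notin> X" using e(2) 2 XD by blast+
      then have "commut a b (e x) = e x" using cm[of "e x"] a b by simp
      then show ?thesis using c(2) eD 2 by simp
    next
      case 3
      have "c x \<notin> X"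
      proof
        assume cx: "c x \<in> X"
        then have "inv' a (c x) \<in> X" using a ba(2) by metis
        then have "c (inv' a (c x)) = c x" using c(1) ba(2) by simp
        then have "inv' a (c x) = x" using bc(1) by metis
        then show False using 3 \<open>inv' a (c x) \<in> X\<close> by simp
      qed
      moreover have "c x \<notin> D" using c(2)[of "c x"] bc(1) 3 by metis
      ultimately have "e (c x) = c x" "commut a b (c x) = c x" using e(3) cm[of "c x"] a b by auto
      then show ?thesis using e(3)[OF 3] by simp
    qed
  qed
  from this[of "inv' c (inv' e x)" for x] show ?thesis
    by (simp add: commut_def fun_eq_iff bc be)
qed

definition perm_simple :: "('a \<Rightarrow> 'a) set \<Rightarrow> bool" where
  "perm_simple H \<longleftrightarrow> H \<noteq> {id} \<and>
    (\<forall>N. N \<subseteq> H \<and> perm_closed N \<and> (\<forall>h\<in>H. \<forall>n\<in>N. h \<circ> n \<circ> inv' h \<in> N) \<longrightarrow> N = H \<or> N = {id})"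

text \<open>For a subgroup \<open>H\<close> of \<open>A\<close> this is finite index. It is also used for subgroups \<open>A\<close> that do not
  contain \<open>H\<close>, in order to say that the image of \<open>A\<close> modulo \<open>H\<close> is finite.\<close>

definition finite_over :: "('a \<Rightarrow> 'a) set \<Rightarrow> ('a \<Rightarrow> 'a) set \<Rightarrow> bool" where
  "finite_over H A \<longleftrightarrow> (\<exists>C. C \<subseteq> A \<and> finite C \<and> (\<forall>a\<in>A. \<exists>c\<in>C. a \<circ> inv' c \<in> H))"

text \<open>Modulo \<open>H\<close>, the groups \<open>K\<close> and \<open>A\<close> commute, so their products form a group.\<close>

lemma finite_over_product:
  assumes K: "perm_closed K" and A: "perm_closed A" and H: "perm_closed H" and HK: "H \<subseteq> K"
    and bij: "\<And>x. x \<in> K \<union> A \<Longrightarrow> bij x"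
    and norm: "\<And>k h. k \<in> K \<Longrightarrow> h \<in> H \<Longrightarrow> k \<circ> h \<circ> inv' k \<in> H"
    and comm: "\<And>k a. k \<in> K \<Longrightarrow> a \<in> A \<Longrightarrow> commut k a \<in> H"
    and fin: "finite_over H K" "finite_over H A"
  obtains W where "perm_closed W" "K \<subseteq> W" "A \<subseteq> W" "finite_over H W"
    "W \<subseteq> {k \<circ> a | k a. k \<in> K \<and> a \<in> A}"
proof
  let ?W = "{k \<circ> a | k a. k \<in> K \<and> a \<in> A}"
  note K' = perm_closedD[OF K] and A' = perm_closedD[OF A] and H' = perm_closedD[OF H]
  show "K \<subseteq> ?W" using A'(1) by (metis (mono_tags, lifting) comp_id mem_Collect_eq subsetI)
  show "A \<subseteq> ?W" using K'(1) by (metis (mono_tags, lifting) id_comp mem_Collect_eq subsetI)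
  show "?W \<subseteq> ?W" ..
  show "perm_closed ?W"
  proof (rule perm_closedI)
    have "id \<circ> id \<in> ?W" using K'(1) A'(1) by blast
    then show "id \<in> ?W" by simp
  next
    fix f g assume "f \<in> ?W" "g \<in> ?W"
    then obtain k a k' a' where *: "f = k \<circ> a" "g = k' \<circ> a'" "k \<in> K" "k' \<in> K" "a \<in> A" "a' \<in> A"
      by blast
    have "f \<circ> g = (k \<circ> k' \<circ> commut (inv' k') a) \<circ> (a \<circ> a')"
      using * bij by (simp add: commut_def fun_eq_iff bij_inv_simps)
    moreover have "k \<circ> k' \<circ> commut (inv' k') a \<in> K"
      using * K'(2)[OF K'(2)] K'(3) comm HK by (metis subsetD)
    ultimately show "f \<circ> g \<in> ?W" using * A'(2) by blast
  next
    fix f assume "f \<in> ?W"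
    then obtain k a where *: "f = k \<circ> a" "k \<in> K" "a \<in> A" by blast
    have "inv' f = (inv' k \<circ> commut k (inv' a)) \<circ> inv' a"
      unfolding *(1) using *(2,3) bij by (simp add: commut_def inv_compose fun_eq_iff bij_inv_simps)
    moreover have "inv' k \<circ> commut k (inv' a) \<in> K"
      using * K'(2)[OF K'(3)] A'(3) comm HK by (metis subsetD)
    ultimately show "inv' f \<in> ?W" using * A'(3) by blast
  qed
  obtain C where C: "C \<subseteq> K" "finite C" "\<And>a. a\<in>K \<Longrightarrow> \<exists>c\<in>C. a \<circ> inv' c \<in> H"
    using fin(1) by (auto simp: finite_over_def)
  obtain D where D: "D \<subseteq> A" "finite D" "\<And>a. a\<in>A \<Longrightarrow> \<exists>c\<in>D. a \<circ> inv' c \<in> H"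
    using fin(2) by (auto simp: finite_over_def)
  let ?E = "(\<lambda>(x, y). x \<circ> y) ` (C \<times> D)"
  show "finite_over H ?W"
    unfolding finite_over_def
  proof (intro exI[of _ ?E] conjI ballI)
    show "?E \<subseteq> ?W" using C(1) D(1) by fastforce
    show "finite ?E" using C(2) D(2) by blast
    fix f assume "f \<in> ?W"
    then obtain k a where *: "f = k \<circ> a" "k \<in> K" "a \<in> A" by blast
    obtain x where x: "x \<in> C" "k \<circ> inv' x \<in> H" using C(3) * by blast
    obtain y where y: "y \<in> D" "a \<circ> inv' y \<in> H" using D(3) * by blast
    have xK: "x \<in> K" and yA: "y \<in> A" using x y C(1) D(1) by blast+
    have "f \<circ> inv' (x \<circ> y) = (k \<circ> inv' x) \<circ> (x \<circ> (a \<circ> inv' y) \<circ> inv' x)"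
      using * xK yA bij by (simp add: inv_compose fun_eq_iff bij_inv_simps)
    also have "\<dots> \<in> H" using H'(2) x y norm xK by blast
    finally show "\<exists>c\<in>?E. f \<circ> inv' c \<in> H" using x(1) y(1) by force
  qed
qed

section \<open>Trees with a legal coloring\<close>

text \<open>A tree with a legal coloring by \<open>C\<close> in terms of the map that sends a vertex and a color to the
  other end of the edge of that color. Words in the colors describe walks, and acyclicity says that no
  reduced word describes a closed walk: the tree is the Cayley graph of the free product of copies of
  \<open>\<int>/2\<close> indexed by \<open>C\<close>, without a base point.\<close>

locale colored_tree =
  fixes V :: "'v set" and C :: "'c set" and nb :: "'v \<Rightarrow> 'c \<Rightarrow> 'v"
  assumes finite_C: "finite C"
    and nb_closed: "v \<in> V \<Longrightarrow> i \<in> C \<Longrightarrow> nb v i \<in> V"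
    and nb_nb: "v \<in> V \<Longrightarrow> i \<in> C \<Longrightarrow> nb (nb v i) i = v"
    and joined: "u \<in> V \<Longrightarrow> v \<in> V \<Longrightarrow> \<exists>w. set w \<subseteq> C \<and> foldl nb u w = v"
    and no_circuit: "v \<in> V \<Longrightarrow> set w \<subseteq> C \<Longrightarrow> distinct_adj w \<Longrightarrow> foldl nb v w = v \<Longrightarrow> w = []"
begin

abbreviation walk :: "'v \<Rightarrow> 'c list \<Rightarrow> 'v" where
  "walk \<equiv> foldl nb"

definition reduced :: "'c list \<Rightarrow> bool" where
  "reduced w \<longleftrightarrow> set w \<subseteq> C \<and> distinct_adj w"

lemma reduced_simps [simp]:
  "reduced []" "reduced [i] \<longleftrightarrow> i \<in> C"
  "reduced (i # w) \<longleftrightarrow> i \<in> C \<and> reduced w \<and> (w = [] \<or> hd w \<noteq> i)"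
  "reduced (rev w) \<longleftrightarrow> reduced w"
  by (auto simp: reduced_def distinct_adj_Cons)

lemma reduced_append:
  "reduced (w @ w') \<longleftrightarrow> reduced w \<and> reduced w' \<and> (w = [] \<or> w' = [] \<or> last w \<noteq> hd w')"
  by (auto simp: reduced_def distinct_adj_append_iff)

lemma reduced_letters: "reduced w \<Longrightarrow> set w \<subseteq> C"
  by (simp add: reduced_def)

lemma walk_closed: "v \<in> V \<Longrightarrow> set w \<subseteq> C \<Longrightarrow> walk v w \<in> V"
  by (induction w arbitrary: v) (auto simp: nb_closed)

lemma walk_rev: "v \<in> V \<Longrightarrow> set w \<subseteq> C \<Longrightarrow> walk (walk v w) (rev w) = v"
  by (induction w arbitrary: v) (auto simp: nb_closed nb_nb)

lemma reduced_exists: "u \<in> V \<Longrightarrow> set w \<subseteq> C \<Longrightarrow> \<exists>w'. reduced w' \<and> walk u w' = walk u w"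
proof (induction w rule: rev_induct)
  case (snoc i w)
  then obtain w' where w': "reduced w'" "walk u w' = walk u w" by auto
  show ?case
  proof (cases "w' \<noteq> [] \<and> last w' = i")
    case True
    then obtain w'' where w'': "w' = w'' @ [i]" by (metis append_butlast_last_id)
    then have "walk u w'' \<in> V" using w'(1) snoc.prems walk_closed reduced_letters[of w'] by simp
    then have "walk u w'' = walk u (w @ [i])"
      using w'(2)[symmetric] w'' snoc.prems by (simp add: nb_nb)
    then show ?thesis using w' w'' by (auto simp: reduced_append)
  next
    case False
    then have "reduced (w' @ [i])" using w' snoc.prems by (auto simp: reduced_append)
    moreover have "walk u (w' @ [i]) = walk u (w @ [i])" using w' by simp
    ultimately show ?thesis by blast
  qed
qed (auto intro: exI[of _ "[]"])

lemma reduced_unique: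
  "u \<in> V \<Longrightarrow> reduced w \<Longrightarrow> reduced w' \<Longrightarrow> walk u w = walk u w' \<Longrightarrow> w = w'"
proof (induction w arbitrary: u w')
  case Nil
  then show ?case using no_circuit[of u w'] by (simp add: reduced_def)
next
  case (Cons i w)
  show ?case
  proof (cases w')
    case Nil
    then show ?thesis using Cons.prems no_circuit[of u "i # w"] by (simp add: reduced_def)
  next
    case (Cons j w'')
    show ?thesis
    proof (cases "i = j")
      case True
      then show ?thesis using Cons Cons.IH[of "nb u i" w''] Cons.prems by (simp add: nb_closed)
    next
      case False
      \<comment> \<open>going back along one word and forward along the other is a reduced circuit\<close>
      have red: "reduced (rev w' @ i # w)"
        using Cons.prems Cons False by (auto simp: reduced_append last_rev)
      have u': "walk u w' \<in> V" and letters: "set (rev w' @ i # w) \<subseteq> C"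
        using Cons.prems walk_closed reduced_letters red by blast+
      have "walk (walk u w') (rev w' @ i # w) = walk u w'"
        using Cons.prems walk_rev[of u w'] reduced_letters[of w'] by simp
      then have "rev w' @ i # w = []"
        using red no_circuit[OF u' letters] by (simp add: reduced_def)
      then show ?thesis by simp
    qed
  qed
qed

definition geod :: "'v \<Rightarrow> 'v \<Rightarrow> 'c list" where
  "geod u v = (THE w. reduced w \<and> walk u w = v)"

lemma geod_eqI: "u \<in> V \<Longrightarrow> reduced w \<Longrightarrow> walk u w = v \<Longrightarrow> geod u v = w"
  unfolding geod_def using reduced_unique by blast

lemma geod_props:
  assumes "u \<in> V" "v \<in> V"
  shows "reduced (geod u v)" "walk u (geod u v) = v"
proof -
  obtain w where "reduced w" "walk u w = v" 
    using joined[OF assms] reduced_exists[OF assms(1)] by metis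
  then show "reduced (geod u v)" "walk u (geod u v) = v" using geod_eqI[OF assms(1)] by auto
qed

lemma geod_self: "u \<in> V \<Longrightarrow> geod u u = []"
  by (rule geod_eqI) auto

text \<open>The word of the geodesic changes at its end only, as in multiplying a reduced word of the free
  product by a generator.\<close>

lemma geod_nb:
  assumes "u \<in> V" "v \<in> V" "i \<in> C"
  shows "geod u (nb v i) =
    (if geod u v \<noteq> [] \<and> last (geod u v) = i then butlast (geod u v) else geod u v @ [i])"
proof (cases "geod u v \<noteq> [] \<and> last (geod u v) = i")
  case True
  let ?w = "butlast (geod u v)"
  have eq: "geod u v = ?w @ [i]" using True by (metis append_butlast_last_id)
  have red: "reduced ?w" using geod_props(1)[OF assms(1,2)] eq by (metis reduced_append)
  have "nb (walk u ?w) i = v" using geod_props(2)[OF assms(1,2)] eq by (metis foldl_Cons foldl_Nil foldl_append)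
  then have "nb v i = walk u ?w"
    using nb_nb[OF walk_closed[OF assms(1) reduced_letters[OF red]] assms(3)] by simp
  then show ?thesis using geod_eqI[OF assms(1) red] True by simp
next
  case False
  then have "reduced (geod u v @ [i])" using geod_props(1)[OF assms(1,2)] assms(3) by (auto simp: reduced_append)
  then show ?thesis using geod_eqI[OF assms(1)] geod_props(2)[OF assms(1,2)] False by auto
qed

lemma nb_inj: "v \<in> V \<Longrightarrow> i \<in> C \<Longrightarrow> j \<in> C \<Longrightarrow> nb v i = nb v j \<Longrightarrow> i = j"
  using reduced_unique[of v "[i]" "[j]"] by simp

lemma nb_neq: "v \<in> V \<Longrightarrow> i \<in> C \<Longrightarrow> nb v i \<noteq> v"
  using reduced_unique[of v "[i]" "[]"] by auto

lemma connected_induct [consumes 2, case_names base step]: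
  assumes "x \<in> V" "u \<in> V" and "P u" and "\<And>x i. x \<in> V \<Longrightarrow> i \<in> C \<Longrightarrow> P x \<Longrightarrow> P (nb x i)"
  shows "P x"
proof -
  have "set w \<subseteq> C \<Longrightarrow> P (walk u w)" for w
    using assms by (induction w rule: rev_induct) (auto simp: walk_closed)
  then show ?thesis using joined assms by blast
qed

subsection \<open>Half-trees\<close>

text \<open>The component of \<open>nb v i\<close> after removing the edge of color \<open>i\<close> at \<open>v\<close>; its root is \<open>nb v i\<close>.\<close>

definition half :: "'v \<Rightarrow> 'c \<Rightarrow> 'v set" where
  "half v i = {walk v (i # w) | w. reduced (i # w)}"

lemma mem_half_iff:
  assumes "v \<in> V" "i \<in> C"
  shows "x \<in> half v i \<longleftrightarrow> x \<in> V \<and> geod v x \<noteq> [] \<and> hd (geod v x) = i"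
proof
  assume "x \<in> half v i"
  then obtain w where w: "x = walk v (i # w)" "reduced (i # w)" by (auto simp: half_def)
  then have "geod v x = i # w" using geod_eqI assms by blast
  then show "x \<in> V \<and> geod v x \<noteq> [] \<and> hd (geod v x) = i"
    using w walk_closed[OF assms(1) reduced_letters[OF w(2)]] by auto
next
  assume *: "x \<in> V \<and> geod v x \<noteq> [] \<and> hd (geod v x) = i"
  then obtain w where "geod v x = i # w" by (metis list.exhaust_sel)
  then show "x \<in> half v i" using geod_props[of v x] assms * unfolding half_def by auto
qed

lemma half_subset: "v \<in> V \<Longrightarrow> i \<in> C \<Longrightarrow> half v i \<subseteq> V"
  by (auto simp: mem_half_iff)

lemma base_notin_half: "v \<in> V \<Longrightarrow> i \<in> C \<Longrightarrow> v \<notin> half v i"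
  by (simp add: mem_half_iff geod_self)

lemma nb_in_half: "v \<in> V \<Longrightarrow> i \<in> C \<Longrightarrow> nb v i \<in> half v i"
  by (auto simp: half_def intro: exI[of _ "[]"])

lemma half_disjoint: "v \<in> V \<Longrightarrow> i \<in> C \<Longrightarrow> j \<in> C \<Longrightarrow> i \<noteq> j \<Longrightarrow> half v i \<inter> half v j = {}"
  by (auto simp: mem_half_iff)

lemma half_cover: "v \<in> V \<Longrightarrow> x \<in> V \<Longrightarrow> x \<noteq> v \<Longrightarrow> \<exists>i\<in>C. x \<in> half v i"
proof -
  assume *: "v \<in> V" "x \<in> V" "x \<noteq> v"
  then have ne: "geod v x \<noteq> []" using geod_props(2)[of v x] by auto
  then have "hd (geod v x) \<in> C" using geod_props(1)[of v x] * reduced_letters by fastforce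
  then show ?thesis using * ne by (auto simp: mem_half_iff)
qed

lemma half_complement:
  assumes "v \<in> V" "i \<in> C"
  shows "half (nb v i) i = V - half v i"
proof -
  have nb: "nb v i \<in> V" using assms nb_closed by simp
  have one: "x \<notin> half v i" if x: "x \<in> half (nb v i) i" for x
  proof -
    obtain w where w: "x = walk (nb v i) (i # w)" "reduced (i # w)"
      using x unfolding half_def by blast
    then have "geod v x = w" using assms by (auto simp: nb_nb intro: geod_eqI)
    then show ?thesis using assms w by (auto simp: mem_half_iff)
  qed
  have two: "x \<in> half (nb v i) i" if "x \<in> V" "x \<notin> half v i" for x
  proof -
    have "reduced (i # geod v x)" "walk (nb v i) (i # geod v x) = x"
      using that assms geod_props[of v x] by (auto simp: mem_half_iff nb_nb)
    then show ?thesis unfolding half_def by (metis (mono_tags, lifting) mem_Collect_eq)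
  qed
  show ?thesis using one two half_subset[OF nb assms(2)] by blast
qed

lemma half_boundary:
  assumes "v \<in> V" "i \<in> C" "j \<in> C" "x \<in> half v i" "nb x j \<notin> half v i"
  shows "x = nb v i" "j = i"
proof -
  have x: "x \<in> V" using assms half_subset by blast
  obtain w where w: "geod v x = i # w" using assms(4) mem_half_iff[OF assms(1,2)] by (metis list.exhaust_sel)
  have *: "geod v (nb x j) = [] \<or> hd (geod v (nb x j)) \<noteq> i"
    using assms mem_half_iff[OF assms(1,2)] nb_closed x by blast
  have "last (i # w) = j \<and> butlast (i # w) = []"
    using * geod_nb[OF assms(1) x assms(3)] w by (auto split: if_splits)
  then have "w = []" "j = i" by (auto split: if_splits)
  then show "x = nb v i" "j = i" using w geod_props(2)[OF assms(1) x] by auto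
qed

lemma half_deep:
  assumes "v \<in> V" "reduced (w @ [i])"
  shows "half (walk v w) i = {walk v (w @ i # w') | w'. reduced (w @ i # w')}"
proof -
  have "reduced (w @ i # w') \<longleftrightarrow> reduced (i # w')" for w'
    using assms(2) by (auto simp: reduced_append)
  then show ?thesis unfolding half_def by simp
qed

text \<open>Seen from a vertex \<open>v\<close> outside, all geodesics into the half-tree start with the geodesic to its
  bounding edge.\<close>

lemma half_outside:
  assumes "u \<in> V" "v \<in> V" "i \<in> C" "v \<notin> half u i"
  shows "half u i = {walk v (geod v u @ i # w') | w'. reduced (geod v u @ i # w')}"
    and "reduced (geod v u @ [i])"
proof -
  have g: "reduced (geod v u)" "walk v (geod v u) = u" using geod_props assms by auto
  show red: "reduced (geod v u @ [i])"
  proof (rule ccontr)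
    assume "\<not> reduced (geod v u @ [i])"
    then have *: "geod v u \<noteq> []" "last (geod v u) = i" using g assms by (auto simp: reduced_append)
    have "walk u (rev (geod v u)) = v" using walk_rev[OF assms(2) reduced_letters[OF g(1)]] g(2) by simp
    then have "geod u v = rev (geod v u)" using g(1) by (intro geod_eqI assms) simp_all
    then have "v \<in> half u i" using * assms(1-3) by (simp add: mem_half_iff hd_rev)
    then show False using assms(4) by blast
  qed
  show "half u i = {walk v (geod v u @ i # w') | w'. reduced (geod v u @ i # w')}"
    using half_deep[OF assms(2) red] unfolding g(2) .
qed

text \<open>Either \<open>half u i\<close> or its complement, which is again a half-tree, does not contain \<open>v\<close>. That one
  lies in a single branch at \<open>v\<close>, because all geodesics from \<open>v\<close> into it have the same first color.\<close>

lemma half_position: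
  assumes "u \<in> V" "i \<in> C" "v \<in> V" "j \<in> C"
  shows "half u i \<subseteq> half v j \<or> half v j \<subseteq> half u i \<or> half u i \<inter> half v j = {} \<or>
    V - half u i \<subseteq> half v j"
proof -
  have key: "half a k \<subseteq> half v j \<or> half a k \<inter> half v j = {}"
    if a: "a \<in> V" "k \<in> C" "v \<notin> half a k" for a k
  proof -
    have "geod v x \<noteq> [] \<and> hd (geod v x) = hd (geod v a @ [k])" if "x \<in> half a k" for x
    proof -
      obtain w' where "x = walk v (geod v a @ k # w')" "reduced (geod v a @ k # w')"
        using \<open>x \<in> half a k\<close> half_outside(1)[OF a(1) assms(3) a(2,3)] by blast
      then have "geod v x = geod v a @ k # w'" using geod_eqI assms by blast
      then show ?thesis by (simp add: hd_append)
    qed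
    then show ?thesis
      using half_subset[OF a(1,2)] by (auto simp: mem_half_iff[OF assms(3,4)] subset_iff)
  qed
  show ?thesis
  proof (cases "v \<in> half u i")
    case True
    have "V - half u i \<subseteq> half v j \<or> (V - half u i) \<inter> half v j = {}"
      using key[of "nb u i" i] unfolding half_complement[OF assms(1,2)]
      using True assms nb_closed by blast
    then show ?thesis using half_subset[OF assms(3,4)] by blast
  next
    case False
    then show ?thesis using key[OF assms(1,2)] by blast
  qed
qed

section \<open>Automorphisms and local actions\<close>

definition aut :: "('v \<Rightarrow> 'v) set" where
  "aut = {g. g permutes V \<and> (\<forall>v\<in>V. \<forall>i\<in>C. \<exists>j\<in>C. g (nb v i) = nb (g v) j)}"

text \<open>The local action \<open>\<sigma>(g,v)\<close>, extended by the identity outside of the colors.\<close>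

definition loc :: "('v \<Rightarrow> 'v) \<Rightarrow> 'v \<Rightarrow> 'c \<Rightarrow> 'c" where
  "loc g v = (\<lambda>i. if i \<in> C then THE j. j \<in> C \<and> g (nb v i) = nb (g v) j else i)"

lemma aut_bij: "g \<in> aut \<Longrightarrow> bij g"
  by (auto simp: aut_def intro: permutes_bij)

lemma aut_mem: "g \<in> aut \<Longrightarrow> g x \<in> V \<longleftrightarrow> x \<in> V"
  by (simp add: aut_def permutes_in_image)

lemma aut_outside: "g \<in> aut \<Longrightarrow> x \<notin> V \<Longrightarrow> g x = x"
  by (simp add: aut_def permutes_def)

lemma loc_eqI: "g v \<in> V \<Longrightarrow> i \<in> C \<Longrightarrow> j \<in> C \<Longrightarrow> g (nb v i) = nb (g v) j \<Longrightarrow> loc g v i = j"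
  unfolding loc_def using nb_inj by (auto intro!: the_equality)

lemma loc_nb:
  assumes "g \<in> aut" "v \<in> V" "i \<in> C"
  shows "loc g v i \<in> C" "g (nb v i) = nb (g v) (loc g v i)"
proof -
  obtain j where "j \<in> C" "g (nb v i) = nb (g v) j" using assms by (auto simp: aut_def)
  then show "loc g v i \<in> C" "g (nb v i) = nb (g v) (loc g v i)"
    using loc_eqI[of g v i j] assms aut_mem[of g v] by auto
qed

lemma loc_outside: "i \<notin> C \<Longrightarrow> loc g v i = i"
  by (simp add: loc_def)

lemma loc_permutes:
  assumes "g \<in> aut" "v \<in> V"
  shows "loc g v permutes C"
proof (rule bij_imp_permutes)
  have "inj_on (loc g v) C"
  proof (rule inj_onI)
    fix i j assume *: "i \<in> C" "j \<in> C" "loc g v i = loc g v j"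
    then have "g (nb v i) = g (nb v j)" using loc_nb[OF assms] by simp
    then have "nb v i = nb v j" using aut_bij[OF assms(1)] by (metis bij_inv_simps(1))
    then show "i = j" using * nb_inj assms by blast
  qed
  moreover have "loc g v ` C \<subseteq> C" using loc_nb[OF assms] by auto
  ultimately show "bij_betw (loc g v) C C"
    using endo_inj_surj[OF finite_C] by (simp add: bij_betw_def)
qed (simp add: loc_outside)

text \<open>This uses that the coloring is legal: both ends of an edge, and of its image, see the same
  color.\<close>

lemma loc_edge:
  assumes "g \<in> aut" "v \<in> V" "i \<in> C"
  shows "loc g (nb v i) i = loc g v i"
proof (rule loc_eqI)
  show "g (nb v i) \<in> V" using assms by (simp add: aut_mem[OF assms(1)] nb_closed)
  show "g (nb (nb v i) i) = nb (g (nb v i)) (loc g v i)"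
    using loc_nb[OF assms] assms by (simp add: nb_nb aut_mem[OF assms(1)])
qed (use loc_nb[OF assms] assms in auto)

lemma aut_comp:
  assumes "g \<in> aut" "h \<in> aut"
  shows "g \<circ> h \<in> aut"
proof -
  have "g \<circ> h permutes V" using assms permutes_compose[of h V g] by (simp add: aut_def)
  moreover have "\<exists>j\<in>C. (g \<circ> h) (nb v i) = nb ((g \<circ> h) v) j" if "v \<in> V" "i \<in> C" for v i
  proof -
    have "h v \<in> V" using aut_mem[OF assms(2)] that by blast
    then show ?thesis
      using loc_nb[OF assms(2) that] loc_nb[OF assms(1), of "h v" "loc h v i"] by auto
  qed
  ultimately show ?thesis by (simp add: aut_def)
qed

lemma aut_inv:
  assumes "g \<in> aut"
  shows "inv' g \<in> aut"
proof -
  have p: "inv' g permutes V" using assms permutes_inv by (auto simp: aut_def)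
  have "\<exists>j\<in>C. inv' g (nb v i) = nb (inv' g v) j" if v: "v \<in> V" and i: "i \<in> C" for v i
  proof -
    let ?u = "inv' g v"
    have u: "?u \<in> V" using permutes_in_image[OF p] v by blast
    have "i \<in> loc g ?u ` C" unfolding permutes_image[OF loc_permutes[OF assms u]] by (rule i)
    then obtain j where j: "j \<in> C" "loc g ?u j = i" by blast
    then have "g (nb ?u j) = nb v i" using loc_nb[OF assms u] bij_inv_simps[OF aut_bij[OF assms]] by simp
    then have "inv' g (nb v i) = nb ?u j" using bij_inv_simps[OF aut_bij[OF assms]] by metis
    then show ?thesis using j by blast
  qed
  then show ?thesis using p by (simp add: aut_def)
qed

lemma aut_id: "id \<in> aut"
  by (auto simp: aut_def permutes_id)

lemma loc_comp:
  assumes "g \<in> aut" "h \<in> aut" "v \<in> V"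
  shows "loc (g \<circ> h) v = loc g (h v) \<circ> loc h v"
proof
  fix i
  show "loc (g \<circ> h) v i = (loc g (h v) \<circ> loc h v) i"
  proof (cases "i \<in> C")
    case True
    then show ?thesis using assms loc_nb[of h v i] loc_nb[of g "h v" "loc h v i"] aut_mem[of h v] aut_mem[of g "h v"]
      by (intro loc_eqI) auto
  qed (simp add: loc_outside)
qed

lemma loc_id: "v \<in> V \<Longrightarrow> loc id v = id"
proof
  fix i assume "v \<in> V"
  then show "loc id v i = id i"
    by (cases "i \<in> C") (auto simp: loc_outside intro: loc_eqI)
qed

lemma loc_inv:
  assumes "g \<in> aut" "v \<in> V"
  shows "loc (inv' g) v = inv' (loc g (inv' g v))"
proof -
  have *: "inv' g v \<in> V" using aut_mem[OF aut_inv] assms by blast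
  have "loc g (inv' g v) \<circ> loc (inv' g) v = id"
    using loc_comp[OF assms(1) aut_inv[OF assms(1)] assms(2)] bij_inv_simps[OF aut_bij[OF assms(1)]]
      loc_id[OF assms(2)] by simp
  then show ?thesis
    using bij_inv_simps[OF permutes_bij[OF loc_permutes[OF assms(1) *]]]
    by (metis comp_assoc comp_id id_comp)
qed

subsection \<open>Prescribing local actions\<close>

text \<open>The color word of the image of the walk \<open>w\<close> from \<open>v\<close>, if the local actions are given by \<open>\<tau>\<close>.\<close>

primrec transl :: "('v \<Rightarrow> 'c \<Rightarrow> 'c) \<Rightarrow> 'v \<Rightarrow> 'c list \<Rightarrow> 'c list" where
  "transl \<tau> v [] = []"
| "transl \<tau> v (i # w) = \<tau> v i # transl \<tau> (nb v i) w"

text \<open>The condition of \<open>loc_edge\<close>, which is the only constraint on the local actions of an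
  automorphism (\<open>aut_exists\<close>).\<close>

definition compatible :: "('v \<Rightarrow> 'c \<Rightarrow> 'c) \<Rightarrow> bool" where
  "compatible \<tau> \<longleftrightarrow> (\<forall>v\<in>V. \<tau> v permutes C \<and> (\<forall>i\<in>C. \<tau> (nb v i) i = \<tau> v i))"

lemma compatible_loc: "g \<in> aut \<Longrightarrow> compatible (loc g)"
  by (simp add: compatible_def loc_permutes loc_edge)

lemma compatibleD:
  assumes "compatible \<tau>" "v \<in> V"
  shows "\<tau> v permutes C" "i \<in> C \<Longrightarrow> \<tau> v i \<in> C" "\<tau> v i = \<tau> v j \<longleftrightarrow> i = j" "i \<in> C \<Longrightarrow> \<tau> (nb v i) i = \<tau> v i"
  using assms permutes_in_image[of "\<tau> v" C] permutes_inj[of "\<tau> v" C] 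
  by (auto simp: compatible_def dest: injD)

lemma transl_append: "transl \<tau> v (w @ w') = transl \<tau> v w @ transl \<tau> (walk v w) w'"
  by (induction w arbitrary: v) auto

lemma transl_Nil_iff: "transl \<tau> v w = [] \<longleftrightarrow> w = []"
  by (cases w) auto

lemma transl_reduced:
  assumes "compatible \<tau>"
  shows "v \<in> V \<Longrightarrow> reduced w \<Longrightarrow> reduced (transl \<tau> v w)"
proof (induction w arbitrary: v)
  case (Cons i w)
  note \<tau> = compatibleD[OF assms]
  have *: "reduced (transl \<tau> (nb v i) w)" "\<tau> v i \<in> C"
    using Cons \<tau> by (auto simp: nb_closed)
  show ?case
  proof (cases w)
    case (Cons j w')
    then show ?thesis using * Cons.prems \<tau>(3)[of "nb v i" j i] \<tau>(4)[of v i] by (auto simp: nb_closed)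
  qed (use * in simp)
qed simp

lemma transl_inj:
  assumes "compatible \<tau>"
  shows "v \<in> V \<Longrightarrow> set w \<subseteq> C \<Longrightarrow> set w' \<subseteq> C \<Longrightarrow> transl \<tau> v w = transl \<tau> v w' \<Longrightarrow> w = w'"
proof (induction w arbitrary: v w')
  case Nil
  then show ?case by (metis transl_Nil_iff)
next
  case (Cons i w)
  then obtain j w'' where w': "w' = j # w''" by (cases w') auto
  then have "i = j" using Cons.prems compatibleD(3)[OF assms] by auto
  moreover have "w = w''"
    using Cons.prems w' \<open>i = j\<close> by (intro Cons.IH[of "nb v i"]) (simp_all add: nb_closed)
  ultimately show ?case using w' by simp
qed

lemma aut_walk:
  "g \<in> aut \<Longrightarrow> v \<in> V \<Longrightarrow> set w \<subseteq> C \<Longrightarrow> g (walk v w) = walk (g v) (transl (loc g) v w)"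
proof (induction w arbitrary: v)
  case (Cons i w)
  then show ?case using loc_nb[of g v i] by (simp add: nb_closed)
qed simp

text \<open>The image of a vertex is found by translating the color word of the geodesic from \<open>v0\<close>.
  Compatible local actions keep words reduced, so the map is injective and the translation can be read
  off from any vertex.\<close>

lemma aut_exists:
  assumes \<tau>: "compatible \<tau>" and v0: "v0 \<in> V" and w0: "w0 \<in> V"
  obtains g where "g \<in> aut" "g v0 = w0" "\<And>v. v \<in> V \<Longrightarrow> loc g v = \<tau> v"
proof -
  define g where "g x = (if x \<in> V then walk w0 (transl \<tau> v0 (geod v0 x)) else x)" for x
  note T = compatibleD[OF \<tau>]
  have red: "reduced (transl \<tau> v0 (geod v0 x))" if "x \<in> V" for x
    using transl_reduced[OF \<tau>] v0 geod_props that by blast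
  have closed: "g x \<in> V" if "x \<in> V" for x
    using red[OF that] that walk_closed[OF w0] reduced_letters by (simp add: g_def)
  have g_nb: "g (nb x i) = nb (g x) (\<tau> x i)" if x: "x \<in> V" and i: "i \<in> C" for x i
  proof -
    have ext: "g (nb y j) = nb (g y) (\<tau> y j)" 
      if y: "y \<in> V" "j \<in> C" "geod v0 (nb y j) = geod v0 y @ [j]" for y j
      using y by (simp add: g_def nb_closed transl_append geod_props v0)
    show ?thesis
    proof (cases "geod v0 x \<noteq> [] \<and> last (geod v0 x) = i")
      case True
      let ?y = "nb x i"
      have y: "?y \<in> V" "nb ?y i = x" using x i by (auto simp: nb_closed nb_nb)
      have "geod v0 ?y = butlast (geod v0 x)" using geod_nb[OF v0 x i] True by simp
      then have "geod v0 (nb ?y i) = geod v0 ?y @ [i]"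
        using True y(2) by (metis append_butlast_last_id)
      then have "g x = nb (g ?y) (\<tau> ?y i)" using ext[OF y(1) i] y(2) by simp
      moreover have "\<tau> ?y i = \<tau> x i" using T(4) x i by blast
      ultimately show ?thesis using nb_nb closed y T(2)[OF x i] by simp
    next
      case False
      have "geod v0 (nb x i) = geod v0 x @ [i]" by (rule trans[OF geod_nb[OF v0 x i] if_not_P[OF False]])
      then show ?thesis using ext x i by blast
    qed
  qed
  have g0: "g v0 = w0" using v0 by (simp add: g_def geod_self)
  have "inj_on g V"
  proof (rule inj_onI)
    fix x y assume *: "x \<in> V" "y \<in> V" "g x = g y"
    then have "transl \<tau> v0 (geod v0 x) = transl \<tau> v0 (geod v0 y)"
      using reduced_unique[OF w0 red red] by (simp add: g_def)
    then have "geod v0 x = geod v0 y"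
      using transl_inj[OF \<tau> v0] geod_props(1)[OF v0] reduced_letters * by blast
    then show "x = y" using geod_props(2)[OF v0] * by metis
  qed
  moreover have "g ` V = V"
  proof (intro equalityI subsetI)
    fix y assume "y \<in> V"
    then show "y \<in> g ` V" using w0
    proof (induction rule: connected_induct)
      case base
      show ?case using g0 v0 by blast
    next
      case (step y j)
      then obtain x where x: "x \<in> V" "y = g x" by blast
      have "j \<in> \<tau> x ` C" unfolding permutes_image[OF T(1)[OF x(1)]] by (rule step(2))
      then obtain i where i: "i \<in> C" "\<tau> x i = j" by blast
      then have "g (nb x i) = nb y j" "nb x i \<in> V" using g_nb[OF x(1) i(1)] x nb_closed by auto
      then show ?case by (metis imageI)
    qed
  qed (use closed in blast)
  ultimately have "g permutes V"
    by (intro bij_imp_permutes) (auto simp: bij_betw_def g_def)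
  then have "g \<in> aut" using g_nb T(2) by (auto simp: aut_def)
  moreover have "loc g v = \<tau> v" if "v \<in> V" for v
  proof
    fix i show "loc g v i = \<tau> v i"
    proof (cases "i \<in> C")
      case True
      then show ?thesis using that closed T(2) g_nb by (intro loc_eqI) auto
    next
      case False
      then show ?thesis using T(1)[OF that] by (simp add: loc_outside permutes_def)
    qed
  qed
  ultimately show ?thesis using that g0 by blast
qed

text \<open>The automorphisms with trivial local actions are the left translations of the Cayley graph; they
  are transitive on the vertices.\<close>

lemma color_preserving_exists:
  assumes "u \<in> V" "v \<in> V"
  obtains t where "t \<in> aut" "t u = v" "\<And>x. x \<in> V \<Longrightarrow> loc t x = id"
  using aut_exists[of "\<lambda>_. id" u v] assms by (auto simp: compatible_def permutes_id)

text \<open>Left translations commute with right multiplication.\<close>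

lemma color_preserving_walk:
  assumes "t \<in> aut" "\<And>x. x \<in> V \<Longrightarrow> loc t x = id" "x \<in> V" "set w \<subseteq> C"
  shows "t (walk x w) = walk (t x) w"
  using assms(3,4)
proof (induction w arbitrary: x)
  case (Cons i w)
  then show ?case using loc_nb[OF assms(1), of x i] assms(2)[of x] nb_closed by simp
qed simp

lemma color_preserving_power:
  assumes "t \<in> aut" "\<And>x. x \<in> V \<Longrightarrow> loc t x = id"
  shows "t ^^ n \<in> aut \<and> (\<forall>x\<in>V. loc (t ^^ n) x = id)"
proof (induction n)
  case 0
  show ?case unfolding funpow.simps using aut_id loc_id by blast
next
  case (Suc n)
  then have p: "t ^^ n \<in> aut" by blast
  have "loc (t \<circ> t ^^ n) x = id" if "x \<in> V" for x
  proof -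
    have y: "(t ^^ n) x \<in> V" using aut_mem[OF p] that by blast
    have "loc (t ^^ n) x = id" using Suc that by blast
    then show ?thesis by (simp only: loc_comp[OF assms(1) p that] assms(2)[OF y] id_comp)
  qed
  then show ?case unfolding funpow.simps using aut_comp[OF assms(1) p] by blast
qed

lemma color_preserving_walk_power:
  assumes t: "t \<in> aut" "\<And>x. x \<in> V \<Longrightarrow> loc t x = id" and v: "v \<in> V" and w: "set w \<subseteq> C" "t v = walk v w"
  shows "(t ^^ n) v = walk v (concat (replicate n w))"
proof (induction n)
  case (Suc n)
  have c: "set (concat (replicate n w)) \<subseteq> C" using w by (auto split: if_splits)
  have "(t ^^ Suc n) v = t (walk v (concat (replicate n w)))" using Suc by simp
  also have "\<dots> = walk (walk v w) (concat (replicate n w))" using color_preserving_walk[OF t v c] w by simp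
  finally show ?case by simp
qed simp

subsection \<open>Automorphisms and half-trees\<close>

lemma aut_half_subset:
  assumes "g \<in> aut" "v \<in> V" "i \<in> C"
  shows "g ` half v i \<subseteq> half (g v) (loc g v i)"
proof
  fix y assume "y \<in> g ` half v i"
  then obtain w where w: "y = g (walk v (i # w))" "reduced (i # w)" unfolding half_def by blast
  have y: "y = walk (g v) (transl (loc g) v (i # w))"
    unfolding w(1) using aut_walk[OF assms(1,2) reduced_letters[OF w(2)]] .
  have "reduced (transl (loc g) v (i # w))"
    using transl_reduced[OF compatible_loc[OF assms(1)] assms(2) w(2)] .
  with y show "y \<in> half (g v) (loc g v i)" unfolding half_def transl.simps by blast
qed

lemma aut_half:
  assumes "g \<in> aut" "v \<in> V" "i \<in> C"
  shows "g ` half v i = half (g v) (loc g v i)"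
proof (rule equalityI[OF aut_half_subset[OF assms]])
  let ?j = "loc g v i"
  have b: "bij g" using aut_bij assms by blast
  have gv: "g v \<in> V" "?j \<in> C" using aut_mem[OF assms(1)] loc_nb[OF assms] assms by auto
  have l: "loc (inv' g) (g v) ?j = i"
    using loc_inv[OF assms(1) gv(1)] bij_inv_simps[OF b]
      bij_inv_simps[OF permutes_bij[OF loc_permutes[OF assms(1,2)]]] by simp
  have "inv' g ` half (g v) ?j \<subseteq> half v i"
    using aut_half_subset[OF aut_inv[OF assms(1)] gv] l bij_inv_simps[OF b] by simp
  then show "half (g v) ?j \<subseteq> g ` half v i" using bij_inv_simps[OF b] by (metis image_iff image_subset_iff subsetI)
qed

text \<open>An automorphism with trivial local actions on a half-tree is determined there by the image of
  the bounding edge.\<close>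

lemma half_fixed:
  assumes "g \<in> aut" "v \<in> V" "i \<in> C" "g v = v" "loc g v i = i" "\<And>x. x \<in> half v i \<Longrightarrow> loc g x = id"
    and "x \<in> half v i"
  shows "g x = x"
proof -
  have "reduced (i # w) \<Longrightarrow> g (walk v (i # w)) = walk v (i # w)" for w
  proof (induction w rule: rev_induct)
    case Nil
    then show ?case using assms loc_nb[of g v i] by simp
  next
    case (snoc j w)
    let ?x = "walk v (i # w)"
    have red: "reduced (i # w)" "j \<in> C" using snoc.prems by (auto simp: reduced_append split: if_splits)
    then have x: "?x \<in> half v i" unfolding half_def by blast
    then have "?x \<in> V" using half_subset assms by blast
    then have "g (nb ?x j) = nb (g ?x) j" using loc_nb[OF assms(1)] red assms(6)[OF x] by simp
    then show ?case using snoc.IH[OF red(1)] by simp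
  qed
  then show ?thesis using assms(7) unfolding half_def by blast
qed

text \<open>Automorphisms that fix the bounding edges of disjoint half-trees may be glued to the identity
  outside of the half-trees, possibly infinitely many. By the condition \<open>apex\<close>, the outer ends of the
  bounding edges lie in none of the half-trees, so the glued map fixes the bounding edges.\<close>

lemma patch_aut:
  fixes u :: "'k \<Rightarrow> 'v"
  assumes i: "i \<in> C" and u: "\<And>n. n \<in> I \<Longrightarrow> u n \<in> V" and g: "\<And>n. n \<in> I \<Longrightarrow> g n \<in> aut"
    and fix_u: "\<And>n. n \<in> I \<Longrightarrow> g n (u n) = u n" and fix_i: "\<And>n. n \<in> I \<Longrightarrow> loc (g n) (u n) i = i"
    and disj: "\<And>m n. m \<in> I \<Longrightarrow> n \<in> I \<Longrightarrow> m \<noteq> n \<Longrightarrow> half (u m) i \<inter> half (u n) i = {}"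
    and apex: "\<And>m n. m \<in> I \<Longrightarrow> n \<in> I \<Longrightarrow> m \<noteq> n \<Longrightarrow> u m \<notin> half (u n) i"
    and h: "\<And>n x. n \<in> I \<Longrightarrow> x \<in> half (u n) i \<Longrightarrow> h x = g n x"
      "\<And>x. (\<And>n. n \<in> I \<Longrightarrow> x \<notin> half (u n) i) \<Longrightarrow> h x = x"
  shows "h \<in> aut" "\<And>n x. n \<in> I \<Longrightarrow> x \<in> half (u n) i \<Longrightarrow> loc h x = loc (g n) x"
    "\<And>x. x \<in> V \<Longrightarrow> (\<And>n. n \<in> I \<Longrightarrow> x \<notin> half (u n) i) \<Longrightarrow> loc h x = id"
proof -
  let ?U = "\<lambda>n. half (u n) i"
  have img: "g n ` ?U n = ?U n" if "n \<in> I" for n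
    using aut_half[OF g[OF that] u[OF that] i] fix_u fix_i that by simp
  have mem: "h x \<in> ?U n" if "n \<in> I" "x \<in> ?U n" for n x
    using img[OF that(1)] h(1)[OF that] that by auto
  have sub: "?U n \<subseteq> V" if "n \<in> I" for n using half_subset u i that by blast
  have hu: "h (u n) = u n" if "n \<in> I" for n
  proof (rule h(2))
    fix m assume "m \<in> I"
    then show "u n \<notin> ?U m" using apex that base_notin_half u i by (cases "n = m") auto
  qed
  have cases: thesis if "\<And>n. n \<in> I \<Longrightarrow> x \<in> ?U n \<Longrightarrow> thesis" "(\<And>n. n \<in> I \<Longrightarrow> x \<notin> ?U n) \<Longrightarrow> thesis" for x thesis
    using that by blast
  have closed: "h x \<in> V" if "x \<in> V" for x
    by (rule cases[of x]) (use mem sub h(2) that in auto)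
  have "inj_on h V"
  proof (rule inj_onI)
    fix x y assume xy: "x \<in> V" "y \<in> V" "h x = h y"
    have *: "a = b" if "n \<in> I" "a \<in> ?U n" "h a = h b" for n a b
    proof -
      have "b \<in> ?U n"
      proof (rule cases[of b])
        fix m assume m: "m \<in> I" "b \<in> ?U m"
        then have "h a \<in> ?U n \<inter> ?U m" using mem[OF that(1,2)] mem[OF m] that(3) by simp
        then have "m = n" using disj[OF m(1) that(1)] by blast
        then show ?thesis using m(2) by simp
      next
        assume "\<And>n. n \<in> I \<Longrightarrow> b \<notin> ?U n"
        then have "h b = b" by (rule h(2))
        then show ?thesis using mem[OF that(1,2)] that(3) by simp
      qed
      then have "g n a = g n b" using h(1)[OF that(1)] that(2,3) by metis
      then show "a = b" using aut_bij[OF g[OF that(1)]] by (metis bij_inv_simps(1))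
    qed
    show "x = y"
    proof (rule cases[of x])
      fix n assume "n \<in> I" "x \<in> ?U n"
      then show ?thesis using * xy by blast
    next
      assume x: "\<And>n. n \<in> I \<Longrightarrow> x \<notin> ?U n"
      show ?thesis
      proof (rule cases[of y])
        fix n assume "n \<in> I" "y \<in> ?U n"
        then show ?thesis using *[of n y x] xy by simp
      next
        assume "\<And>n. n \<in> I \<Longrightarrow> y \<notin> ?U n"
        then show ?thesis using h(2) x xy by metis
      qed
    qed
  qed
  moreover have "h ` V = V"
  proof (intro equalityI subsetI)
    fix y assume y: "y \<in> V"
    show "y \<in> h ` V"
    proof (rule cases[of y])
      fix n assume n: "n \<in> I" "y \<in> ?U n"
      then obtain x where "x \<in> ?U n" "y = g n x" using img by blast
      then have "y = h x" "x \<in> V" using h(1)[OF n(1)] sub[OF n(1)] by auto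
      then show ?thesis by (rule image_eqI)
    next
      assume "\<And>n. n \<in> I \<Longrightarrow> y \<notin> ?U n"
      then have "y = h y" using h(2)[of y] by simp
      then show ?thesis using y by (rule image_eqI)
    qed
  qed (use closed in blast)
  moreover have "h x = x" if "x \<notin> V" for x using h(2) sub that by blast
  ultimately have perm: "h permutes V" by (intro bij_imp_permutes) (auto simp: bij_betw_def)
  have inside: "h (nb x j) = nb (h x) (loc (g n) x j)" if n: "n \<in> I" and x: "x \<in> ?U n" and j: "j \<in> C" for n x j
  proof (cases "nb x j \<in> ?U n")
    case True
    have "x \<in> V" using sub[OF n] x by blast
    then show ?thesis using h(1)[OF n x] h(1)[OF n True] loc_nb(2)[OF g[OF n] _ j] by simp
  next
    case False
    then have eq: "x = nb (u n) i" "j = i" using half_boundary[OF u[OF n] i j x] by auto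
    have "nb x j = u n" using eq nb_nb u n i by simp
    moreover have "h x = x" using h(1)[OF n x] eq fix_u fix_i loc_nb[OF g[OF n] u[OF n] i] n by simp
    moreover have "loc (g n) x j = j" using eq loc_edge[OF g[OF n] u[OF n] i] fix_i n by simp
    ultimately show ?thesis using hu n by simp
  qed
  have outside: "h (nb x j) = nb (h x) j"
    if x: "x \<in> V" "\<And>n. n \<in> I \<Longrightarrow> x \<notin> ?U n" and j: "j \<in> C" for x j
  proof (rule cases[of "nb x j"])
    fix n assume n: "n \<in> I" "nb x j \<in> ?U n"
    have "nb (nb x j) j = x" using nb_nb x j by blast
    then have eq: "nb x j = nb (u n) i" "j = i"
      using half_boundary[OF u[OF n(1)] i j n(2)] x(2)[OF n(1)] by auto
    have "h (nb x j) = g n (nb (u n) i)" using h(1)[OF n] eq(1) by simp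
    also have "\<dots> = nb (u n) i"
      using loc_nb(2)[OF g[OF n(1)] u[OF n(1)] i] fix_u[OF n(1)] fix_i[OF n(1)] by simp
    finally show ?thesis using h(2)[OF x(2)] eq(1) by simp
  next
    assume "\<And>n. n \<in> I \<Longrightarrow> nb x j \<notin> ?U n"
    then show ?thesis using h(2)[of "nb x j"] h(2)[OF x(2)] by simp
  qed
  have "\<exists>k\<in>C. h (nb x j) = nb (h x) k" if "x \<in> V" "j \<in> C" for x j
  proof (rule cases[of x])
    fix n assume n: "n \<in> I" "x \<in> ?U n"
    then show ?thesis using inside[OF n that(2)] loc_nb[OF g[OF n(1)] that] by blast
  next
    assume "\<And>n. n \<in> I \<Longrightarrow> x \<notin> ?U n"
    then show ?thesis using outside[OF that(1) _ that(2)] that(2) by blast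
  qed
  then show "h \<in> aut" using perm by (simp add: aut_def)
  show "loc h x = loc (g n) x" if n: "n \<in> I" "x \<in> ?U n" for n x
  proof
    fix j
    show "loc h x j = loc (g n) x j"
    proof (cases "j \<in> C")
      case True
      have "x \<in> V" using sub[OF n(1)] n(2) by blast
      then show ?thesis using inside[OF n True] closed loc_nb(1)[OF g[OF n(1)] _ True] True
        by (intro loc_eqI) auto
    qed (simp add: loc_outside)
  qed
  show "loc h x = id" if x: "x \<in> V" "\<And>n. n \<in> I \<Longrightarrow> x \<notin> ?U n" for x
  proof
    fix j
    show "loc h x j = id j"
    proof (cases "j \<in> C")
      case True
      then show ?thesis using outside[OF x True] closed[OF x(1)] by (simp add: loc_eqI)
    qed (simp add: loc_outside)
  qed
qed

end

section \<open>Restricted Burger--Mozes groups\<close>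

locale burger_mozes = colored_tree V C nb
  for V :: "'v set" and C :: "'c set" and nb :: "'v \<Rightarrow> 'c \<Rightarrow> 'v" +
  fixes F F' :: "('c \<Rightarrow> 'c) set"
  assumes F_closed: "perm_closed F" and F'_closed: "perm_closed F'" and F_sub: "F \<subseteq> F'"
    and F'_permutes: "a \<in> F' \<Longrightarrow> a permutes C"
    and same_orbits: "a \<in> F' \<Longrightarrow> i \<in> C \<Longrightarrow> \<exists>f\<in>F. f i = a i"
begin

definition sing :: "('v \<Rightarrow> 'v) \<Rightarrow> 'v set" where
  "sing g = {v \<in> V. loc g v \<notin> F}"

definition BM :: "('v \<Rightarrow> 'v) set" where
  "BM = {g \<in> aut. (\<forall>v\<in>V. loc g v \<in> F') \<and> finite (sing g)}"

lemma BM_aut: "g \<in> BM \<Longrightarrow> g \<in> aut"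
  by (simp add: BM_def)

lemma BM_bij: "g \<in> BM \<Longrightarrow> bij g"
  by (simp add: BM_aut aut_bij)

lemma BM_loc: "g \<in> BM \<Longrightarrow> v \<in> V \<Longrightarrow> loc g v \<in> F'"
  by (simp add: BM_def)

lemma BM_I: "g \<in> aut \<Longrightarrow> (\<And>v. v \<in> V \<Longrightarrow> loc g v \<in> F') \<Longrightarrow> finite (sing g) \<Longrightarrow> g \<in> BM"
  by (simp add: BM_def)

lemma sing_comp:
  assumes "g \<in> aut" "h \<in> aut"
  shows "sing (g \<circ> h) \<subseteq> sing h \<union> inv' h ` sing g"
proof
  fix v assume v: "v \<in> sing (g \<circ> h)"
  then have V: "v \<in> V" by (simp add: sing_def)
  have hV: "h v \<in> V" using aut_mem[OF assms(2)] V by blast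
  show "v \<in> sing h \<union> inv' h ` sing g"
  proof (cases "loc g (h v) \<in> F")
    case True
    then have "loc h v \<notin> F"
      using v loc_comp[OF assms V] perm_closedD(2)[OF F_closed] by (auto simp: sing_def)
    then show ?thesis using V by (simp add: sing_def)
  next
    case False
    then have "h v \<in> sing g" using hV by (simp add: sing_def)
    then show ?thesis using bij_inv_simps(1)[OF aut_bij[OF assms(2)], of v] by (metis UnI2 imageI)
  qed
qed

lemma sing_inv:
  assumes "g \<in> aut"
  shows "sing (inv' g) \<subseteq> g ` sing g"
proof
  fix v assume v: "v \<in> sing (inv' g)"
  then have V: "v \<in> V" by (simp add: sing_def)
  have iV: "inv' g v \<in> V" using aut_mem[OF aut_inv[OF assms]] V by blast
  have "loc g (inv' g v) \<notin> F"
    using v loc_inv[OF assms V] perm_closedD(3)[OF F_closed] by (auto simp: sing_def)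
  then have "inv' g v \<in> sing g" using iV by (simp add: sing_def)
  then show "v \<in> g ` sing g" using bij_inv_simps(2)[OF aut_bij[OF assms], of v] by (metis imageI)
qed

lemma sing_outer: "v \<in> V \<Longrightarrow> v \<notin> sing g \<Longrightarrow> loc g v \<in> F"
  by (simp add: sing_def)

lemma BM_closed: "perm_closed BM"
proof (rule perm_closedI)
  note F' = perm_closedD[OF F'_closed]
  have "sing id = {}" using perm_closedD(1)[OF F_closed] by (auto simp: sing_def loc_id)
  then show "id \<in> BM" using F'(1) by (intro BM_I) (simp_all add: aut_id loc_id)
  show "g \<circ> h \<in> BM" if "g \<in> BM" "h \<in> BM" for g h
  proof (rule BM_I)
    show "g \<circ> h \<in> aut" using that by (simp add: BM_aut aut_comp)
    show "loc (g \<circ> h) v \<in> F'" if "v \<in> V" for v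
      using loc_comp[of g h v] \<open>g \<in> BM\<close> \<open>h \<in> BM\<close> that F'(2) aut_mem[of h v] by (simp add: BM_aut BM_loc)
    show "finite (sing (g \<circ> h))"
      using finite_subset[OF sing_comp[of g h]] that by (simp add: BM_def)
  qed
  show "inv' g \<in> BM" if "g \<in> BM" for g
  proof (rule BM_I)
    show "inv' g \<in> aut" using that by (simp add: BM_aut aut_inv)
    then show "loc (inv' g) v \<in> F'" if "v \<in> V" for v
      using loc_inv[of g v] \<open>g \<in> BM\<close> that F'(3) aut_mem[of "inv' g" v] by (simp add: BM_aut BM_loc)
    show "finite (sing (inv' g))"
      using finite_subset[OF sing_inv[of g]] that by (simp add: BM_def)
  qed
qed

lemmas BM_id = perm_closedD(1)[OF BM_closed]
lemmas BM_comp = perm_closedD(2)[OF BM_closed]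
lemmas BM_inv = perm_closedD(3)[OF BM_closed]

lemma BM_conj: "g \<in> BM \<Longrightarrow> h \<in> BM \<Longrightarrow> g \<circ> h \<circ> inv' g \<in> BM"
  by (simp add: BM_comp BM_inv)

lemma BM_commut: "g \<in> BM \<Longrightarrow> h \<in> BM \<Longrightarrow> commut g h \<in> BM"
  by (simp add: commut_def BM_comp BM_inv)

lemma regular_BM:
  assumes "g \<in> aut" "\<And>v. v \<in> V \<Longrightarrow> loc g v \<in> F"
  shows "g \<in> BM" "sing g = {}"
proof -
  show s: "sing g = {}" using assms(2) by (auto simp: sing_def)
  show "g \<in> BM" using assms F_sub s by (intro BM_I) auto
qed

lemma color_preserving_BM:
  assumes "u \<in> V" "v \<in> V"
  obtains t where "t \<in> BM" "t u = v" "\<And>x. x \<in> V \<Longrightarrow> loc t x = id" "sing t = {}"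
proof -
  obtain t where t: "t \<in> aut" "t u = v" "\<And>x. x \<in> V \<Longrightarrow> loc t x = id"
    using color_preserving_exists[OF assms] by blast
  show thesis using that[of t] t regular_BM[of t] perm_closedD(1)[OF F_closed] by simp
qed

text \<open>Beyond the edge of color \<open>j\<close> at \<open>v\<close>, all local actions are equal to one element of \<open>F\<close> that
  agrees with \<open>a\<close> at \<open>j\<close>. It exists because \<open>F\<close> and \<open>F'\<close> have the same orbits, and compatibility is
  only a condition at \<open>v\<close>.\<close>

lemma local_action_realized:
  assumes a: "a \<in> F'" and v: "v \<in> V"
  obtains r where "r \<in> BM" "r v = v" "loc r v = a" "sing r \<subseteq> {v}"
    "\<And>i x. i \<in> C \<Longrightarrow> a i = i \<Longrightarrow> x \<in> half v i \<Longrightarrow> r x = x"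
proof -
  \<comment> \<open>The choice of \<open>id\<close> makes the element trivial on the branches of the colors fixed by \<open>a\<close>.\<close>
  define f where "f j = (if a j = j then id else SOME f. f \<in> F \<and> f j = a j)" for j
  have f: "f j \<in> F \<and> f j j = a j" if "j \<in> C" for j
  proof (cases "a j = j")
    case False
    have "\<exists>f. f \<in> F \<and> f j = a j" using same_orbits[OF a that] by blast
    from someI_ex[OF this] show ?thesis using False by (simp add: f_def)
  qed (use perm_closedD(1)[OF F_closed] in \<open>simp add: f_def\<close>)
  define \<tau> where "\<tau> x = (if x = v then a else f (hd (geod v x)))" for x
  have branch: "hd (geod v x) \<in> C" "geod v x \<noteq> []" if "x \<in> V" "x \<noteq> v" for x
  proof -
    show ne: "geod v x \<noteq> []" using geod_props(2)[OF v that(1)] that(2) by auto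
    show "hd (geod v x) \<in> C" using ne reduced_letters[OF geod_props(1)[OF v that(1)]] by auto
  qed
  have \<tau>F: "\<tau> x \<in> F" if "x \<in> V" "x \<noteq> v" for x
    using f branch(1)[OF that] that by (simp add: \<tau>_def)
  have \<tau>F': "\<tau> x \<in> F'" if "x \<in> V" for x
    using \<tau>F[OF that] F_sub a by (cases "x = v") (auto simp: \<tau>_def)
  have "\<tau> (nb x i) i = \<tau> x i" if x: "x \<in> V" and i: "i \<in> C" for x i
  proof (cases "x = v")
    case True
    then have "geod v (nb x i) = [i]" using geod_nb[OF v v i] geod_self[OF v] by simp
    then show ?thesis using True f[OF i] nb_neq[OF v i] by (simp add: \<tau>_def)
  next
    case False
    show ?thesis
    proof (cases "nb x i = v")
      case True
      then have "x = nb v i" using nb_nb[OF x i] by simp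
      then have "geod v x = [i]" using geod_nb[OF v v i] geod_self[OF v] by simp
      then show ?thesis using True False f[OF i] by (simp add: \<tau>_def)
    next
      case ne: False
      have "hd (geod v (nb x i)) = hd (geod v x)"
      proof (cases "geod v x \<noteq> [] \<and> last (geod v x) = i")
        case True
        then have eq: "geod v (nb x i) = butlast (geod v x)" using geod_nb[OF v x i] by simp
        moreover have "geod v (nb x i) \<noteq> []" using branch(2)[OF nb_closed[OF x i] ne] .
        ultimately show ?thesis by (cases "geod v x") auto
      next
        case no: False
        have "geod v (nb x i) = geod v x @ [i]" by (rule trans[OF geod_nb[OF v x i] if_not_P[OF no]])
        then show ?thesis using branch(2)[OF x False] by simp
      qed
      then show ?thesis using False ne by (simp add: \<tau>_def)
    qed
  qed
  then have "compatible \<tau>" unfolding compatible_def using \<tau>F' F'_permutes by blast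
  then obtain r where r: "r \<in> aut" "r v = v" "\<And>x. x \<in> V \<Longrightarrow> loc r x = \<tau> x"
    using aut_exists[OF _ v v] by blast
  show thesis
  proof (rule that[of r])
    show s: "sing r \<subseteq> {v}"
    proof
      fix x assume "x \<in> sing r"
      then have "x \<in> V" "\<tau> x \<notin> F" using r(3)[of x] by (auto simp: sing_def)
      then show "x \<in> {v}" using \<tau>F[of x] by blast
    qed
    show "r \<in> BM" using r \<tau>F' finite_subset[OF s] by (intro BM_I) auto
    show "r v = v" by (rule r(2))
    show la: "loc r v = a" using r(3)[OF v] by (simp add: \<tau>_def)
    show "r x = x" if i: "i \<in> C" "a i = i" and x: "x \<in> half v i" for i x
    proof (rule half_fixed[OF r(1) v i(1) r(2) _ _ x])
      show "loc r v i = i" using la i by simp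
      fix y assume y: "y \<in> half v i"
      then have "y \<in> V" "hd (geod v y) = i" "y \<noteq> v"
        using mem_half_iff[OF v i(1), of y] base_notin_half[OF v i(1)] by auto
      then show "loc r y = id" using r(3) i by (simp add: \<tau>_def f_def)
    qed
  qed
qed

subsection \<open>Rigid stabilizers\<close>

definition rigid :: "'v set \<Rightarrow> ('v \<Rightarrow> 'v) set" where
  "rigid X = {g \<in> BM. \<forall>x. x \<notin> X \<longrightarrow> g x = x}"

lemma rigid_BM: "g \<in> rigid X \<Longrightarrow> g \<in> BM"
  by (simp add: rigid_def)

lemma rigid_fixes: "g \<in> rigid X \<Longrightarrow> x \<notin> X \<Longrightarrow> g x = x"
  by (simp add: rigid_def)

lemma rigid_mono: "X \<subseteq> Y \<Longrightarrow> rigid X \<subseteq> rigid Y"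
  by (auto simp: rigid_def)

lemma rigid_closed: "perm_closed (rigid X)"
proof (rule perm_closedI)
  show "inv' g \<in> rigid X" if "g \<in> rigid X" for g
    using that BM_inv bij_inv_simps(1)[OF BM_bij[of g]] unfolding rigid_def by (smt (verit) mem_Collect_eq)
qed (auto simp: rigid_def BM_id BM_comp)

lemma rigid_maps:
  assumes "g \<in> rigid X" "x \<in> X"
  shows "g x \<in> X"
proof (rule ccontr)
  assume "g x \<notin> X"
  then have "g (g x) = g x" using assms(1) by (rule rigid_fixes[rotated])
  then have "g x = x" using bij_inv_simps(1)[OF BM_bij[OF rigid_BM[OF assms(1)]]] by metis
  then show False using \<open>g x \<notin> X\<close> assms(2) by simp
qed

lemma rigid_conj:
  assumes "g \<in> BM" "a \<in> rigid X"
  shows "g \<circ> a \<circ> inv' g \<in> rigid (g ` X)"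
proof -
  note b = bij_inv_simps[OF BM_bij[OF assms(1)]]
  have "(g \<circ> a \<circ> inv' g) x = x" if "x \<notin> g ` X" for x
  proof -
    have "inv' g x \<notin> X" using that b(2)[of x] by (metis imageI)
    then show ?thesis using rigid_fixes[OF assms(2)] b(2) by simp
  qed
  then show ?thesis
    unfolding rigid_def using BM_conj[OF assms(1) rigid_BM[OF assms(2)]] by blast
qed

lemma rigid_commute:
  assumes a: "a \<in> rigid X" and b: "b \<in> rigid Y" and "X \<inter> Y = {}"
  shows "commut a b = id"
proof -
  have "a (b x) = b (a x)" for x
  proof -
    consider "x \<in> X" "x \<notin> Y" | "x \<in> Y" "x \<notin> X" | "x \<notin> X" "x \<notin> Y" using assms(3) by blast
    then show ?thesis
    proof cases
      case 1
      then have "a x \<notin> Y" using rigid_maps[OF a] assms(3) by blast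
      then show ?thesis using 1 rigid_fixes[OF b] by metis
    next
      case 2
      then have "b x \<notin> X" using rigid_maps[OF b] assms(3) by blast
      then show ?thesis using 2 rigid_fixes[OF a] by metis
    next
      case 3
      then show ?thesis using rigid_fixes[OF a 3(1)] rigid_fixes[OF b 3(2)] by metis
    qed
  qed
  then have "a \<circ> b = b \<circ> a" by auto
  then have "commut a b = b \<circ> (a \<circ> inv' a) \<circ> inv' b" by (simp add: commut_def o_assoc)
  then show ?thesis
    using bij_inv_simps(4)[OF BM_bij[OF rigid_BM[OF a]]] bij_inv_simps(4)[OF BM_bij[OF rigid_BM[OF b]]] by simp
qed

text \<open>The outer end of the bounding edge and all other edges there are fixed; a permutation of the
  colors that fixes all but one of them is trivial.\<close>

lemma rigid_base:
  assumes r: "r \<in> rigid (half v i)" and v: "v \<in> V" and i: "i \<in> C"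
  shows "r v = v" "loc r v = id" "r (nb v i) = nb v i" "loc r (nb v i) i = i"
proof -
  have ra: "r \<in> aut" using r by (simp add: rigid_BM BM_aut)
  show rv: "r v = v" using rigid_fixes[OF r] base_notin_half[OF v i] by blast
  have "r (nb v i) \<in> half v i" using rigid_maps[OF r nb_in_half[OF v i]] .
  then have "nb v (loc r v i) \<in> half v i" using loc_nb(2)[OF ra v i] rv by simp
  then have li: "loc r v i = i"
    using half_disjoint[OF v loc_nb(1)[OF ra v i] i] nb_in_half[OF v loc_nb(1)[OF ra v i]] by blast
  have "loc r v j = j" for j
  proof (cases "j \<in> C \<and> j \<noteq> i")
    case True
    then have "nb v j \<notin> half v i" using half_disjoint[OF v _ i, of j] nb_in_half[OF v, of j] by blast
    then have "r (nb v j) = nb v j" by (rule rigid_fixes[OF r])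
    then show ?thesis using True rv v by (intro loc_eqI) auto
  qed (use li loc_outside in auto)
  then show "loc r v = id" by auto
  show "r (nb v i) = nb v i" using loc_nb(2)[OF ra v i] rv li by simp
  show "loc r (nb v i) i = i" using loc_edge[OF ra v i] li by simp
qed

definition cutoff :: "'v set \<Rightarrow> ('v \<Rightarrow> 'v) \<Rightarrow> 'v \<Rightarrow> 'v" where
  "cutoff X g = (\<lambda>x. if x \<in> X then g x else x)"

text \<open>An element that fixes an edge splits into its parts on the two sides. The part on one side has
  no new singular vertices, since its local action at the outer end of the edge is trivial.\<close>

lemma cutoff_rigid:
  assumes g: "g \<in> BM" and v: "v \<in> V" and i: "i \<in> C" and gv: "g v = v" "loc g v i = i"
  shows "cutoff (half v i) g \<in> rigid (half v i)" "sing (cutoff (half v i) g) \<subseteq> sing g \<inter> half v i"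
proof -
  let ?h = "cutoff (half v i) g"
  have 1: "?h \<in> aut" "\<And>x. x \<in> half v i \<Longrightarrow> loc ?h x = loc g x"
    "\<And>x. x \<in> V \<Longrightarrow> x \<notin> half v i \<Longrightarrow> loc ?h x = id"
    using patch_aut[of i "{()}" "\<lambda>_. v" "\<lambda>_. g" ?h] BM_aut[OF g] v i gv by (auto simp: cutoff_def)
  show s: "sing ?h \<subseteq> sing g \<inter> half v i"
  proof
    fix x assume x: "x \<in> sing ?h"
    then have "x \<in> V" "loc ?h x \<notin> F" by (auto simp: sing_def)
    moreover from this have "x \<in> half v i" using 1(3) perm_closedD(1)[OF F_closed] by metis
    ultimately show "x \<in> sing g \<inter> half v i" using 1(2) by (simp add: sing_def)
  qed
  have "loc ?h x \<in> F'" if "x \<in> V" for x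
    using 1(2,3) that BM_loc[OF g that] perm_closedD(1)[OF F'_closed] by (cases "x \<in> half v i") auto
  moreover have "finite (sing ?h)" using finite_subset[OF s] g by (simp add: BM_def)
  ultimately show "?h \<in> rigid (half v i)" using BM_I[OF 1(1)] by (simp add: rigid_def cutoff_def)
qed

text \<open>An element that fixes a vertex and all its neighbors is the product of its parts on the
  branches.\<close>

lemma mem_by_cutoffs:
  assumes g: "g \<in> BM" and v: "v \<in> V" and gv: "g v = v" "loc g v = id"
    and K: "perm_closed K" and cuts: "\<And>i. i \<in> C \<Longrightarrow> cutoff (half v i) g \<in> K"
  shows "g \<in> K"
proof -
  have img: "g ` half v i = half v i" if "i \<in> C" for i
    using aut_half[OF BM_aut[OF g] v that] gv by simp
  have "cutoff (\<Union>i\<in>S. half v i) g \<in> K" if "finite S" "S \<subseteq> C" for S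
    using that
  proof (induction S rule: finite_induct)
    case empty
    have "cutoff (\<Union>i\<in>{}. half v i) g = id" by (auto simp: cutoff_def)
    then show ?case using perm_closedD(1)[OF K] by metis
  next
    case (insert i S)
    let ?U = "\<Union>i\<in>S. half v i"
    have disj: "half v i \<inter> ?U = {}" using half_disjoint[OF v] insert by blast
    have gU: "g x \<in> ?U" if "x \<in> ?U" for x using that img insert.prems by blast
    have "cutoff (\<Union>i\<in>insert i S. half v i) g = cutoff (half v i) g \<circ> cutoff ?U g"
    proof
      fix x
      show "cutoff (\<Union>i\<in>insert i S. half v i) g x = (cutoff (half v i) g \<circ> cutoff ?U g) x"
      proof (cases "x \<in> ?U")
        case True
        then have "g x \<notin> half v i" using gU disj by blast
        then show ?thesis using True by (auto simp: cutoff_def)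
      next
        case False
        then show ?thesis by (auto simp: cutoff_def)
      qed
    qed
    moreover have "cutoff (half v i) g \<in> K" "cutoff ?U g \<in> K" using cuts insert by simp_all
    ultimately show ?case using perm_closedD(2)[OF K] by metis
  qed
  from this[OF finite_C order_refl] have "cutoff (\<Union>i\<in>C. half v i) g \<in> K" .
  moreover have "cutoff (\<Union>i\<in>C. half v i) g = g"
  proof
    fix x
    show "cutoff (\<Union>i\<in>C. half v i) g x = g x"
    proof (cases "x \<in> (\<Union>i\<in>C. half v i)")
      case False
      then have "x \<notin> V \<or> x = v" using half_cover[OF v] by blast
      then have "g x = x" using gv aut_outside[OF BM_aut[OF g]] by blast
      then show ?thesis using False by (simp add: cutoff_def)
    qed (simp add: cutoff_def)
  qed
  ultimately show ?thesis by simp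
qed

lemma root_action_realized:
  assumes "a \<in> F'" "a i = i" "u \<in> V" "i \<in> C"
  obtains z where "z \<in> rigid (half u i)" "loc z (nb u i) = a" "sing z \<subseteq> {nb u i}"
proof -
  have v: "nb u i \<in> V" using assms nb_closed by blast
  obtain r where r: "r \<in> BM" "loc r (nb u i) = a" "sing r \<subseteq> {nb u i}"
    "\<And>x. x \<in> half (nb u i) i \<Longrightarrow> r x = x"
    using local_action_realized[OF assms(1) v] assms by metis
  have "r x = x" if "x \<notin> half u i" for x
    using r(4) half_complement[OF assms(3,4)] aut_outside[OF BM_aut[OF r(1)]] that by blast
  then have "r \<in> rigid (half u i)" using r(1) by (simp add: rigid_def)
  then show thesis using that r(2,3) by blast
qed

definition half_trees :: "'v set set" where
  "half_trees = {half u i | u i. u \<in> V \<and> i \<in> C}"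

lemma half_trees_I: "u \<in> V \<Longrightarrow> i \<in> C \<Longrightarrow> half u i \<in> half_trees"
  by (auto simp: half_trees_def)

lemma half_trees_image: "g \<in> aut \<Longrightarrow> X \<in> half_trees \<Longrightarrow> g ` X \<in> half_trees"
  unfolding half_trees_def using aut_half aut_mem loc_nb(1) by blast

text \<open>The group \<open>G\<^sup>+\<close> generated by the elements supported in half-trees.\<close>

definition Gplus :: "('v \<Rightarrow> 'v) set" where
  "Gplus = perm_closed hull (\<Union>X\<in>half_trees. rigid X)"

text \<open>It turns out to be the derived subgroup of \<open>G\<^sup>+\<close> (\<open>commut_Gplus_core\<close>). Generating it by
  commutators within one half-tree is what makes it contained in every nontrivial normal subgroup of
  itself.\<close>

definition core :: "('v \<Rightarrow> 'v) set" where
  "core = perm_closed hull {commut a b | a b X. X \<in> half_trees \<and> a \<in> rigid X \<and> b \<in> rigid X}"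

lemma Gplus_closed: "perm_closed Gplus" and core_closed: "perm_closed core"
  by (simp_all add: Gplus_def core_def perm_closed_hull)

lemma rigid_Gplus: "X \<in> half_trees \<Longrightarrow> a \<in> rigid X \<Longrightarrow> a \<in> Gplus"
  unfolding Gplus_def by (rule hull_inc) blast

lemma commut_core: "X \<in> half_trees \<Longrightarrow> a \<in> rigid X \<Longrightarrow> b \<in> rigid X \<Longrightarrow> commut a b \<in> core"
  unfolding core_def by (rule hull_inc) blast

lemma Gplus_BM: "Gplus \<subseteq> BM"
  unfolding Gplus_def using rigid_BM by (intro perm_closed_hull_least BM_closed) blast

lemma core_Gplus: "core \<subseteq> Gplus"
  unfolding core_def
proof (intro perm_closed_hull_least Gplus_closed subsetI)
  note G = perm_closedD[OF Gplus_closed]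
  fix s assume "s \<in> {commut a b | a b X. X \<in> half_trees \<and> a \<in> rigid X \<and> b \<in> rigid X}"
  then obtain a b X where X: "X \<in> half_trees" "a \<in> rigid X" "b \<in> rigid X" "s = commut a b" by blast
  then have "a \<in> Gplus" "b \<in> Gplus" using rigid_Gplus by blast+
  then show "s \<in> Gplus" using G(2,3) by (simp add: X(4) commut_def)
qed

lemma core_conj:
  assumes "g \<in> BM" "k \<in> core"
  shows "g \<circ> k \<circ> inv' g \<in> core"
  using assms(2) unfolding core_def
proof (rule conj_hull[rotated 3])
  fix s assume "s \<in> {commut a b | a b X. X \<in> half_trees \<and> a \<in> rigid X \<and> b \<in> rigid X}"
  then obtain a b X where X: "X \<in> half_trees" "a \<in> rigid X" "b \<in> rigid X" "s = commut a b" by blast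
  have b: "bij g" "bij a" "bij b" using assms(1) X by (simp_all add: rigid_BM BM_bij)
  show "bij s" using X BM_bij[OF BM_commut] by (simp add: rigid_BM)
  have "g \<circ> s \<circ> inv' g = commut (g \<circ> a \<circ> inv' g) (g \<circ> b \<circ> inv' g)"
    unfolding X(4) by (rule commut_conj[OF b])
  also have "\<dots> \<in> core"
    using commut_core[OF half_trees_image[OF BM_aut[OF assms(1)] X(1)]] rigid_conj[OF assms(1)] X by blast
  finally show "g \<circ> s \<circ> inv' g \<in> perm_closed hull {commut a b | a b X. X \<in> half_trees \<and> a \<in> rigid X \<and> b \<in> rigid X}"
    by (simp add: core_def)
qed (use assms BM_bij in blast)

end

section \<open>The group generated by half-tree fixators\<close>

text \<open>The case of a transitive group \<open>F'\<close> that is generated by its point stabilizers and does not act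
  freely.\<close>

locale burger_mozes_stabilizers = burger_mozes V C nb F F'
  for V :: "'v set" and C :: "'c set" and nb :: "'v \<Rightarrow> 'c \<Rightarrow> 'v" and F F' :: "('c \<Rightarrow> 'c) set" +
  assumes card_C: "card C \<ge> 3" and V_nonempty: "V \<noteq> {}"
    and trans_F': "i \<in> C \<Longrightarrow> j \<in> C \<Longrightarrow> \<exists>a\<in>F'. a i = j"
    and gen_F': "F' \<subseteq> perm_closed hull {a \<in> F'. \<exists>i\<in>C. a i = i}"
    and nonfree: "\<exists>a\<in>F'. \<exists>i\<in>C. a i = i \<and> a \<noteq> id"
begin

lemma third_color: "\<exists>k\<in>C. k \<noteq> i \<and> k \<noteq> j"
proof (rule ccontr)
  assume "\<not> ?thesis"
  then have "C \<subseteq> {i, j}" by blast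
  then have "card C \<le> card {i, j}" by (rule card_mono[rotated]) simp
  also have "\<dots> \<le> 2" by (simp add: card_insert_if)
  finally show False using card_C by simp
qed

text \<open>An element of a point stabilizer is the local action of an element that fixes the corresponding
  edge, and these elements generate \<open>F'\<close>.\<close>

lemma Gplus_prescribed:
  assumes v: "v \<in> V" and "a \<in> F'"
  shows "\<exists>r\<in>Gplus. r v = v \<and> loc r v = a"
proof -
  note G = perm_closedD[OF Gplus_closed]
  let ?K = "{a. \<exists>r\<in>Gplus. r v = v \<and> loc r v = a}"
  have aut: "r \<in> aut" if "r \<in> Gplus" for r using that Gplus_BM BM_aut by blast
  have "perm_closed ?K"
  proof (rule perm_closedI)
    show "id \<in> ?K" using bexI[of _ id, OF _ G(1)] loc_id[OF v] by simp
    show "f \<circ> g \<in> ?K" if fg: "f \<in> ?K" "g \<in> ?K" for f g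
    proof -
      obtain r s where rs: "r \<in> Gplus" "r v = v" "loc r v = f" "s \<in> Gplus" "s v = v" "loc s v = g"
        using fg by blast
      then have "loc (r \<circ> s) v = f \<circ> g" using loc_comp[OF aut aut v, of r s] by simp
      moreover have "(r \<circ> s) v = v" using rs by simp
      ultimately show ?thesis using G(2)[OF rs(1,4)] by blast
    qed
    show "inv' f \<in> ?K" if f: "f \<in> ?K" for f
    proof -
      obtain r where r: "r \<in> Gplus" "r v = v" "loc r v = f" using f by blast
      have "inv' r v = v" using bij_inv_simps(1)[OF aut_bij[OF aut[OF r(1)]]] r(2) by metis
      then have "loc (inv' r) v = inv' f" using loc_inv[OF aut[OF r(1)] v] r(3) by simp
      then show ?thesis using G(3)[OF r(1)] \<open>inv' r v = v\<close> by blast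
    qed
  qed
  moreover have "{a \<in> F'. \<exists>i\<in>C. a i = i} \<subseteq> ?K"
  proof
    fix a assume "a \<in> {a \<in> F'. \<exists>i\<in>C. a i = i}"
    then obtain i where a: "a \<in> F'" "i \<in> C" "a i = i" by blast
    have w: "nb v i \<in> V" "nb (nb v i) i = v" using v a nb_closed nb_nb by auto
    obtain z where z: "z \<in> rigid (half (nb v i) i)" "loc z v = a"
      using root_action_realized[OF a(1,3) w(1) a(2)] w(2) by metis
    moreover have "z v = v" using rigid_base(3)[OF z(1) w(1) a(2)] w(2) by simp
    ultimately show "a \<in> ?K"
      using bexI[of _ z, OF _ rigid_Gplus[OF half_trees_I[OF w(1) a(2)] z(1)]] by simp
  qed
  ultimately have "F' \<subseteq> ?K" using gen_F' perm_closed_hull_least by blast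
  then show ?thesis using assms(2) by blast
qed

text \<open>After correcting the local action at \<open>v\<close> by an element of \<open>G\<^sup>+\<close>, the element splits into its
  parts on the branches at \<open>v\<close>.\<close>

lemma stabilizer_Gplus:
  assumes g: "g \<in> BM" and v: "v \<in> V" and gv: "g v = v"
  shows "g \<in> Gplus"
proof -
  obtain r where r: "r \<in> Gplus" "r v = v" "loc r v = loc g v"
    using Gplus_prescribed[OF v BM_loc[OF g v]] by blast
  have rB: "r \<in> BM" using r Gplus_BM by blast
  note b = bij_inv_simps[OF BM_bij[OF rB]]
  let ?h = "inv' r \<circ> g"
  have irv: "inv' r v = v" using b(1)[of v] r(2) by simp
  have h: "?h \<in> BM" using BM_comp BM_inv rB g by blast
  have hv: "?h v = v" using gv irv by simp
  have "loc ?h v = inv' (loc r v) \<circ> loc g v"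
    using loc_comp[OF aut_inv[OF BM_aut[OF rB]] BM_aut[OF g] v] loc_inv[OF BM_aut[OF rB] v] gv irv by simp
  then have lh: "loc ?h v = id"
    using r(3) bij_inv_simps(3)[OF permutes_bij[OF loc_permutes[OF BM_aut[OF g] v]]] by simp
  have "?h \<in> Gplus"
  proof (rule mem_by_cutoffs[OF h v hv lh Gplus_closed])
    fix i assume i: "i \<in> C"
    have "loc ?h v i = i" unfolding lh by simp
    then show "cutoff (half v i) ?h \<in> Gplus"
      by (rule rigid_Gplus[OF half_trees_I[OF v i] cutoff_rigid(1)[OF h v i hv]])
  qed
  then have "r \<circ> ?h \<in> Gplus" using perm_closedD(2)[OF Gplus_closed] r by blast
  moreover have "r \<circ> ?h = g" using b(2) by auto
  ultimately show ?thesis by simp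
qed

text \<open>The stabilizer of a vertex acts on its neighbors as \<open>F'\<close>, hence transitively; so any two
  vertices at distance two are exchangeable.\<close>

lemma Gplus_even_transitive:
  "v \<in> V \<Longrightarrow> set w \<subseteq> C \<Longrightarrow> length w = 2 * n \<Longrightarrow> \<exists>k\<in>Gplus. k v = walk v w"
proof (induction n arbitrary: w)
  case 0
  then show ?case using bexI[of _ id, OF _ perm_closedD(1)[OF Gplus_closed]] by simp
next
  case (Suc n)
  obtain w1 j where w1: "w = w1 @ [j]" "length w1 = Suc (2 * n)"
    using Suc.prems(3) by (cases w rule: rev_cases) auto
  obtain w0 i where w0: "w1 = w0 @ [i]" "length w0 = 2 * n"
    using w1(2) by (cases w1 rule: rev_cases) auto
  have w0C: "set w0 \<subseteq> C" and ij: "i \<in> C" "j \<in> C" using Suc.prems(2) w0 w1 by auto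
  obtain k where k: "k \<in> Gplus" "k v = walk v w0" using Suc.IH[OF Suc.prems(1) w0C w0(2)] by blast
  let ?x = "walk v w0" and ?y = "nb (walk v w0) i"
  have x: "?x \<in> V" using walk_closed[OF Suc.prems(1) w0C] .
  have y: "?y \<in> V" "nb ?y i = ?x" using x ij nb_closed nb_nb by auto
  obtain a where a: "a \<in> F'" "a i = j" using trans_F' ij by blast
  obtain r where r: "r \<in> Gplus" "r ?y = ?y" "loc r ?y = a" using Gplus_prescribed[OF y(1) a(1)] by blast
  have "r ?x = nb ?y j" using loc_nb(2)[of r ?y i] r a y ij Gplus_BM BM_aut by auto
  then have "(r \<circ> k) v = walk v w" using k w0 w1 by simp
  then show ?case using perm_closedD(2)[OF Gplus_closed r(1) k(1)] by blast
qed

lemma even_displacement_Gplus: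
  assumes g: "g \<in> BM" and v: "v \<in> V" and w: "set w \<subseteq> C" "even (length w)" "g v = walk v w"
  shows "g \<in> Gplus"
proof -
  obtain k where k: "k \<in> Gplus" "k v = walk v w"
    using Gplus_even_transitive[OF v w(1)] w(2) by (metis evenE)
  have kB: "k \<in> BM" using k Gplus_BM by blast
  note b = bij_inv_simps[OF BM_bij[OF kB]]
  have "(inv' k \<circ> g) v = v" using b(1)[of v] k w by simp
  then have "inv' k \<circ> g \<in> Gplus" using stabilizer_Gplus BM_comp BM_inv kB g v by blast
  then have "k \<circ> (inv' k \<circ> g) \<in> Gplus" using perm_closedD(2)[OF Gplus_closed k(1)] by blast
  moreover have "k \<circ> (inv' k \<circ> g) = g" using b(2) by auto
  ultimately show ?thesis by simp
qed

subsection \<open>The quotient by the core is abelian\<close>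

text \<open>Otherwise all generators of \<open>F'\<close> fix \<open>i\<close>, contrary to transitivity.\<close>

lemma color_moved_by_stabilizer:
  assumes i: "i \<in> C"
  shows "\<exists>l\<in>C. \<exists>a\<in>F'. a l = l \<and> a i \<noteq> i"
proof (rule ccontr)
  assume *: "\<not> ?thesis"
  have "perm_closed {a. bij a \<and> a i = i}"
  proof (rule perm_closedI)
    fix f :: "'c \<Rightarrow> 'c" assume f: "f \<in> {a. bij a \<and> a i = i}"
    then have b: "bij f" and fi: "f i = i" by auto
    show "inv' f \<in> {a. bij a \<and> a i = i}" using bij_inv_simps(1)[OF b, of i] bij_inv_simps(5)[OF b] fi by simp
  qed (auto intro: bij_comp)
  moreover have "{a \<in> F'. \<exists>i\<in>C. a i = i} \<subseteq> {a. bij a \<and> a i = i}"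
    using * permutes_bij[OF F'_permutes] by blast
  ultimately have fixed: "F' \<subseteq> {a. bij a \<and> a i = i}" using gen_F' perm_closed_hull_least by blast
  obtain j where j: "j \<in> C" "j \<noteq> i" using third_color by blast
  obtain a where "a \<in> F'" "a i = j" using trans_F'[OF i j(1)] by blast
  then show False using fixed j by auto
qed

text \<open>Rotate around the base \<open>u\<close> of the half-tree, by an element whose local action fixes another
  color \<open>l\<close> and moves \<open>i\<close>; the larger half-tree is the complement of the branch of color \<open>l\<close>.\<close>

lemma half_tree_mover:
  assumes "X \<in> half_trees"
  obtains Y g where "Y \<in> half_trees" "X \<subseteq> Y" "g \<in> rigid Y" "g ` X \<inter> X = {}"
proof -
  obtain u i where X: "X = half u i" "u \<in> V" "i \<in> C" using assms by (auto simp: half_trees_def)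
  obtain l a where a: "l \<in> C" "a \<in> F'" "a l = l" "a i \<noteq> i" using color_moved_by_stabilizer X by blast
  have li: "l \<noteq> i" using a by blast
  have w: "nb u l \<in> V" "nb (nb u l) l = u" using X a nb_closed nb_nb by auto
  let ?Y = "half (nb u l) l"
  obtain g where g: "g \<in> rigid ?Y" "loc g u = a"
    using root_action_realized[OF a(2,3) w(1) a(1)] w(2) by metis
  have gu: "g u = u" using rigid_base(3)[OF g(1) w(1) a(1)] w(2) by simp
  have ga: "g \<in> aut" using g rigid_BM BM_aut by blast
  have "?Y = V - half u l" using half_complement X a by blast
  then have sub: "X \<subseteq> ?Y" using X half_subset[OF X(2,3)] half_disjoint[OF X(2,3) a(1)] li by blast
  have "g ` X = half u (a i)" using aut_half[OF ga X(2,3)] g gu X by simp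
  then have "g ` X \<inter> X = {}"
    using half_disjoint[OF X(2) loc_nb(1)[OF ga X(2,3)] X(3)] g a X by simp
  then show thesis using that half_trees_I[OF w(1) a(1)] sub g(1) by blast
qed

lemma half_trees_position:
  assumes "X \<in> half_trees" "Y \<in> half_trees"
  shows "X \<subseteq> Y \<or> Y \<subseteq> X \<or> X \<inter> Y = {} \<or> V - X \<subseteq> Y"
  using assms half_position unfolding half_trees_def by blast

lemma half_trees_subset: "X \<in> half_trees \<Longrightarrow> X \<subseteq> V"
  using half_subset unfolding half_trees_def by blast

lemma commut_rigid_core:
  assumes X: "X \<in> half_trees" "s \<in> rigid X" and Y: "Y \<in> half_trees" "t \<in> rigid Y"
  shows "commut s t \<in> core"
proof -
  note C = perm_closedD[OF core_closed]
  consider "X \<subseteq> Y" | "Y \<subseteq> X" | "X \<inter> Y = {}" | "V - X \<subseteq> Y" using half_trees_position X Y by blast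
  then show ?thesis
  proof cases
    case 1
    then show ?thesis using commut_core rigid_mono X Y by blast
  next
    case 2
    then show ?thesis using commut_core rigid_mono X Y by blast
  next
    case 3
    then show ?thesis using rigid_commute X Y C(1) by metis
  next
    case 4
    \<comment> \<open>Modulo the core, \<open>s\<close> may be replaced by a conjugate supported off \<open>X\<close>, hence inside \<open>Y\<close>.\<close>
    obtain Z g where Z: "Z \<in> half_trees" "X \<subseteq> Z" "g \<in> rigid Z" "g ` X \<inter> X = {}"
      using half_tree_mover[OF X(1)] by blast
    have B: "s \<in> BM" "t \<in> BM" "g \<in> BM" using X Y Z rigid_BM by blast+
    let ?s' = "g \<circ> s \<circ> inv' g"
    have "g ` X \<subseteq> V" using half_trees_subset half_trees_image[OF BM_aut[OF B(3)] X(1)] by blast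
    then have "g ` X \<subseteq> Y" using Z(4) 4 by blast
    then have "?s' \<in> rigid Y" using rigid_conj[OF B(3) X(2)] rigid_mono by blast
    then have c1: "commut ?s' t \<in> core" using commut_core Y by blast
    have "s \<in> rigid Z" using X(2) rigid_mono[OF Z(2)] by blast
    then have c2: "commut s g \<in> core" using commut_core Z by blast
    have c3: "t \<circ> inv' (commut s g) \<circ> inv' t \<in> core" using core_conj[OF B(2)] C(3) c2 by blast
    have "commut s t = commut s g \<circ> commut ?s' t \<circ> (t \<circ> inv' (commut s g) \<circ> inv' t)"
      using B[THEN BM_bij] by (simp add: commut_inverse) (simp add: commut_def inv_conj fun_eq_iff bij_inv_simps)
    then show ?thesis using C(2) c1 c2 c3 by metis
  qed
qed

lemma commut_Gplus_core:
  assumes "a \<in> Gplus" "b \<in> Gplus"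
  shows "commut a b \<in> core"
proof (rule commut_hull_mem[OF core_closed _ _ _ assms[unfolded Gplus_def]])
  show "bij s" if "s \<in> (\<Union>X\<in>half_trees. rigid X)" for s using that rigid_BM BM_bij by blast
  show "x \<circ> m \<circ> inv' x \<in> core" if "x \<in> perm_closed hull (\<Union>X\<in>half_trees. rigid X)" "m \<in> core" for x m
    using core_conj that Gplus_BM by (auto simp: Gplus_def)
  show "commut s t \<in> core" if "s \<in> (\<Union>X\<in>half_trees. rigid X)" "t \<in> (\<Union>X\<in>half_trees. rigid X)" for s t
    using that commut_rigid_core by blast
qed

subsection \<open>Elements without singular vertices\<close>

text \<open>Let \<open>m\<close> be a translation such that the half-trees \<open>m\<^sup>n X\<close> are disjoint, for \<open>X = half v i\<close>, and
  let \<open>h\<close> be the product of all \<open>m\<^sup>n r m\<^sup>-\<^sup>n\<close> with \<open>n \<ge> 0\<close>. Conjugation by \<open>m\<close> removes the first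
  factor, so \<open>r = [h,m]\<close>. The infinite product has no singular vertices because \<open>r\<close> has none and \<open>m\<close>
  has trivial local actions.\<close>

lemma regular_rigid_core:
  assumes r: "r \<in> rigid (half v i)" "sing r = {}" and v: "v \<in> V" and i: "i \<in> C"
  shows "r \<in> core"
proof -
  obtain j where j: "j \<in> C" "j \<noteq> i" using third_color by blast
  obtain k where k: "k \<in> C" "k \<noteq> i" "k \<noteq> j" using third_color by blast
  \<comment> \<open>The colors \<open>j, k\<close> differ from \<open>i\<close> and from each other, so the words \<open>(jk)\<^sup>n i\<close> are reduced and
    the half-trees at their ends are disjoint; the length two puts the translation in \<open>G\<^sup>+\<close>.\<close>
  let ?w = "[j, k]"
  have w: "set ?w \<subseteq> C" using j k by simp
  have rB: "r \<in> BM" using r rigid_BM by blast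
  note ra = BM_aut[OF rB]
  obtain m where m: "m \<in> BM" "m v = walk v ?w" "\<And>x. x \<in> V \<Longrightarrow> loc m x = id"
    using color_preserving_BM[OF v walk_closed[OF v w]] by metis
  note ma = BM_aut[OF m(1)] and mb = bij_inv_simps[OF BM_bij[OF m(1)]]
  have mG: "m \<in> Gplus" using even_displacement_Gplus[OF m(1) v w _ m(2)] by simp
  have pw: "m ^^ n \<in> aut" "\<And>x. x \<in> V \<Longrightarrow> loc (m ^^ n) x = id" for n
    using color_preserving_power[OF ma m(3)] by blast+
  note pb = bij_inv_simps[OF aut_bij[OF pw(1)]]
  define W where "W n = concat (replicate n ?w)" for n
  have W_Suc: "W (Suc n) = j # k # W n" for n by (simp add: W_def)
  have W_C: "set (W n) \<subseteq> C" for n using w by (auto simp: W_def split: if_splits)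
  have W_last: "W n = [] \<or> last (W n) = k" for n
    by (induction n) (auto simp: W_Suc W_def[of 0])
  have W_red: "reduced (W n)" for n
  proof (induction n)
    case (Suc n)
    have "W n = [] \<or> hd (W n) = j" by (cases n) (auto simp: W_Suc W_def[of 0])
    then show ?case using Suc j k by (auto simp: W_Suc)
  qed (simp add: W_def)
  have W_add: "W (a + b) = W a @ W b" for a b by (simp add: W_def replicate_add)
  have red: "reduced (W n @ [i])" for n
    using W_red[of n] W_last[of n] i k by (auto simp: reduced_append)
  define u where "u n = walk v (W n)" for n
  have u: "u n \<in> V" for n using walk_closed[OF v W_C] by (simp add: u_def)
  have pu: "(m ^^ n) v = u n" for n
    using color_preserving_walk_power[OF ma m(3) v w m(2)] by (simp add: u_def W_def)
  have u0: "u 0 = v" by (simp add: u_def W_def)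
  have geod_half: "\<exists>w'. geod v x = W n @ i # w'" if x: "x \<in> half (u n) i" for x n
  proof -
    obtain w' where "x = walk v (W n @ i # w')" "reduced (W n @ i # w')"
      using x half_deep[OF v red] unfolding u_def by blast
    then show ?thesis using geod_eqI[OF v] by blast
  qed
  have clash: "W a @ i # x \<noteq> W b @ y" if ab: "a < b" for a b x y
  proof
    assume *: "W a @ i # x = W b @ y"
    obtain c where "b = a + Suc c" using less_imp_Suc_add[OF ab] by auto
    then have "W b = W a @ j # k # W c" by (simp only: W_add W_Suc)
    then show False using * j(2) by simp
  qed
  have disj: "half (u a) i \<inter> half (u b) i = {}" if "a \<noteq> b" for a b
  proof (rule ccontr)
    assume "half (u a) i \<inter> half (u b) i \<noteq> {}"
    then obtain x where x: "x \<in> half (u a) i" "x \<in> half (u b) i" by blast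
    obtain p where p: "geod v x = W a @ i # p" using geod_half[OF x(1)] by blast
    obtain q where q: "geod v x = W b @ i # q" using geod_half[OF x(2)] by blast
    show False
      using clash[of a b p "i # q"] clash[of b a q "i # p"] p q that by (cases "a < b") auto
  qed
  have apex: "u a \<notin> half (u b) i" for a b
  proof
    assume "u a \<in> half (u b) i"
    then obtain p where p: "geod v (u a) = W b @ i # p" using geod_half by blast
    have "geod v (u a) = W a" using geod_eqI[OF v W_red] by (simp add: u_def)
    then have eq: "W a = W b @ i # p" using p by simp
    show False
    proof (cases "b < a")
      case True
      then show False using clash[of b a p "[]"] eq by simp
    next
      case False
      then obtain c where "b = a + c" using le_Suc_ex[of a b] by auto
      then have "length (W b) \<ge> length (W a)" by (simp add: W_add)
      then show False using arg_cong[OF eq, of length] by simp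
    qed
  qed
  define R where "R n = m ^^ n \<circ> r \<circ> inv' (m ^^ n)" for n
  have Ra: "R n \<in> aut" for n using aut_comp aut_inv pw(1) ra by (simp only: R_def)
  have iV: "inv' (m ^^ n) x \<in> V" if "x \<in> V" for n x using aut_mem[OF aut_inv[OF pw(1)]] that by blast
  have locR: "loc (R n) x = loc r (inv' (m ^^ n) x)" if x: "x \<in> V" for n x
  proof -
    have y: "inv' (m ^^ n) x \<in> V" using iV[OF x] .
    have ry: "r (inv' (m ^^ n) x) \<in> V" using aut_mem[OF ra] y by blast
    have "loc (R n) x = loc (m ^^ n \<circ> r) (inv' (m ^^ n) x) \<circ> loc (inv' (m ^^ n)) x"
      unfolding R_def by (rule loc_comp[OF aut_comp[OF pw(1) ra] aut_inv[OF pw(1)] x])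
    also have "loc (m ^^ n \<circ> r) (inv' (m ^^ n) x) = loc r (inv' (m ^^ n) x)"
      using loc_comp[OF pw(1) ra y] pw(2)[OF ry] by simp
    also have "loc (inv' (m ^^ n)) x = id"
      using loc_inv[OF pw(1) x] pw(2)[OF y] by simp
    finally show ?thesis by simp
  qed
  have ipu: "inv' (m ^^ n) (u n) = v" for n using pu[of n] pb(1)[of n v] by simp
  have Ru: "R n (u n) = u n" for n
    using ipu[of n] pu[of n] rigid_base(1)[OF r(1) v i] by (simp add: R_def)
  have Ri: "loc (R n) (u n) i = i" for n
    using locR[OF u] ipu rigid_base(2)[OF r(1) v i] by simp
  have img: "m ` half (u n) i = half (u (Suc n)) i" for n
  proof -
    have "m (u n) = u (Suc n)" using pu[of n, symmetric] pu[of "Suc n"] by simp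
    then show ?thesis using aut_half[OF ma u i] m(3)[OF u] by simp
  qed
  define h where "h x = (if \<exists>n. x \<in> half (u n) i then R (THE n. x \<in> half (u n) i) x else x)" for x
  have h_in: "h x = R n x" if x: "x \<in> half (u n) i" for n x
  proof -
    have "(THE n. x \<in> half (u n) i) = n" using x disj by (intro the_equality) blast+
    then show ?thesis using x by (auto simp: h_def)
  qed
  have h_out: "h x = x" if "\<And>n. x \<notin> half (u n) i" for x using that by (simp add: h_def)
  note patch = patch_aut[where I = UNIV and u = u and g = R and h = h, OF i u Ra Ru Ri _ apex h_in h_out]
  have ha: "h \<in> aut" and hl: "\<And>n x. x \<in> half (u n) i \<Longrightarrow> loc h x = loc (R n) x"
    "\<And>x. x \<in> V \<Longrightarrow> (\<And>n. x \<notin> half (u n) i) \<Longrightarrow> loc h x = id"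
    by (rule patch; simp add: disj)+
  have "loc h x \<in> F" if x: "x \<in> V" for x
  proof (cases "\<exists>n. x \<in> half (u n) i")
    case True
    then obtain n where n: "x \<in> half (u n) i" by blast
    have "loc r (inv' (m ^^ n) x) \<in> F" using iV[OF x] r(2) sing_outer by blast
    then show ?thesis using hl(1)[OF n] locR[OF x] by simp
  next
    case False
    then show ?thesis using hl(2)[OF x] perm_closedD(1)[OF F_closed] by simp
  qed
  then have hB: "h \<in> BM" using regular_BM ha by blast
  have "h v = v" using h_out apex[of 0] u0 by simp
  then have hG: "h \<in> Gplus" using stabilizer_Gplus[OF hB v] by blast
  have R0: "R 0 x = r x" for x by (simp add: R_def)
  have R_Suc: "R (Suc n) (m x) = m (R n x)" for n x
  proof -
    have "inv' (m ^^ Suc n) (m x) = inv' (m ^^ n) x"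
      using pb(1)[of "Suc n" "inv' (m ^^ n) x"] pb(2)[of n x] by simp
    then show ?thesis by (simp add: R_def)
  qed
  have rfix: "r x = x" if "x \<notin> half (u 0) i" for x using rigid_fixes[OF r(1)] that u0 by simp
  have m_half: "m x \<in> half (u (Suc n)) i \<longleftrightarrow> x \<in> half (u n) i" for x n
    using img[of n] mb(1) by (metis image_iff)
  \<comment> \<open>The commutator relation in the form \<open>h m = r m h\<close>.\<close>
  have key: "h (m x) = r (m (h x))" for x
  proof (cases "\<exists>n. x \<in> half (u n) i")
    case True
    then obtain n where n: "x \<in> half (u n) i" by blast
    have mx: "m x \<in> half (u (Suc n)) i" using m_half n by blast
    have "R n x \<in> half (u n) i"
      using aut_half[OF Ra u i, of n n] Ru Ri n by auto
    then have "m (R n x) \<notin> half (u 0) i" using m_half disj[of 0 "Suc n"] by blast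
    then show ?thesis using h_in[OF n] h_in[OF mx] R_Suc rfix by simp
  next
    case False
    then have hx: "h x = x" using h_out by blast
    show ?thesis
    proof (cases "m x \<in> half (u 0) i")
      case True
      then show ?thesis using h_in[OF True] R0 hx by simp
    next
      case no: False
      have "m x \<notin> half (u n) i" for n using no m_half False by (cases n) auto
      then show ?thesis using h_out[of "m x"] hx rfix[OF no] by simp
    qed
  qed
  have "commut h m = r"
  proof
    fix x
    show "commut h m x = r x"
      using key[of "inv' h (inv' m x)"] bij_inv_simps(2)[OF aut_bij[OF ha]] mb(2) by (simp add: commut_def)
  qed
  then show ?thesis using commut_Gplus_core[OF hG mG] by simp
qed

section \<open>The core has finite index\<close>

text \<open>The elements supported in \<open>half u i\<close> that are singular at most at the root. By
  \<open>root_rigid_core\<close>, their class modulo the core is determined by the local action at the root.\<close>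

definition root_rigid :: "'v \<Rightarrow> 'c \<Rightarrow> ('v \<Rightarrow> 'v) set" where
  "root_rigid u i = {z \<in> rigid (half u i). sing z \<subseteq> {nb u i}}"

lemma root_rigid_closed:
  assumes u: "u \<in> V" and i: "i \<in> C"
  shows "perm_closed (root_rigid u i)"
proof (rule perm_closedI)
  note R = perm_closedD[OF rigid_closed[of "half u i"]]
  have "sing id = {}" using perm_closedD(1)[OF F_closed] by (auto simp: sing_def loc_id)
  then show "id \<in> root_rigid u i" using R(1) by (simp add: root_rigid_def)
  show "f \<circ> g \<in> root_rigid u i" if "f \<in> root_rigid u i" "g \<in> root_rigid u i" for f g
  proof -
    have fg: "f \<in> rigid (half u i)" "g \<in> rigid (half u i)" "sing f \<subseteq> {nb u i}" "sing g \<subseteq> {nb u i}"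
      using that by (auto simp: root_rigid_def)
    have "inv' g (nb u i) = nb u i"
      using rigid_base(3)[OF fg(2) u i] bij_inv_simps(1)[OF BM_bij[OF rigid_BM[OF fg(2)]]] by metis
    then have "sing (f \<circ> g) \<subseteq> {nb u i}"
      using sing_comp[OF BM_aut[OF rigid_BM[OF fg(1)]] BM_aut[OF rigid_BM[OF fg(2)]]] fg by auto
    then show ?thesis using R(2)[OF fg(1,2)] unfolding root_rigid_def by blast
  qed
  show "inv' f \<in> root_rigid u i" if "f \<in> root_rigid u i" for f
  proof -
    have f: "f \<in> rigid (half u i)" "sing f \<subseteq> {nb u i}" using that by (auto simp: root_rigid_def)
    then have "sing (inv' f) \<subseteq> {nb u i}"
      using sing_inv[OF BM_aut[OF rigid_BM[OF f(1)]]] rigid_base(3)[OF f(1) u i] by auto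
    then show ?thesis using R(3)[OF f(1)] unfolding root_rigid_def by blast
  qed
qed

lemma root_rigid_core:
  assumes y: "y \<in> root_rigid u i" and u: "u \<in> V" and i: "i \<in> C" and l: "loc y (nb u i) = id"
  shows "y \<in> core"
proof -
  have yr: "y \<in> rigid (half u i)" "sing y \<subseteq> {nb u i}" using y by (auto simp: root_rigid_def)
  have yB: "y \<in> BM" using yr rigid_BM by blast
  have root: "nb u i \<in> V" using u i nb_closed by blast
  have "sing y = {}" using yr(2) l perm_closedD(1)[OF F_closed] by (auto simp: sing_def)
  then show ?thesis using regular_rigid_core[OF yr(1) _ u i] by blast
qed

lemma root_rigid_finite_over_core:
  assumes u: "u \<in> V" and i: "i \<in> C"
  shows "finite_over core (root_rigid u i)"
proof -
  let ?Z = "root_rigid u i" and ?x = "nb u i"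
  define L where "L z = loc z ?x" for z
  define rep where "rep a = (SOME z. z \<in> ?Z \<and> L z = a)" for a
  have x: "?x \<in> V" using u i nb_closed by blast
  have ZB: "z \<in> BM" if "z \<in> ?Z" for z using that rigid_BM by (auto simp: root_rigid_def)
  have rep: "rep (L z) \<in> ?Z \<and> L (rep (L z)) = L z" if "z \<in> ?Z" for z
    unfolding rep_def by (rule someI[of _ z]) (simp add: that)
  have "L ` ?Z \<subseteq> {a. a permutes C}" unfolding L_def using ZB loc_permutes[OF BM_aut x] by blast
  then have fin: "finite (L ` ?Z)" using finite_permutations[OF finite_C] finite_subset by blast
  show ?thesis
    unfolding finite_over_def
  proof (intro exI[of _ "rep ` L ` ?Z"] conjI ballI)
    show "rep ` L ` ?Z \<subseteq> ?Z" using rep by blast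
    show "finite (rep ` L ` ?Z)" using fin by blast
    fix z assume z: "z \<in> ?Z"
    obtain r where r: "r \<in> ?Z" "loc r ?x = loc z ?x" "r = rep (L z)" using rep[OF z] by (simp add: L_def)
    have ra: "r \<in> aut" "z \<in> aut" using ZB[OF r(1)] ZB[OF z] BM_aut by auto
    have fixr: "r ?x = ?x" using r(1) rigid_base(3)[OF _ u i] by (auto simp: root_rigid_def)
    then have ifix: "inv' r ?x = ?x" using bij_inv_simps(1)[OF aut_bij[OF ra(1)]] by metis
    have "loc (z \<circ> inv' r) ?x = loc z ?x \<circ> inv' (loc r ?x)"
      using loc_comp[OF ra(2) aut_inv[OF ra(1)] x] loc_inv[OF ra(1) x] by (simp only: ifix)
    also have "\<dots> = id"
      unfolding r(2) using bij_inv_simps(4)[OF permutes_bij[OF loc_permutes[OF ra(2) x]]] by simp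
    finally have "z \<circ> inv' r \<in> core"
      using root_rigid_core[OF _ u i] perm_closedD(2,3)[OF root_rigid_closed[OF u i]] z r(1) by blast
    then show "\<exists>c\<in>rep ` L ` ?Z. z \<circ> inv' c \<in> core" using z r(3) by blast
  qed
qed

lemma root_rigid_Gplus: "u \<in> V \<Longrightarrow> i \<in> C \<Longrightarrow> root_rigid u i \<subseteq> Gplus"
  using rigid_Gplus half_trees_I by (auto simp: root_rigid_def)

lemma finite_over_finitely_many:
  assumes "finite I" "I \<subseteq> V \<times> C"
  shows "\<exists>W. perm_closed W \<and> core \<subseteq> W \<and> W \<subseteq> Gplus \<and> finite_over core W \<and> (\<forall>p\<in>I. root_rigid (fst p) (snd p) \<subseteq> W)"
  using assms
proof (induction I rule: finite_induct)
  case empty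
  have "finite_over core core"
    unfolding finite_over_def
    using perm_closedD(1)[OF core_closed] by (intro exI[of _ "{id}"]) simp
  then show ?case using core_closed core_Gplus by blast
next
  case (insert x I)
  obtain u i where x: "x = (u, i)" "u \<in> V" "i \<in> C" using insert.prems by (cases x) auto
  obtain W where W: "perm_closed W" "core \<subseteq> W" "W \<subseteq> Gplus" "finite_over core W" "\<forall>p\<in>I. root_rigid (fst p) (snd p) \<subseteq> W"
    using insert by blast
  have sub: "root_rigid u i \<subseteq> Gplus" using root_rigid_Gplus x by blast
  obtain W' where W': "perm_closed W'" "W \<subseteq> W'" "root_rigid u i \<subseteq> W'" "finite_over core W'"
    "W' \<subseteq> {k \<circ> a | k a. k \<in> W \<and> a \<in> root_rigid u i}"
  proof (rule finite_over_product[OF W(1) root_rigid_closed[OF x(2,3)] core_closed W(2) _ _ _ W(4)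
        root_rigid_finite_over_core[OF x(2,3)]])
    show "bij y" if "y \<in> W \<union> root_rigid u i" for y using that W(3) sub Gplus_BM BM_bij by blast
    show "k \<circ> h \<circ> inv' k \<in> core" if "k \<in> W" "h \<in> core" for k h using that W(3) Gplus_BM core_conj by blast
    show "commut k a \<in> core" if "k \<in> W" "a \<in> root_rigid u i" for k a using that W(3) sub commut_Gplus_core by blast
  qed
  have "W' \<subseteq> Gplus" using W'(5) W(3) sub perm_closedD(2)[OF Gplus_closed] by blast
  moreover have "\<forall>p\<in>insert x I. root_rigid (fst p) (snd p) \<subseteq> W'"
    using W(5) W'(2,3) x(1) by fastforce
  ultimately show ?case using W(2) W'(1,2,4) by blast
qed

text \<open>It suffices to take the half-trees based at two adjacent vertices: by parity, any other one is
  moved to one of these by a color-preserving element of \<open>G\<^sup>+\<close>, which preserves the singular vertices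
  under conjugation and acts trivially modulo the core.\<close>

lemma Gplus_finite_over_core:
  obtains W where "perm_closed W" "core \<subseteq> W" "W \<subseteq> Gplus" "finite_over core W" "\<And>u i. u \<in> V \<Longrightarrow> i \<in> C \<Longrightarrow> root_rigid u i \<subseteq> W"
proof -
  obtain v where v: "v \<in> V" using V_nonempty by blast
  obtain c where c: "c \<in> C" using third_color by blast
  have v': "nb v c \<in> V" using nb_closed v c by blast
  obtain W where W: "perm_closed W" "core \<subseteq> W" "W \<subseteq> Gplus" "finite_over core W"
    "\<forall>p\<in>{v, nb v c} \<times> C. root_rigid (fst p) (snd p) \<subseteq> W"
    using finite_over_finitely_many[of "{v, nb v c} \<times> C"] finite_C v v' by blast
  have "root_rigid u i \<subseteq> W" if u: "u \<in> V" and i: "i \<in> C" for u i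
  proof
    fix z assume z: "z \<in> root_rigid u i"
    note g = geod_props[OF u v]
    obtain w where w: "set w \<subseteq> C" "even (length w)" "walk u w \<in> {v, nb v c}"
    proof (cases "even (length (geod u v))")
      case True
      then show thesis using that[of "geod u v"] g reduced_letters by simp
    next
      case False
      then show thesis using that[of "geod u v @ [c]"] g reduced_letters[OF g(1)] c by simp
    qed
    have wV: "walk u w \<in> V" using walk_closed[OF u w(1)] .
    obtain t where t: "t \<in> BM" "t u = walk u w" "\<And>x. x \<in> V \<Longrightarrow> loc t x = id" "sing t = {}"
      using color_preserving_BM[OF u wV] by metis
    note ta = BM_aut[OF t(1)]
    have tG: "t \<in> Gplus" using even_displacement_Gplus[OF t(1) u w(1,2) t(2)] .
    have zG: "z \<in> Gplus" using z root_rigid_Gplus u i by blast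
    have zr: "z \<in> rigid (half u i)" "sing z \<subseteq> {nb u i}" using z by (auto simp: root_rigid_def)
    have zB: "z \<in> BM" using rigid_BM[OF zr(1)] .
    have ti: "t (nb u i) = nb (walk u w) i" using loc_nb(2)[OF ta u i] t(2) t(3)[OF u] by simp
    have "t ` half u i = half (walk u w) i" using aut_half[OF ta u i] t(2) t(3)[OF u] by simp
    then have r1: "t \<circ> z \<circ> inv' t \<in> rigid (half (walk u w) i)" using rigid_conj[OF t(1) zr(1)] by metis
    have "sing (inv' t) = {}" using sing_inv[OF ta] t(4) by simp
    then have "sing (t \<circ> z \<circ> inv' t) \<subseteq> inv' (inv' t) ` sing (t \<circ> z)"
      using sing_comp[OF aut_comp[OF ta BM_aut[OF zB]] aut_inv[OF ta]] by simp
    also have "\<dots> \<subseteq> t ` sing z"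
      using sing_comp[OF ta BM_aut[OF zB]] t(4) bij_inv_simps(6)[OF aut_bij[OF ta]] by auto
    also have "\<dots> \<subseteq> {nb (walk u w) i}" using zr(2) ti by auto
    finally have "t \<circ> z \<circ> inv' t \<in> root_rigid (walk u w) i" using r1 unfolding root_rigid_def by blast
    then have m: "t \<circ> z \<circ> inv' t \<in> W" using bspec[OF W(5), of "(walk u w, i)"] w(3) i by auto
    have cm: "commut z t \<in> W" using commut_Gplus_core[OF zG tG] W(2) by blast
    have "z = commut z t \<circ> (t \<circ> z \<circ> inv' t)"
      using bij_inv_simps[OF aut_bij[OF ta]] bij_inv_simps[OF BM_bij[OF zB]]
      by (simp add: commut_def fun_eq_iff)
    then show "z \<in> W" using perm_closedD(2)[OF W(1) cm m] by simp
  qed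
  then show thesis using that W by blast
qed

text \<open>Induction on the depth of the singular vertices. Multiplying by an element that is singular only
  at the root makes the local action at the root trivial, and then the product splits into its parts
  on the branches, in which the singular vertices have smaller depth.\<close>

lemma rigid_generated:
  assumes W: "perm_closed W" "core \<subseteq> W" "\<And>u i. u \<in> V \<Longrightarrow> i \<in> C \<Longrightarrow> root_rigid u i \<subseteq> W"
  shows "u \<in> V \<Longrightarrow> i \<in> C \<Longrightarrow> r \<in> rigid (half u i) \<Longrightarrow> (\<And>x. x \<in> sing r \<Longrightarrow> length (geod u x) < n) \<Longrightarrow> r \<in> W"
proof (induction n arbitrary: u i r)
  case 0
  then have "sing r = {}" by blast
  then show ?case using regular_rigid_core[OF 0(3) _ 0(1,2)] W(2) by blast
next
  case (Suc n)
  note u = Suc.prems(1) and i = Suc.prems(2) and r = Suc.prems(3)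
  let ?x = "nb u i"
  have x: "?x \<in> V" using u i nb_closed by blast
  have rB: "r \<in> BM" using rigid_BM[OF r] .
  have fr: "r ?x = ?x" "loc r ?x i = i" using rigid_base(3,4)[OF r u i] by auto
  obtain z where z: "z \<in> rigid (half u i)" "loc z ?x = loc r ?x" "sing z \<subseteq> {?x}"
    using root_action_realized[OF BM_loc[OF rB x] fr(2) u i] by blast
  have zB: "z \<in> BM" using rigid_BM[OF z(1)] .
  note za = BM_aut[OF zB] and ra = BM_aut[OF rB]
  note zb = bij_inv_simps[OF BM_bij[OF zB]]
  have zx: "z ?x = ?x" using rigid_base(3)[OF z(1) u i] .
  have izx: "inv' z ?x = ?x" using zb(1)[of ?x] zx by simp
  \<comment> \<open>Multiplying on the left keeps the singular vertices of \<open>r\<close> in place.\<close>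
  define y where "y = inv' z \<circ> r"
  have yr: "y \<in> rigid (half u i)" using perm_closedD(2,3)[OF rigid_closed] z r unfolding y_def by blast
  have yB: "y \<in> BM" using rigid_BM[OF yr] .
  have yx: "y ?x = ?x" using fr izx by (simp add: y_def)
  have loc_y: "loc y p = inv' (loc z (inv' z (r p))) \<circ> loc r p" if p: "p \<in> V" for p
  proof -
    have "r p \<in> V" using aut_mem[OF ra] p by blast
    then show ?thesis unfolding y_def using loc_comp[OF aut_inv[OF za] ra p] loc_inv[OF za] by simp
  qed
  have lyx: "loc y ?x = id"
    using loc_y[OF x] z(2) bij_inv_simps(3)[OF permutes_bij[OF loc_permutes[OF ra x]]] by (simp only: fr izx)
  have sing_y: "sing y \<subseteq> sing r"
  proof
    fix p assume p: "p \<in> sing y"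
    then have pV: "p \<in> V" and ns: "loc y p \<notin> F" by (auto simp: sing_def)
    have "p \<noteq> ?x" using ns lyx perm_closedD(1)[OF F_closed] by metis
    then have "r p \<noteq> ?x" using fr(1) bij_inv_simps(1)[OF BM_bij[OF rB]] by metis
    then have "inv' z (r p) \<noteq> ?x" using zb(2) zx by metis
    moreover have "inv' z (r p) \<in> V" using aut_mem[OF aut_inv[OF za]] aut_mem[OF ra] pV by blast
    ultimately have "loc z (inv' z (r p)) \<in> F" using z(3) sing_outer by blast
    then have "loc r p \<notin> F"
      using ns perm_closedD(2,3)[OF F_closed] unfolding loc_y[OF pV] by blast
    then show "p \<in> sing r" using pV by (simp add: sing_def)
  qed
  have "y \<in> W"
  proof (rule mem_by_cutoffs[OF yB x yx lyx W(1)])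
    fix j assume j: "j \<in> C"
    show "cutoff (half ?x j) y \<in> W"
    proof (cases "j = i")
      case True
      have "half ?x j \<inter> half u i = {}" using True half_complement[OF u i] by blast
      then have "cutoff (half ?x j) y p = p" for p
        using rigid_fixes[OF yr] by (auto simp: cutoff_def)
      then have "cutoff (half ?x j) y = id" by auto
      then show ?thesis using perm_closedD(1)[OF W(1)] by simp
    next
      case False
      have ly: "loc y ?x j = j" unfolding lyx by simp
      note c = cutoff_rigid[OF yB x j yx ly]
      show ?thesis
      proof (rule Suc.IH[OF x j c(1)])
        fix p assume "p \<in> sing (cutoff (half ?x j) y)"
        then have p: "p \<in> sing r" "p \<in> half ?x j" using c(2) sing_y by blast+
        have pV: "p \<in> V" using p(2) half_subset[OF x j] by blast
        have g: "reduced (geod ?x p)" "walk ?x (geod ?x p) = p" "geod ?x p \<noteq> []" "hd (geod ?x p) = j"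
          using geod_props[OF x pV] p(2) mem_half_iff[OF x j] by auto
        then have "geod u p = i # geod ?x p" using False i by (intro geod_eqI[OF u]) auto
        then show "length (geod ?x p) < n" using Suc.prems(4)[OF p(1)] by simp
      qed
    qed
  qed
  moreover have "z \<in> W" using W(3)[OF u i] z by (auto simp: root_rigid_def)
  moreover have "r = z \<circ> y" using zb(2) by (auto simp: y_def)
  ultimately show ?case using perm_closedD(2)[OF W(1)] by blast
qed

lemma BM_finite_over_core: "finite_over core BM"
proof -
  obtain W where W: "perm_closed W" "core \<subseteq> W" "W \<subseteq> Gplus" "finite_over core W"
    "\<And>u i. u \<in> V \<Longrightarrow> i \<in> C \<Longrightarrow> root_rigid u i \<subseteq> W"
    using Gplus_finite_over_core by blast
  have "r \<in> W" if r: "r \<in> rigid (half u i)" and u: "u \<in> V" and i: "i \<in> C" for r u i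
  proof -
    let ?n = "Suc (Max ((\<lambda>x. length (geod u x)) ` sing r))"
    have "finite (sing r)" using rigid_BM[OF r] by (simp add: BM_def)
    then have "length (geod u x) < ?n" if "x \<in> sing r" for x
      using that by (simp add: le_imp_less_Suc)
    then show ?thesis using rigid_generated[OF W(1,2,5) u i r] by blast
  qed
  then have "Gplus \<subseteq> W" unfolding Gplus_def half_trees_def using W(1) by (intro perm_closed_hull_least) blast+
  obtain D where D: "D \<subseteq> W" "finite D" "\<forall>a\<in>W. \<exists>c\<in>D. a \<circ> inv' c \<in> core"
    using W(4) by (auto simp: finite_over_def)
  obtain v where v: "v \<in> V" using V_nonempty by blast
  obtain c where c: "c \<in> C" using third_color by blast
  have v': "nb v c \<in> V" using nb_closed v c by blast
  obtain t where t: "t \<in> BM" "t v = nb v c" using color_preserving_BM[OF v v'] by metis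
  note tb = bij_inv_simps[OF BM_bij[OF t(1)]]
  \<comment> \<open>The elements of odd displacement form the coset of \<open>t\<close>, which moves \<open>v\<close> to a neighbor.\<close>
  let ?D = "D \<union> (\<lambda>x. x \<circ> t) ` D"
  have DB: "D \<subseteq> BM" using D(1) W(3) Gplus_BM by blast
  have reps: "\<exists>x\<in>D. k \<circ> inv' x \<in> core" if "k \<in> Gplus" for k
    using D(3) that \<open>Gplus \<subseteq> W\<close> by blast
  show ?thesis
    unfolding finite_over_def
  proof (intro exI[of _ ?D] conjI ballI)
    show "?D \<subseteq> BM" using t(1) BM_comp DB by blast
    show "finite ?D" using D(2) by simp
    fix g assume g: "g \<in> BM"
    have gv: "g v \<in> V" using aut_mem[OF BM_aut[OF g]] v by blast
    note p = geod_props[OF v gv]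
    show "\<exists>x\<in>?D. g \<circ> inv' x \<in> core"
    proof (cases "even (length (geod v (g v)))")
      case True
      then have "g \<in> Gplus" using even_displacement_Gplus[OF g v reduced_letters[OF p(1)]] p(2) by simp
      then show ?thesis using reps by blast
    next
      case False
      have gt: "g \<circ> inv' t \<in> BM" using g t(1) BM_comp BM_inv by blast
      have "(g \<circ> inv' t) (nb v c) = walk (nb v c) (c # geod v (g v))"
        using tb(1)[of v] t(2) p(2) nb_nb[OF v c] by simp
      then have "g \<circ> inv' t \<in> Gplus"
        using False c reduced_letters[OF p(1)]
        by (intro even_displacement_Gplus[OF gt v', of "c # geod v (g v)"]) auto
      then obtain x where x: "x \<in> D" "(g \<circ> inv' t) \<circ> inv' x \<in> core" using reps by blast
      have "bij x" "bij t" using x(1) t(1) BM_bij DB by blast+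
      then have "g \<circ> inv' (x \<circ> t) = (g \<circ> inv' t) \<circ> inv' x" by (simp add: inv_compose o_assoc)
      then have "g \<circ> inv' (x \<circ> t) \<in> core" using x(2) by metis
      moreover have "x \<circ> t \<in> ?D" using x(1) by blast
      ultimately show ?thesis by blast
    qed
  qed
qed

section \<open>The core is simple\<close>

lemma funpow_BM: "t \<in> BM \<Longrightarrow> t ^^ n \<in> BM"
  by (induction n) (simp_all only: funpow.simps BM_id BM_comp)

lemma power_in_core:
  assumes t: "t \<in> BM"
  obtains n where "n > 0" "t ^^ n \<in> core"
proof -
  note K = perm_closedD[OF core_closed]
  obtain D where D: "D \<subseteq> BM" "finite D" "\<forall>a\<in>BM. \<exists>c\<in>D. a \<circ> inv' c \<in> core"
    using BM_finite_over_core by (auto simp: finite_over_def)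
  define f where "f n = (SOME c. c \<in> D \<and> (t ^^ n) \<circ> inv' c \<in> core)" for n
  have f: "f n \<in> D \<and> (t ^^ n) \<circ> inv' (f n) \<in> core" for n
  proof -
    have "\<exists>c. c \<in> D \<and> (t ^^ n) \<circ> inv' c \<in> core" using D(3) funpow_BM[OF t, of n] by blast
    then show ?thesis unfolding f_def by (rule someI_ex)
  qed
  have "finite (range f)" using f D(2) by (meson finite_subset image_subset_iff)
  then have "\<not> inj f" using finite_imageD by blast
  then obtain a b where ab: "a < b" "f a = f b" by (metis injI linorder_neqE_nat)
  let ?c = "f a"
  have cB: "bij ?c" using f D(1) BM_bij by blast
  have bt: "bij (t ^^ n)" for n using funpow_BM[OF t] BM_bij by blast
  have "t ^^ (b - a) \<circ> t ^^ a = t ^^ b" using ab by (simp add: funpow_add[symmetric])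
  then have "t ^^ (b - a) \<circ> (t ^^ a \<circ> inv' ?c) = t ^^ b \<circ> inv' ?c" by (metis comp_assoc)
  then have "t ^^ (b - a) = (t ^^ b \<circ> inv' ?c) \<circ> inv' (t ^^ a \<circ> inv' ?c)"
    using bij_inv_simps(4)[OF bij_comp[OF bij_inv_simps(5)[OF cB] bt]] by (metis comp_assoc comp_id)
  also have "\<dots> \<in> core" using f[of a] f[of b] ab(2) K(2,3) by metis
  finally show thesis using that[of "b - a"] ab(1) by simp
qed

text \<open>Take a translation whose axis runs from the base of \<open>Y\<close> into \<open>Z\<close> and which maps \<open>Y\<close> into \<open>Z\<close>
  together with all its positive powers; some positive power lies in the core, which has finite
  index.\<close>

lemma core_pushes:
  assumes "Y \<in> half_trees" "Z \<in> half_trees"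
  obtains k where "k \<in> core" "k ` Y \<subseteq> Z"
proof -
  obtain y i where Y: "Y = half y i" "y \<in> V" "i \<in> C" using assms(1) by (auto simp: half_trees_def)
  obtain z j where Z: "Z = half z j" "z \<in> V" "j \<in> C" using assms(2) by (auto simp: half_trees_def)
  obtain q0 where q0: "reduced q0" "q0 \<noteq> []" "\<And>w. reduced (q0 @ w) \<Longrightarrow> walk y (q0 @ w) \<in> Z"
  proof (cases "y \<in> Z")
    case False
    let ?q = "geod y z @ [j]"
    have o: "half z j = {walk y (geod y z @ j # w') | w'. reduced (geod y z @ j # w')}" "reduced ?q"
      using half_outside[OF Z(2) Y(2) Z(3)] False Z(1) by auto
    have "walk y (?q @ w) \<in> Z" if "reduced (?q @ w)" for w
    proof -
      have "?q @ w = geod y z @ j # w" by simp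
      then show ?thesis unfolding Z(1) o(1) using that by (metis (mono_tags, lifting) mem_Collect_eq)
    qed
    then show thesis using that[of ?q] o(2) by simp
  next
    case True
    have g: "reduced (geod z y)" "walk z (geod z y) = y" "geod z y \<noteq> []" "hd (geod z y) = j"
      using True geod_props[OF Z(2) Y(2)] mem_half_iff[OF Z(2,3)] Z(1) by auto
    obtain l where l: "l \<in> C" "l \<noteq> last (geod z y)" using third_color by blast
    have "walk y ([l] @ w) \<in> Z" if "reduced ([l] @ w)" for w
    proof -
      have "reduced (geod z y @ l # w)" using g l that by (simp add: reduced_append)
      then have "geod z (walk z (geod z y @ l # w)) = geod z y @ l # w"
        "walk z (geod z y @ l # w) \<in> V"
        using geod_eqI[OF Z(2)] walk_closed[OF Z(2)] reduced_letters by blast+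
      then show ?thesis using g mem_half_iff[OF Z(2,3)] Z(1) by simp
    qed
    then show thesis using that[of "[l]"] l by simp
  qed
  \<comment> \<open>The powers of the final word \<open>q\<close> have to be reduced, also when followed by \<open>i\<close>: its last color
    \<open>m\<close> must differ from \<open>i\<close> and from its first color. Inserting \<open>i\<close> before \<open>m\<close> frees \<open>m\<close> of the third
    condition, to differ from the last color of \<open>q0\<close>.\<close>
  define q1 where "q1 = (if last q0 = i then q0 else q0 @ [i])"
  have q1: "reduced q1" "last q1 = i" "hd q1 = hd q0" "q1 \<noteq> []" "\<exists>w. q1 = q0 @ w"
    using q0 Y(3) by (auto simp: q1_def reduced_append)
  obtain m where m: "m \<in> C" "m \<noteq> i" "m \<noteq> hd q0" using third_color by blast
  define q where "q = q1 @ [m]"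
  have q: "reduced q" "q \<noteq> []" "last q = m" "hd q = hd q0" "\<exists>w. q = q0 @ w"
    using q1 m by (auto simp: q_def reduced_append)
  have qC: "set q \<subseteq> C" using reduced_letters[OF q(1)] .
  define Q where "Q n = concat (replicate n q)" for n
  have Q: "reduced (Q n) \<and> (n > 0 \<longrightarrow> Q n \<noteq> [] \<and> last (Q n) = m \<and> hd (Q n) = hd q0)" for n
  proof (induction n)
    case (Suc n)
    have "Q (Suc n) = q @ Q n" by (simp add: Q_def)
    then show ?case using Suc q m by (cases n) (auto simp: reduced_append Q_def)
  qed (simp add: Q_def)
  obtain t where t: "t \<in> BM" "t y = walk y q" "\<And>x. x \<in> V \<Longrightarrow> loc t x = id"
    using color_preserving_BM[OF Y(2) walk_closed[OF Y(2) qC]] by metis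
  note ta = BM_aut[OF t(1)]
  obtain n where n: "n > 0" "t ^^ n \<in> core" using power_in_core[OF t(1)] by blast
  have tn: "t ^^ n \<in> aut" "loc (t ^^ n) y = id" "(t ^^ n) y = walk y (Q n)"
    using color_preserving_power[OF ta t(3)] color_preserving_walk_power[OF ta t(3) Y(2) qC t(2)] Y(2)
    by (auto simp: Q_def)
  have red: "reduced (Q n @ [i])" using Q[of n] n m Y(3) by (auto simp: reduced_append)
  obtain w0 where w0: "Q n = q0 @ w0"
  proof -
    obtain n' where "n = Suc n'" using n(1) by (cases n) auto
    moreover obtain w where "q = q0 @ w" using q(5) by blast
    ultimately show thesis using that[of "w @ Q n'"] by (simp add: Q_def)
  qed
  have "(t ^^ n) ` Y = half (walk y (Q n)) i" using aut_half[OF tn(1) Y(2,3)] tn Y(1) by simp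
  also have "\<dots> \<subseteq> Z"
  proof
    fix x assume "x \<in> half (walk y (Q n)) i"
    then obtain w where "x = walk y (Q n @ i # w)" "reduced (Q n @ i # w)"
      using half_deep[OF Y(2) red] by blast
    then show "x \<in> Z" using q0(3)[of "w0 @ i # w"] w0 by simp
  qed
  finally show thesis using that[OF n(2)] by blast
qed

text \<open>If \<open>x\<close> is moved, then all but one of the branches at \<open>x\<close> avoid \<open>g x\<close>, and all but one of the
  branches at \<open>g x\<close> avoid \<open>x\<close>. As there are three colors, some branch and its image are both among
  these, and they are disjoint.\<close>

lemma displaced_half_tree:
  assumes g: "g \<in> aut" "g \<noteq> id"
  obtains Z where "Z \<in> half_trees" "g ` Z \<inter> Z = {}"
proof -
  obtain x where x: "x \<in> V" "g x \<noteq> x" using g aut_outside[OF g(1)] by (metis eq_id_iff)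
  have gx: "g x \<in> V" using aut_mem[OF g(1)] x by blast
  obtain p where p: "p \<in> C" "g x \<in> half x p" using half_cover[OF x(1) gx x(2)] by blast
  obtain q where q: "q \<in> C" "x \<in> half (g x) q" using half_cover[OF gx x(1)] x(2) by metis
  let ?\<sigma> = "loc g x"
  note \<sigma> = loc_permutes[OF g(1) x(1)]
  \<comment> \<open>The branch of color \<open>p\<close> contains the image of \<open>x\<close>, and the branch of color \<open>inv' \<sigma> q\<close> is mapped
    to the one that contains \<open>x\<close>.\<close>
  obtain i where i: "i \<in> C" "i \<noteq> p" "i \<noteq> inv' ?\<sigma> q" using third_color by blast
  then have j: "?\<sigma> i \<in> C" "?\<sigma> i \<noteq> q"
    using loc_nb(1)[OF g(1) x(1)] bij_inv_simps(1)[OF permutes_bij[OF \<sigma>], of i] by auto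
  let ?Z = "half x i" and ?gZ = "half (g x) (?\<sigma> i)"
  have gZ: "g ` ?Z = ?gZ" using aut_half[OF g(1) x(1) i(1)] .
  have n1: "g x \<notin> ?Z" using p i half_disjoint[OF x(1) i(1) p(1)] by blast
  have n2: "x \<notin> ?gZ" using q j half_disjoint[OF gx j(1) q(1)] by blast
  have "?Z \<inter> ?gZ = {}"
  proof (rule ccontr)
    assume ne: "?Z \<inter> ?gZ \<noteq> {}"
    have "\<not> V - ?Z \<subseteq> ?gZ" using x(1) base_notin_half[OF x(1) i(1)] n2 by blast
    moreover have "\<not> ?Z \<subseteq> ?gZ"
    proof
      assume sub: "?Z \<subseteq> ?gZ"
      have "nb x i \<in> ?gZ" using nb_in_half[OF x(1) i(1)] sub by blast
      moreover have "nb (nb x i) i \<notin> ?gZ" using n2 nb_nb[OF x(1) i(1)] by simp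
      ultimately have "nb x i = nb (g x) (?\<sigma> i)" "i = ?\<sigma> i"
        using half_boundary[OF gx j(1) i(1)] by blast+
      then have "x = g x" using nb_nb[OF x(1) i(1)] nb_nb[OF gx j(1)] by metis
      then show False using x(2) by simp
    qed
    moreover have "\<not> ?gZ \<subseteq> ?Z"
    proof
      assume sub: "?gZ \<subseteq> ?Z"
      have "nb (g x) (?\<sigma> i) \<in> ?Z" using nb_in_half[OF gx j(1)] sub by blast
      moreover have "nb (nb (g x) (?\<sigma> i)) (?\<sigma> i) \<notin> ?Z" using n1 nb_nb[OF gx j(1)] by simp
      ultimately have "nb (g x) (?\<sigma> i) = nb x i" "?\<sigma> i = i"
        using half_boundary[OF x(1) i(1) j(1)] by blast+
      then have "x = g x" using nb_nb[OF x(1) i(1)] nb_nb[OF gx j(1)] by metis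
      then show False using x(2) by simp
    qed
    ultimately show False using half_position[OF x(1) i(1) gx j(1)] ne by blast
  qed
  then show thesis using that half_trees_I[OF x(1) i(1)] gZ by blast
qed

lemma normal_displaces:
  assumes L: "L \<subseteq> core" "L \<noteq> {id}" "L \<noteq> {}"
    and norm: "\<And>h l. h \<in> core \<Longrightarrow> l \<in> L \<Longrightarrow> h \<circ> l \<circ> inv' h \<in> L"
    and Y: "Y \<in> half_trees"
  obtains l where "l \<in> L" "l ` Y \<inter> Y = {}"
proof -
  obtain l0 where l0: "l0 \<in> L" "l0 \<noteq> id" using L by blast
  have lB: "l0 \<in> BM" using l0 L core_Gplus Gplus_BM by blast
  obtain Z where Z: "Z \<in> half_trees" "l0 ` Z \<inter> Z = {}" using displaced_half_tree[OF BM_aut[OF lB] l0(2)] by blast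
  obtain k where k: "k \<in> core" "k ` Y \<subseteq> Z" using core_pushes[OF Y Z(1)] by blast
  note kb = bij_inv_simps[OF BM_bij[of k]]
  have kB: "k \<in> BM" using k core_Gplus Gplus_BM by blast
  have ik: "inv' k \<in> core" using perm_closedD(3)[OF core_closed] k by blast
  let ?l = "inv' k \<circ> l0 \<circ> k"
  have "inv' k \<circ> l0 \<circ> inv' (inv' k) \<in> L" using norm[OF ik l0(1)] .
  then have lL: "?l \<in> L" using kb(6)[OF kB] by simp
  have "?l ` Y \<inter> Y = {}"
  proof (rule ccontr)
    assume "?l ` Y \<inter> Y \<noteq> {}"
    then obtain y where y: "y \<in> Y" "?l y \<in> Y" by blast
    have "k (?l y) = l0 (k y)" using kb(2)[OF kB] by simp
    then show False using y k(2) Z(2) by (metis IntI empty_iff image_eqI subsetD)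
  qed
  then show thesis using that lL by blast
qed

text \<open>Two applications of \<open>half_tree_mover\<close>, the second one to the larger half-tree of the first. Two
  translates are needed for correcting both entries of a commutator in \<open>core_minimal\<close>.\<close>

lemma three_translates:
  assumes "X \<in> half_trees"
  obtains Y g h where "Y \<in> half_trees" "g \<in> Gplus" "h \<in> Gplus" "X \<subseteq> Y" "g ` X \<subseteq> Y" "h ` X \<subseteq> Y"
    "g ` X \<inter> X = {}" "h ` X \<inter> X = {}" "h ` X \<inter> g ` X = {}"
proof -
  obtain Z g where Z: "Z \<in> half_trees" "X \<subseteq> Z" "g \<in> rigid Z" "g ` X \<inter> X = {}"
    using half_tree_mover[OF assms] by blast
  obtain Y h where Y: "Y \<in> half_trees" "Z \<subseteq> Y" "h \<in> rigid Y" "h ` Z \<inter> Z = {}"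
    using half_tree_mover[OF Z(1)] by blast
  have gX: "g ` X \<subseteq> Z" using rigid_maps[OF Z(3)] Z(2) by blast
  have hX: "h ` X \<subseteq> h ` Z" using Z(2) by blast
  have hY: "h ` X \<subseteq> Y" using rigid_maps[OF Y(3)] Y(2) Z(2) by blast
  show thesis
  proof (rule that[OF Y(1) rigid_Gplus[OF Z(1,3)] rigid_Gplus[OF Y(1,3)]])
    show "X \<subseteq> Y" "g ` X \<subseteq> Y" using Z(2) Y(2) gX by blast+
    show "h ` X \<inter> X = {}" "h ` X \<inter> g ` X = {}" using hX gX Y(4) Z(2) by blast+
  qed (use hY Z(4) in blast)+
qed

text \<open>If \<open>l \<in> L\<close> moves \<open>Y\<close> off itself, then \<open>[a,l]\<close> acts on \<open>Y\<close> like \<open>a\<close>, so \<open>[[a,l],b] = [a,b]\<close> for all \<open>a,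
  b\<close> supported in \<open>Y\<close>.\<close>

lemma core_minimal:
  assumes L: "perm_closed L" "L \<subseteq> core" "L \<noteq> {id}"
    and norm: "\<And>h l. h \<in> core \<Longrightarrow> l \<in> L \<Longrightarrow> h \<circ> l \<circ> inv' h \<in> L"
  shows "core \<subseteq> L"
  unfolding core_def
proof (rule perm_closed_hull_least[OF _ L(1)], rule subsetI)
  fix s assume "s \<in> {commut a b | a b X. X \<in> half_trees \<and> a \<in> rigid X \<and> b \<in> rigid X}"
  then obtain a b X where X: "X \<in> half_trees" and a: "a \<in> rigid X" and b: "b \<in> rigid X" and s: "s = commut a b" by blast
  note K = perm_closedD[OF core_closed] and L' = perm_closedD[OF L(1)]
  obtain Y g h where Y: "Y \<in> half_trees" and gh: "g \<in> Gplus" "h \<in> Gplus"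
    and sub: "X \<subseteq> Y" "g ` X \<subseteq> Y" "h ` X \<subseteq> Y"
    and disj: "g ` X \<inter> X = {}" "h ` X \<inter> X = {}" "h ` X \<inter> g ` X = {}"
    using three_translates[OF X] by blast
  have "L \<noteq> {}" using L'(1) by blast
  then obtain l where l: "l \<in> L" "l ` Y \<inter> Y = {}" using normal_displaces[OF L(2,3) _ norm Y] by blast
  have B: "a \<in> BM" "b \<in> BM" "g \<in> BM" "h \<in> BM" "l \<in> BM"
    using a b gh l L(2) rigid_BM core_Gplus Gplus_BM by blast+
  note bj = B[THEN BM_bij]
  \<comment> \<open>\<open>a\<close> and \<open>b\<close> need not lie in the core; multiplying them by far away conjugates of their inverses
    puts them there without changing their action on \<open>X\<close>.\<close>
  let ?a = "commut a g" and ?b = "commut b h"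
  have ab: "?a \<in> core" "?b \<in> core" using commut_Gplus_core rigid_Gplus[OF X] a b gh by blast+
  let ?c = "commut ?a l"
  have aB: "?a \<in> BM" "?b \<in> BM" "?c \<in> BM" using BM_commut B by blast+
  have "?c = (?a \<circ> l \<circ> inv' ?a) \<circ> inv' l" by (simp add: commut_def)
  then have cL: "?c \<in> L" using norm[OF ab(1) l(1)] L'(2,3) l(1) by metis
  have "commut ?c ?b = ?c \<circ> (?b \<circ> inv' ?c \<circ> inv' ?b)" by (simp add: commut_def o_assoc)
  then have L1: "commut ?c ?b \<in> L" using norm[OF ab(2) L'(3)[OF cL]] L'(2) cL by metis
  have conj_a: "?a = a \<circ> (g \<circ> inv' a \<circ> inv' g)" and conj_b: "?b = b \<circ> (h \<circ> inv' b \<circ> inv' h)"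
    by (simp_all add: commut_def o_assoc)
  have ra: "g \<circ> inv' a \<circ> inv' g \<in> rigid (g ` X)" and rb: "h \<circ> inv' b \<circ> inv' h \<in> rigid (h ` X)"
    using rigid_conj B(3,4) perm_closedD(3)[OF rigid_closed] a b by blast+
  have a_X: "?a x = a x" if "x \<in> X" for x
  proof -
    have "x \<notin> g ` X" using disj(1) that by blast
    then show ?thesis using rigid_fixes[OF ra, of x] unfolding conj_a by simp
  qed
  have a_out: "?a x = x" if "x \<notin> X" "x \<notin> g ` X" for x
    using rigid_fixes[OF ra that(2)] rigid_fixes[OF a that(1)] unfolding conj_a by auto
  have b_X: "?b x = b x" if "x \<in> X" for x
  proof -
    have "x \<notin> h ` X" using disj(2) that by blast
    then show ?thesis using rigid_fixes[OF rb, of x] unfolding conj_b by simp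
  qed
  have b_out: "?b x = x" if "x \<notin> X" "x \<notin> h ` X" for x
    using rigid_fixes[OF rb that(2)] rigid_fixes[OF b that(1)] unfolding conj_b by auto
  have b_h: "?b x \<in> h ` X" if "x \<in> h ` X" for x
  proof -
    have r: "(h \<circ> inv' b \<circ> inv' h) x \<in> h ` X" using rigid_maps[OF rb that] .
    then have "(h \<circ> inv' b \<circ> inv' h) x \<notin> X" using disj(2) by blast
    then have "b ((h \<circ> inv' b \<circ> inv' h) x) = (h \<circ> inv' b \<circ> inv' h) x" by (rule rigid_fixes[OF b])
    then have "?b x = (h \<circ> inv' b \<circ> inv' h) x" unfolding conj_b by simp
    then show ?thesis using r by metis
  qed
  have c_Y: "?c x = ?a x" if x: "x \<in> Y" for x
  proof -
    have "inv' l x \<notin> Y" using l(2) x bij_inv_simps(2)[OF bj(5), of x] by (metis IntI empty_iff image_eqI)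
    then have "?a (inv' l x) = inv' l x" using a_out sub by blast
    then have "inv' ?a (inv' l x) = inv' l x" using bij_inv_simps(1)[OF BM_bij[OF aB(1)]] by metis
    then show ?thesis using bij_inv_simps(2)[OF bj(5)] unfolding commut_def[of ?a l] by simp
  qed
  have "commut ?c ?b = commut a b"
  proof (rule commut_local[where X = X and D = "h ` X"])
    show "bij a" "bij b" "bij ?c" "bij ?b" using bj aB BM_bij by blast+
    show "a x = x" if "x \<notin> X" for x using rigid_fixes[OF a that] .
    show "b x = x" if "x \<notin> X" for x using rigid_fixes[OF b that] .
    show "?c x = a x" if "x \<in> X" for x using c_Y a_X sub(1) that by auto
    show "?c x = x" if "x \<in> h ` X" for x
    proof -
      have "x \<in> Y" "x \<notin> X" "x \<notin> g ` X" using that sub(3) disj by blast+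
      then show ?thesis using c_Y a_out by simp
    qed
    show "?b x = b x" if "x \<in> X" for x using b_X that .
    show "?b x \<in> h ` X" if "x \<in> h ` X" for x using b_h that .
    show "?b x = x" if "x \<notin> X" "x \<notin> h ` X" for x using b_out that .
    show "X \<inter> h ` X = {}" using disj(2) by blast
  qed
  then show "s \<in> L" using L1 s by simp
qed

lemma core_nontrivial: "core \<noteq> {id}"
proof -
  obtain a i where a: "a \<in> F'" "i \<in> C" "a i = i" "a \<noteq> id" using nonfree by blast
  obtain u where u: "u \<in> V" using V_nonempty by blast
  obtain r where r: "r \<in> rigid (half u i)" "loc r (nb u i) = a"
    using root_action_realized[OF a(1,3) u a(2)] by blast
  have rid: "r \<noteq> id" using r(2) a(4) loc_id nb_closed[OF u a(2)] by metis
  note X = half_trees_I[OF u a(2)]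
  obtain Y g where Y: "Y \<in> half_trees" "half u i \<subseteq> Y" "g \<in> rigid Y" "g ` half u i \<inter> half u i = {}"
    using half_tree_mover[OF X] by blast
  have "r \<in> rigid Y" using r(1) rigid_mono[OF Y(2)] by blast
  then have c: "commut g r \<in> core" using commut_core[OF Y(1,3)] by blast
  have B: "g \<in> BM" "r \<in> BM" using Y(3) r(1) rigid_BM by blast+
  obtain x where x: "r x \<noteq> x" using rid by (metis eq_id_iff)
  then have xX: "x \<in> half u i" using rigid_fixes[OF r(1)] by blast
  have "commut g r \<noteq> id"
  proof
    assume "commut g r = id"
    then have "commut g r (r x) = r x" by simp
    then have "(g \<circ> r \<circ> inv' g) x = r x" using bij_inv_simps[OF BM_bij[OF B(2)]] by (simp add: commut_def)
    moreover have "(g \<circ> r \<circ> inv' g) x = x"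
      using rigid_fixes[OF rigid_conj[OF B(1) r(1)], of x] Y(4) xX by blast
    ultimately show False using x by simp
  qed
  then show ?thesis using c by blast
qed

lemma core_simple: "perm_simple core"
  unfolding perm_simple_def
proof (intro conjI allI impI)
  fix N assume "N \<subseteq> core \<and> perm_closed N \<and> (\<forall>h\<in>core. \<forall>n\<in>N. h \<circ> n \<circ> inv' h \<in> N)"
  then show "N = core \<or> N = {id}" using core_minimal[of N] by blast
qed (rule core_nontrivial)

end

section \<open>An obstruction to virtual simplicity\<close>

context burger_mozes begin

text \<open>The group \<open>N\<close> of the introduction; a normal subgroup of \<open>F'\<close> by \<open>stab_group_conj\<close>.\<close>

definition stab_group :: "('c \<Rightarrow> 'c) set" where
  "stab_group = perm_closed hull {a \<in> F'. \<exists>i\<in>C. a i = i}"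

lemma stab_group_closed: "perm_closed stab_group"
  by (simp add: stab_group_def perm_closed_hull)

lemma stab_group_sub: "stab_group \<subseteq> F'"
  unfolding stab_group_def by (rule perm_closed_hull_least[OF _ F'_closed]) blast

lemma stab_group_mem: "a \<in> F' \<Longrightarrow> i \<in> C \<Longrightarrow> a i = i \<Longrightarrow> a \<in> stab_group"
  unfolding stab_group_def by (rule hull_inc) blast

lemma stab_group_conj:
  assumes a: "a \<in> F'" and n: "n \<in> stab_group"
  shows "a \<circ> n \<circ> inv' a \<in> stab_group"
  using n unfolding stab_group_def
proof (rule conj_hull[rotated 3])
  show "bij a" using permutes_bij[OF F'_permutes[OF a]] .
  fix s assume "s \<in> {a \<in> F'. \<exists>i\<in>C. a i = i}"
  then obtain i where s: "s \<in> F'" "i \<in> C" "s i = i" by blast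
  then show "bij s" using permutes_bij[OF F'_permutes] by blast
  have ai: "a i \<in> C" using permutes_in_image[OF F'_permutes[OF a], of i] s(2) by simp
  have "(a \<circ> s \<circ> inv' a) (a i) = a i" using bij_inv_simps(1)[OF permutes_bij[OF F'_permutes[OF a]]] s(3) by simp
  moreover have "a \<circ> s \<circ> inv' a \<in> F'" using perm_closedD(2,3)[OF F'_closed] a s(1) by blast
  ultimately show "a \<circ> s \<circ> inv' a \<in> perm_closed hull {a \<in> F'. \<exists>i\<in>C. a i = i}"
    using stab_group_mem[OF _ ai] by (simp only: stab_group_def)
qed

text \<open>The local actions at the ends of an edge agree on its color, so they differ by an element of a
  point stabilizer.\<close>

lemma local_actions_one_coset:
  assumes g: "g \<in> BM" and x: "x \<in> V" and y: "y \<in> V"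
  shows "inv' (loc g x) \<circ> loc g y \<in> stab_group"
  using y x
proof (induction rule: connected_induct)
  case base
  have "inv' (loc g x) \<circ> loc g x = id"
    using bij_inv_simps(3)[OF permutes_bij[OF loc_permutes[OF BM_aut[OF g] x]]] .
  then show ?case using perm_closedD(1)[OF stab_group_closed] by metis
next
  case (step y i)
  have y': "nb y i \<in> V" using nb_closed step by blast
  note b = bij_inv_simps[OF permutes_bij[OF loc_permutes[OF BM_aut[OF g] step(1)]]]
  have "(inv' (loc g y) \<circ> loc g (nb y i)) i = i"
    using loc_edge[OF BM_aut[OF g] step(1,2)] b(1) by simp
  moreover have "inv' (loc g y) \<circ> loc g (nb y i) \<in> F'"
    using perm_closedD(2,3)[OF F'_closed] BM_loc[OF g step(1)] BM_loc[OF g y'] by blast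
  ultimately have "inv' (loc g y) \<circ> loc g (nb y i) \<in> stab_group" using stab_group_mem step(2) by blast
  then have "(inv' (loc g x) \<circ> loc g y) \<circ> (inv' (loc g y) \<circ> loc g (nb y i)) \<in> stab_group"
    using perm_closedD(2)[OF stab_group_closed] step(3) by blast
  moreover have "(inv' (loc g x) \<circ> loc g y) \<circ> (inv' (loc g y) \<circ> loc g (nb y i)) = inv' (loc g x) \<circ> loc g (nb y i)"
    using b(2) by (simp add: fun_eq_iff)
  ultimately show ?case by metis
qed

text \<open>An element of \<open>F'\<close> agrees with an element of \<open>N\<close> at a point.\<close>

lemma transitive_stab_group:
  assumes "\<And>i j. i \<in> C \<Longrightarrow> j \<in> C \<Longrightarrow> \<exists>a\<in>stab_group. a i = j" "C \<noteq> {}"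
  shows "F' \<subseteq> stab_group"
proof
  fix b assume b: "b \<in> F'"
  obtain i where i: "i \<in> C" using assms(2) by blast
  have bi: "b i \<in> C" using permutes_in_image[OF F'_permutes[OF b], of i] i by simp
  obtain n where n: "n \<in> stab_group" "n i = b i" using assms(1)[OF i bi] by blast
  have nF: "n \<in> F'" using n stab_group_sub by blast
  note nb = bij_inv_simps[OF permutes_bij[OF F'_permutes[OF nF]]]
  have "(inv' n \<circ> b) i = i" using nb(1)[of i] n(2) by simp
  moreover have "inv' n \<circ> b \<in> F'" using perm_closedD(2,3)[OF F'_closed] nF b by blast
  ultimately have "inv' n \<circ> b \<in> stab_group" using stab_group_mem i by blast
  then have "n \<circ> (inv' n \<circ> b) \<in> stab_group" using perm_closedD(2)[OF stab_group_closed] n by blast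
  moreover have "n \<circ> (inv' n \<circ> b) = b" using nb(2) by auto
  ultimately show "b \<in> stab_group" by simp
qed

lemma stab_group_orbit_invariant:
  assumes "a \<in> stab_group"
  shows "a i \<in> (\<lambda>n. n j) ` stab_group \<longleftrightarrow> i \<in> (\<lambda>n. n j) ` stab_group"
proof -
  note S = perm_closedD[OF stab_group_closed]
  have "a \<in> F'" using assms stab_group_sub by blast
  then have ab: "inv' a (a x) = x" for x using bij_inv_simps(1)[OF permutes_bij[OF F'_permutes]] by blast
  have fwd: "b x \<in> (\<lambda>n. n j) ` stab_group" if b: "b \<in> stab_group" and x: "x \<in> (\<lambda>n. n j) ` stab_group" for b x
  proof -
    obtain n where n: "n \<in> stab_group" "x = n j" using x by blast
    show ?thesis using S(2)[OF b n(1)] n(2) by (intro image_eqI[of _ _ "b \<circ> n"]) auto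
  qed
  show ?thesis using fwd[OF assms, of i] fwd[OF S(3)[OF assms], of "a i"] ab by auto
qed

definition BM_stab :: "('v \<Rightarrow> 'v) set" where
  "BM_stab = {g \<in> BM. \<forall>v\<in>V. loc g v \<in> stab_group}"

lemma BM_stab_closed: "perm_closed BM_stab"
proof (rule perm_closedI)
  note S = perm_closedD[OF stab_group_closed]
  show "id \<in> BM_stab" using BM_id S(1) loc_id by (simp add: BM_stab_def)
  show "g \<circ> h \<in> BM_stab" if g: "g \<in> BM_stab" and h: "h \<in> BM_stab" for g h
  proof -
    have B: "g \<in> BM" "h \<in> BM" using g h by (auto simp: BM_stab_def)
    have "loc (g \<circ> h) v \<in> stab_group" if v: "v \<in> V" for v
    proof -
      have "h v \<in> V" using aut_mem[OF BM_aut[OF B(2)]] v by blast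
      then have "loc g (h v) \<circ> loc h v \<in> stab_group" using g h v S(2) by (simp add: BM_stab_def)
      then show ?thesis using loc_comp[OF BM_aut[OF B(1)] BM_aut[OF B(2)] v] by metis
    qed
    then show ?thesis using BM_comp[OF B] unfolding BM_stab_def by blast
  qed
  show "inv' g \<in> BM_stab" if g: "g \<in> BM_stab" for g
  proof -
    have B: "g \<in> BM" using g by (auto simp: BM_stab_def)
    have "loc (inv' g) v \<in> stab_group" if v: "v \<in> V" for v
    proof -
      have "inv' g v \<in> V" using aut_mem[OF aut_inv[OF BM_aut[OF B]]] v by blast
      then have "inv' (loc g (inv' g v)) \<in> stab_group" using g S(3) by (simp add: BM_stab_def)
      then show ?thesis using loc_inv[OF BM_aut[OF B] v] by metis
    qed
    then show ?thesis using BM_inv[OF B] unfolding BM_stab_def by blast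
  qed
qed

text \<open>The local actions of \<open>h\<close> at two vertices enter, but they lie in the same coset of the normal
  subgroup \<open>N\<close>.\<close>

lemma BM_stab_conj:
  assumes h: "h \<in> BM" and g: "g \<in> BM_stab"
  shows "h \<circ> g \<circ> inv' h \<in> BM_stab"
proof -
  note S = perm_closedD[OF stab_group_closed]
  have gB: "g \<in> BM" using g by (simp add: BM_stab_def)
  note ha = BM_aut[OF h] and ga = BM_aut[OF gB]
  have "loc (h \<circ> g \<circ> inv' h) x \<in> stab_group" if x: "x \<in> V" for x
  proof -
    let ?y = "inv' h x"
    have y: "?y \<in> V" using aut_mem[OF aut_inv[OF ha]] x by blast
    have gy: "g ?y \<in> V" using aut_mem[OF ga] y by blast
    let ?a = "loc h ?y" and ?a' = "loc h (g ?y)" and ?n = "loc g ?y"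
    have aF: "?a \<in> F'" "?a' \<in> F'" using BM_loc[OF h] y gy by auto
    note b = bij_inv_simps[OF permutes_bij[OF F'_permutes[OF aF(1)]]]
    note b' = bij_inv_simps[OF permutes_bij[OF F'_permutes[OF aF(2)]]]
    have "loc (h \<circ> g \<circ> inv' h) x = (?a' \<circ> ?n) \<circ> inv' ?a"
      using loc_comp[OF aut_comp[OF ha ga] aut_inv[OF ha] x] loc_comp[OF ha ga y] loc_inv[OF ha x] by metis
    also have "\<dots> = (?a' \<circ> ?n \<circ> inv' ?a') \<circ> (?a \<circ> (inv' ?a \<circ> ?a') \<circ> inv' ?a)"
      using b(2) b'(1) by (simp add: fun_eq_iff)
    also have "\<dots> \<in> stab_group"
    proof (rule S(2))
      have "?n \<in> stab_group" using g y by (simp add: BM_stab_def)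
      then show "?a' \<circ> ?n \<circ> inv' ?a' \<in> stab_group" by (rule stab_group_conj[OF aF(2)])
      show "?a \<circ> (inv' ?a \<circ> ?a') \<circ> inv' ?a \<in> stab_group"
        by (rule stab_group_conj[OF aF(1) local_actions_one_coset[OF h y gy]])
    qed
    finally show ?thesis .
  qed
  then show ?thesis using BM_conj[OF h gB] unfolding BM_stab_def by blast
qed

end

text \<open>Here \<open>B\<close> is a nontrivial set of colors invariant under \<open>N\<close>, such as an orbit, if \<open>N\<close> is not
  transitive.\<close>

locale burger_mozes_fold = burger_mozes V C nb F F'
  for V :: "'v set" and C :: "'c set" and nb :: "'v \<Rightarrow> 'c \<Rightarrow> 'v" and F F' :: "('c \<Rightarrow> 'c) set" +
  fixes B :: "'c set" and base :: 'v
  assumes B_sub: "B \<subseteq> C" and B_ne: "B \<noteq> {}" and B_proper: "B \<noteq> C"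
    and B_invariant: "a \<in> stab_group \<Longrightarrow> i \<in> C \<Longrightarrow> a i \<in> B \<longleftrightarrow> i \<in> B"
    and base: "base \<in> V"
    and nonfree: "\<exists>a\<in>F'. \<exists>i\<in>C. a i = i \<and> a \<noteq> id"
begin

text \<open>The line has the integers as vertices, and its edges alternate between the colors of \<open>B\<close> and the
  other ones: from an even integer, a color of \<open>B\<close> leads upwards and any other color downwards, and
  conversely from an odd integer.\<close>

definition step :: "int \<Rightarrow> 'c \<Rightarrow> int" where
  "step p i = (if even p \<longleftrightarrow> i \<in> B then p + 1 else p - 1)"

definition fold_map :: "'v \<Rightarrow> int" where
  "fold_map v = foldl step 0 (geod base v)"

lemma step_step: "step (step p i) i = p"
  by (auto simp: step_def)

lemma fold_map_nb:
  assumes x: "x \<in> V" and i: "i \<in> C"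
  shows "fold_map (nb x i) = step (fold_map x) i"
proof (cases "geod base x \<noteq> [] \<and> last (geod base x) = i")
  case True
  then have eq: "geod base x = butlast (geod base x) @ [i]" by (metis append_butlast_last_id)
  have "geod base (nb x i) = butlast (geod base x)" using geod_nb[OF base x i] True by simp
  moreover have "fold_map x = step (foldl step 0 (butlast (geod base x))) i"
    unfolding fold_map_def by (subst eq) simp
  ultimately show ?thesis by (simp add: fold_map_def step_step)
next
  case False
  have "geod base (nb x i) = geod base x @ [i]" by (rule trans[OF geod_nb[OF base x i] if_not_P[OF False]])
  then show ?thesis by (simp add: fold_map_def)
qed

lemma fold_map_walk: "x \<in> V \<Longrightarrow> set w \<subseteq> C \<Longrightarrow> fold_map (walk x w) = foldl step (fold_map x) w"
  by (induction w arbitrary: x) (simp_all add: fold_map_nb nb_closed)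

lemma fold_map_base: "fold_map base = 0"
  by (simp add: fold_map_def geod_self[OF base])

text \<open>Isometries of the line that preserve the two kinds of edges: the even translations, and the
  reflections that exchange even and odd integers.\<close>

lemma fold_map_isometry:
  assumes g: "g \<in> BM_stab" and v: "v \<in> V"
  defines "p \<equiv> fold_map (g base)"
  shows "fold_map (g v) = (if even p then p + fold_map v else p - fold_map v)"
  using v base
proof (induction rule: connected_induct)
  case base
  then show ?case by (simp add: fold_map_base p_def)
next
  case (step x i)
  have gB: "g \<in> BM" and l: "loc g x \<in> stab_group" using g step(1) by (auto simp: BM_stab_def)
  note ga = BM_aut[OF gB]
  have gx: "g x \<in> V" using aut_mem[OF ga] step(1) by blast
  have "fold_map (g (nb x i)) = local.step (fold_map (g x)) (loc g x i)"
    using fold_map_nb[OF gx loc_nb(1)[OF ga step(1,2)]] loc_nb(2)[OF ga step(1,2)] by simp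
  moreover have "loc g x i \<in> B \<longleftrightarrow> i \<in> B" using B_invariant[OF l step(2)] .
  moreover have "fold_map (nb x i) = local.step (fold_map x) i" using fold_map_nb[OF step(1,2)] .
  ultimately show ?case using step(3) by (auto simp: step_def)
qed

definition fold_kernel :: "('v \<Rightarrow> 'v) set" where
  "fold_kernel = {g \<in> BM_stab. \<forall>v\<in>V. fold_map (g v) = fold_map v}"

lemma fold_kernel_closed: "perm_closed fold_kernel"
proof (rule perm_closedI)
  note S = perm_closedD[OF BM_stab_closed]
  have mem: "g v \<in> V" if "g \<in> fold_kernel" "v \<in> V" for g v
    using that aut_mem[OF BM_aut, of g v] by (auto simp: fold_kernel_def BM_stab_def)
  show "id \<in> fold_kernel" using S(1) by (simp add: fold_kernel_def)
  show "g \<circ> h \<in> fold_kernel" if g: "g \<in> fold_kernel" and h: "h \<in> fold_kernel" for g h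
    using S(2)[of g h] g h mem[OF h] by (simp add: fold_kernel_def)
  show "inv' g \<in> fold_kernel" if g: "g \<in> fold_kernel" for g
  proof -
    have gS: "g \<in> BM_stab" and ga: "g \<in> aut" using g BM_aut by (auto simp: fold_kernel_def BM_stab_def)
    have "fold_map (inv' g v) = fold_map v" if v: "v \<in> V" for v
    proof -
      have "inv' g v \<in> V" using aut_mem[OF aut_inv[OF ga]] v by blast
      then have "fold_map (g (inv' g v)) = fold_map (inv' g v)" using g by (simp add: fold_kernel_def)
      then show ?thesis using bij_inv_simps(2)[OF aut_bij[OF ga]] by simp
    qed
    then show ?thesis using S(3)[OF gS] by (simp add: fold_kernel_def)
  qed
qed

lemma fold_kernel_conj:
  assumes h: "h \<in> BM_stab" and g: "g \<in> fold_kernel"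
  shows "h \<circ> g \<circ> inv' h \<in> fold_kernel"
proof -
  have gS: "g \<in> BM_stab" using g by (simp add: fold_kernel_def)
  have ha: "h \<in> aut" and ga: "g \<in> aut" and hB: "h \<in> BM" using h gS BM_aut by (auto simp: BM_stab_def)
  have "fold_map ((h \<circ> g \<circ> inv' h) v) = fold_map v" if v: "v \<in> V" for v
  proof -
    let ?y = "inv' h v"
    have y: "?y \<in> V" using aut_mem[OF aut_inv[OF ha]] v by blast
    have gy: "g ?y \<in> V" using aut_mem[OF ga] y by blast
    have "fold_map (g ?y) = fold_map ?y" using g y by (simp add: fold_kernel_def)
    then have "fold_map (h (g ?y)) = fold_map (h ?y)"
      using fold_map_isometry[OF h gy] fold_map_isometry[OF h y] by simp
    then show ?thesis using bij_inv_simps(2)[OF aut_bij[OF ha]] by simp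
  qed
  then show ?thesis using BM_stab_conj[OF hB gS] unfolding fold_kernel_def by blast
qed

text \<open>Such an element fixes \<open>u\<close>, where its local action is trivial. So all its local actions lie in
  \<open>N\<close>, and it fixes a point of the line; the reflections have no fixed points, as their centers are
  not integers.\<close>

lemma rigid_fold_kernel:
  assumes z: "z \<in> rigid (half u i)" and u: "u \<in> V" and i: "i \<in> C"
  shows "z \<in> fold_kernel"
proof -
  note zu = rigid_base[OF z u i]
  have zB: "z \<in> BM" using rigid_BM[OF z] .
  have "loc z v \<in> stab_group" if v: "v \<in> V" for v
  proof -
    have "inv' (loc z u) \<circ> loc z v = loc z v" unfolding zu(2) by (simp add: fun_eq_iff)
    then show ?thesis using local_actions_one_coset[OF zB u v] by metis
  qed
  then have zS: "z \<in> BM_stab" using zB by (simp add: BM_stab_def)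
  let ?p = "fold_map (z base)"
  have "even ?p"
  proof (rule ccontr)
    assume "odd ?p"
    then have "fold_map u = ?p - fold_map u" using fold_map_isometry[OF zS u] zu(1) by simp
    then have "?p = 2 * fold_map u" by simp
    then show False using \<open>odd ?p\<close> by simp
  qed
  then have "?p = 0" using fold_map_isometry[OF zS u] zu(1) by simp
  then have "fold_map (z v) = fold_map v" if "v \<in> V" for v using fold_map_isometry[OF zS that] by simp
  then show ?thesis using zS by (simp add: fold_kernel_def)
qed

lemma alternating:
  fixes p q :: 'c
  assumes "p \<in> C" "q \<in> C" "p \<noteq> q"
  defines "A \<equiv> \<lambda>n. concat (replicate n [p, q])"
  shows "set (A n) \<subseteq> C" "reduced (A n @ [p])" "length (A n) = 2 * n"
proof -
  have Suc: "A (Suc n) = p # q # A n" for n by (simp add: A_def)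
  have z: "A 0 = []" by (simp add: A_def)
  show "length (A n) = 2 * n" by (induction n) (simp_all add: Suc z)
  show r: "reduced (A n @ [p])"
  proof (induction n)
    case (Suc n)
    have "hd (A n @ [p]) = p" by (cases n) (simp_all add: \<open>\<And>n. A (Suc n) = p # q # A n\<close> z)
    then show ?case using Suc assms by (simp add: \<open>\<And>n. A (Suc n) = p # q # A n\<close>)
  qed (use assms z in simp)
  then show "set (A n) \<subseteq> C" using reduced_letters by fastforce
qed

text \<open>Half-trees far from the base vertex support nontrivial elements that fix a large ball.\<close>

lemma fold_kernel_infinite: "infinite fold_kernel"
proof
  assume fin: "finite fold_kernel"
  obtain a i where a: "a \<in> F'" "i \<in> C" "a i = i" "a \<noteq> id" using nonfree by blast
  obtain j where j: "j \<in> C" "j \<noteq> i" using B_sub B_ne B_proper a(2) by blast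
  let ?A = "\<lambda>n. concat (replicate n [i, j])"
  have ij: "i \<noteq> j" using j by simp
  note A = alternating[OF a(2) j(1) ij]
  define x where "x k = (SOME x. k x \<noteq> x)" for k :: "'v \<Rightarrow> 'v"
  have x: "k (x k) \<noteq> x k" if "k \<noteq> id" for k
    unfolding x_def by (rule someI_ex) (use that in \<open>auto simp: fun_eq_iff\<close>)
  \<comment> \<open>Every nontrivial element of a finite kernel would move some vertex at distance less than \<open>n\<close>.\<close>
  define n where "n = Suc (Max ((\<lambda>k. length (geod base (x k))) ` fold_kernel))"
  let ?u = "walk base (?A n)"
  have u: "?u \<in> V" using walk_closed[OF base A(1)] .
  obtain z where z: "z \<in> rigid (half ?u i)" "loc z (nb ?u i) = a"
    using root_action_realized[OF a(1,3) u a(2)] by blast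
  have zid: "z \<noteq> id" using z(2) a(4) loc_id nb_closed[OF u a(2)] by metis
  have zK: "z \<in> fold_kernel" using rigid_fold_kernel[OF z(1) u a(2)] .
  have "x z \<in> half ?u i" using x[OF zid] rigid_fixes[OF z(1)] by blast
  then obtain w where w: "x z = walk base (?A n @ i # w)" "reduced (?A n @ i # w)"
    using half_deep[OF base A(2)] by blast
  then have "length (geod base (x z)) > n" using geod_eqI[OF base w(2)] A(3)[of n] by simp
  moreover have "length (geod base (x z)) < n" 
    unfolding n_def using fin zK by (simp add: le_imp_less_Suc)
  ultimately show False by simp
qed

lemma fold_map_unbounded: "\<exists>v\<in>V. fold_map v = 2 * int n"
proof -
  obtain i where i: "i \<in> B" using B_ne by blast
  obtain j where j: "j \<in> C" "j \<notin> B" using B_sub B_proper by blast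
  have iC: "i \<in> C" using i B_sub by blast
  have ij: "i \<noteq> j" using i j by blast
  let ?A = "concat (replicate n [i, j])"
  have A: "set ?A \<subseteq> C" using alternating(1)[OF iC j(1) ij] .
  have "even p \<Longrightarrow> foldl step p (concat (replicate n [i, j])) = p + 2 * int n" for p n
    by (induction n arbitrary: p) (simp_all add: step_def i j)
  from this[of 0 n] have "fold_map (walk base ?A) = 2 * int n"
    using fold_map_walk[OF base A] by (simp add: fold_map_base)
  then show ?thesis using walk_closed[OF base A] by blast
qed

text \<open>The infinite kernel meets \<open>H\<close> nontrivially. It lies in the group of elements with local actions
  in \<open>N\<close>, which is normalized by \<open>H\<close>, so \<open>H\<close> is contained in that group by simplicity. Therefore \<open>H\<close>
  normalizes the kernel as well, and is contained in it. Hence the images of the base vertex on the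
  line are determined by the finitely many cosets of \<open>H\<close>.\<close>

theorem no_simple_finite_index:
  assumes H: "perm_closed H" "H \<subseteq> BM" "finite_over H BM" "perm_simple H"
  shows False
proof -
  have simple: "L = {id} \<or> L = H"
    if "perm_closed L" "\<And>h l. h \<in> H \<Longrightarrow> l \<in> L \<Longrightarrow> h \<circ> l \<circ> inv' h \<in> L" "L \<subseteq> H" for L
  proof -
    have "L \<subseteq> H \<and> perm_closed L \<and> (\<forall>h\<in>H. \<forall>n\<in>L. h \<circ> n \<circ> inv' h \<in> L)" using that by simp
    then show ?thesis using H(4) unfolding perm_simple_def by metis
  qed
  note H' = perm_closedD[OF H(1)]
  have KB: "fold_kernel \<subseteq> BM" by (auto simp: fold_kernel_def BM_stab_def)
  obtain D where D: "D \<subseteq> BM" "finite D" "\<forall>a\<in>BM. \<exists>c\<in>D. a \<circ> inv' c \<in> H"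
    using H(3) by (auto simp: finite_over_def)
  have closed_Int: "perm_closed (L \<inter> H)" if "perm_closed L" for L
    using that H(1) by (auto simp: perm_closed_def)
  define f where "f k = (SOME c. c \<in> D \<and> k \<circ> inv' c \<in> H)" for k
  have f: "f k \<in> D \<and> k \<circ> inv' (f k) \<in> H" if "k \<in> BM" for k
  proof -
    have "\<exists>c. c \<in> D \<and> k \<circ> inv' c \<in> H" using D(3) that by blast
    then show ?thesis unfolding f_def by (rule someI_ex)
  qed
  have "f ` fold_kernel \<subseteq> D" using f KB by blast
  then have "finite (f ` fold_kernel)" using D(2) by (rule finite_subset)
  then have "\<not> inj_on f fold_kernel" using fold_kernel_infinite finite_imageD by blast
  then obtain k k' where k: "k \<in> fold_kernel" "k' \<in> fold_kernel" "f k = f k'" "k \<noteq> k'" by (auto simp: inj_on_def)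
  have kB: "k \<in> BM" "k' \<in> BM" using k KB by blast+
  have cB: "f k \<in> BM" using f[OF kB(1)] D(1) by blast
  note bk = bij_inv_simps[OF BM_bij[OF kB(2)]] and bc = bij_inv_simps[OF BM_bij[OF cB]]
  let ?m = "k \<circ> inv' k'"
  have m_id: "?m \<noteq> id"
  proof
    assume "?m = id"
    then have "?m (k' x) = k' x" for x by simp
    then have "k x = k' x" for x using bk(1) by simp
    then show False using k(4) by auto
  qed
  have "?m = (k \<circ> inv' (f k)) \<circ> inv' (k' \<circ> inv' (f k))"
    using bc BM_bij[OF kB(2)] by (simp add: inv_compose fun_eq_iff)
  then have mH: "?m \<in> H" using f[OF kB(1)] f[OF kB(2)] k(3) H'(2,3) by metis
  have mK: "?m \<in> fold_kernel" using perm_closedD(2,3)[OF fold_kernel_closed] k by blast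
  have mS: "?m \<in> BM_stab" using mK unfolding fold_kernel_def by blast
  have "BM_stab \<inter> H = {id} \<or> BM_stab \<inter> H = H"
  proof (rule simple[OF closed_Int[OF BM_stab_closed]])
    fix h l assume h: "h \<in> H" and l: "l \<in> BM_stab \<inter> H"
    have hB: "h \<in> BM" using h H(2) by (rule subsetD[rotated])
    have "h \<circ> l \<circ> inv' h \<in> H" using H'(2)[OF H'(2)[OF h IntD2[OF l]] H'(3)[OF h]] .
    then show "h \<circ> l \<circ> inv' h \<in> BM_stab \<inter> H" using BM_stab_conj[OF hB IntD1[OF l]] by (rule IntI[rotated])
  qed (rule Int_lower2)
  then have HS: "H \<subseteq> BM_stab" using mS mH m_id by blast
  have "fold_kernel \<inter> H = {id} \<or> fold_kernel \<inter> H = H"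
  proof (rule simple[OF closed_Int[OF fold_kernel_closed]])
    fix h l assume h: "h \<in> H" and l: "l \<in> fold_kernel \<inter> H"
    have hS: "h \<in> BM_stab" using h HS by (rule subsetD[rotated])
    have "h \<circ> l \<circ> inv' h \<in> H" using H'(2)[OF H'(2)[OF h IntD2[OF l]] H'(3)[OF h]] .
    then show "h \<circ> l \<circ> inv' h \<in> fold_kernel \<inter> H" using fold_kernel_conj[OF hS IntD1[OF l]] by (rule IntI[rotated])
  qed (rule Int_lower2)
  then have HK: "H \<subseteq> fold_kernel" using mK mH m_id by blast
  have vals: "fold_map v \<in> (\<lambda>c. fold_map (c base)) ` D" if v: "v \<in> V" for v
  proof -
    obtain t where t: "t \<in> BM" "t base = v" using color_preserving_BM[OF base v] by metis
    obtain c where c: "c \<in> D" "t \<circ> inv' c \<in> H" using D(3) t(1) by blast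
    have cb: "c \<in> BM" using c(1) D(1) by blast
    have cV: "c base \<in> V" using aut_mem[OF BM_aut[OF cb]] base by blast
    have "fold_map ((t \<circ> inv' c) (c base)) = fold_map (c base)"
      using c(2) HK cV unfolding fold_kernel_def by blast
    then have "fold_map v = fold_map (c base)" using bij_inv_simps(1)[OF BM_bij[OF cb]] t(2) by simp
    then show ?thesis using c(1) by blast
  qed
  have "range (\<lambda>n. 2 * int n) \<subseteq> (\<lambda>c. fold_map (c base)) ` D"
    using fold_map_unbounded vals by (metis image_subset_iff)
  then have "finite (range (\<lambda>n. 2 * int n))" using D(2) finite_subset by blast
  moreover have "inj (\<lambda>n. 2 * int n)" by (auto intro: injI)
  ultimately show False using finite_imageD by blast
qed

end

section \<open>Groups of bijections as abstract groups\<close>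

definition comp_group :: "('a \<Rightarrow> 'a) set \<Rightarrow> ('a \<Rightarrow> 'a) monoid" where
  "comp_group S = \<lparr>carrier = S, mult = (\<circ>), one = id\<rparr>"

lemma comp_group_simps [simp]:
  "carrier (comp_group S) = S" "mult (comp_group S) = (\<circ>)" "one (comp_group S) = id"
  "(comp_group S)\<lparr>carrier := H\<rparr> = comp_group H"
  by (simp_all add: comp_group_def)

lemma comp_group_group:
  assumes "perm_closed S" "\<And>f. f \<in> S \<Longrightarrow> bij f"
  shows "group (comp_group S)"
proof (rule groupI)
  note S = perm_closedD[OF assms(1)]
  show "\<exists>y\<in>carrier (comp_group S). y \<otimes>\<^bsub>comp_group S\<^esub> x = \<one>\<^bsub>comp_group S\<^esub>"
    if "x \<in> carrier (comp_group S)" for x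
    using that S(3)[of x] bij_inv_simps(3)[OF assms(2), of x] by auto
qed (use perm_closedD[OF assms(1)] in \<open>auto simp: comp_assoc\<close>)

lemma comp_group_inv:
  assumes "perm_closed S" "\<And>f. f \<in> S \<Longrightarrow> bij f" "f \<in> S"
  shows "inv\<^bsub>comp_group S\<^esub> f = inv' f"
  using group.inv_equality[OF comp_group_group[OF assms(1,2)], of "inv' f" f] perm_closedD(3)[OF assms(1)]
    bij_inv_simps(3)[OF assms(2)[OF assms(3)]] assms(3) by simp

lemma comp_group_subgroup_iff:
  assumes "perm_closed S" "\<And>f. f \<in> S \<Longrightarrow> bij f"
  shows "subgroup H (comp_group S) \<longleftrightarrow> H \<subseteq> S \<and> perm_closed H"
proof
  assume H: "subgroup H (comp_group S)"
  have sub: "H \<subseteq> S" using subgroup.subset[OF H] by simp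
  have "perm_closed H"
  proof (rule perm_closedI)
    show "id \<in> H" using subgroup.one_closed[OF H] by simp
    show "f \<circ> g \<in> H" if "f \<in> H" "g \<in> H" for f g using subgroup.m_closed[OF H that] by simp
    show "inv' f \<in> H" if "f \<in> H" for f
    proof -
      have "f \<in> S" using that sub by blast
      then show ?thesis using subgroup.m_inv_closed[OF H that] comp_group_inv[OF assms] by simp
    qed
  qed
  then show "H \<subseteq> S \<and> perm_closed H" using sub by simp
next
  assume H: "H \<subseteq> S \<and> perm_closed H"
  then have *: "H \<subseteq> S" "perm_closed H" by auto
  note H' = perm_closedD[OF *(2)]
  show "subgroup H (comp_group S)"
  proof (rule subgroup.intro)
    show "inv\<^bsub>comp_group S\<^esub> f \<in> H" if "f \<in> H" for f
    proof -
      have "f \<in> S" using that *(1) by blast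
      then show ?thesis using H'(3)[OF that] comp_group_inv[OF assms] by simp
    qed
  qed (use * H' in auto)
qed

lemma comp_group_normal_iff:
  assumes "perm_closed S" "\<And>f. f \<in> S \<Longrightarrow> bij f"
  shows "N \<lhd> comp_group S \<longleftrightarrow>
    N \<subseteq> S \<and> perm_closed N \<and> (\<forall>h\<in>S. \<forall>n\<in>N. h \<circ> n \<circ> inv' h \<in> N)"
proof -
  have "(\<forall>h\<in>S. \<forall>n\<in>N. h \<circ> n \<circ> inv\<^bsub>comp_group S\<^esub> h \<in> N) \<longleftrightarrow> (\<forall>h\<in>S. \<forall>n\<in>N. h \<circ> n \<circ> inv' h \<in> N)"
    using comp_group_inv[OF assms] by metis
  then show ?thesis
    using group.normal_inv_iff[OF comp_group_group[OF assms]] comp_group_subgroup_iff[OF assms] by simp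
qed

lemma finite_rcosets_iff:
  assumes S: "perm_closed S" "\<And>f. f \<in> S \<Longrightarrow> bij f" and H: "H \<subseteq> S" "perm_closed H"
  shows "finite (rcosets\<^bsub>comp_group S\<^esub> H) \<longleftrightarrow> finite_over H S"
proof -
  interpret group "comp_group S" using comp_group_group[OF S] .
  have sg: "subgroup H (comp_group S)" using comp_group_subgroup_iff[OF S] H by blast
  let ?c = "\<lambda>a. (\<lambda>h. h \<circ> a) ` H"
  have coset: "H #>\<^bsub>comp_group S\<^esub> a = ?c a" for a by (auto simp: r_coset_def)
  have rc: "rcosets\<^bsub>comp_group S\<^esub> H = ?c ` S" by (auto simp: RCOSETS_def coset)
  have mem: "a \<in> ?c b \<longleftrightarrow> a \<circ> inv' b \<in> H" if "b \<in> S" for a b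
  proof
    assume "a \<in> ?c b"
    then obtain h where "h \<in> H" "a = h \<circ> b" by blast
    then show "a \<circ> inv' b \<in> H" using bij_inv_simps(4)[OF S(2)[OF that]] by (metis comp_assoc comp_id)
  next
    assume *: "a \<circ> inv' b \<in> H"
    have "a = (a \<circ> inv' b) \<circ> b" using bij_inv_simps(3)[OF S(2)[OF that]] by (metis comp_assoc comp_id)
    then show "a \<in> ?c b" using * by blast
  qed
  have self: "a \<in> ?c a" for a using perm_closedD(1)[OF H(2)] by (intro image_eqI[where x = id]) simp_all
  show ?thesis
  proof
    assume "finite (rcosets\<^bsub>comp_group S\<^esub> H)"
    then obtain D where D: "D \<subseteq> S" "finite D" "?c ` S = ?c ` D"
      unfolding rc using finite_subset_image[of "?c ` S" ?c S] by blast
    have "\<exists>c\<in>D. a \<circ> inv' c \<in> H" if a: "a \<in> S" for a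
    proof -
      have "?c a \<in> ?c ` D" unfolding D(3)[symmetric] using a by (rule imageI)
      then obtain c where c: "c \<in> D" "?c a = ?c c" by blast
      then have "a \<in> ?c c" using self by metis
      then show ?thesis using mem c(1) D(1) by blast
    qed
    then show "finite_over H S" using D(1,2) unfolding finite_over_def by blast
  next
    assume "finite_over H S"
    then obtain D where D: "D \<subseteq> S" "finite D" "\<forall>a\<in>S. \<exists>c\<in>D. a \<circ> inv' c \<in> H"
      by (auto simp: finite_over_def)
    have "?c ` S \<subseteq> ?c ` D"
    proof
      fix X assume "X \<in> ?c ` S"
      then obtain a where a: "a \<in> S" "X = ?c a" by blast
      obtain c where c: "c \<in> D" "a \<circ> inv' c \<in> H" using D(3) a(1) by blast
      have cS: "c \<in> S" using c(1) D(1) by blast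
      have "a \<in> H #>\<^bsub>comp_group S\<^esub> c" unfolding coset using mem[OF cS] c(2) by blast
      then have "H #>\<^bsub>comp_group S\<^esub> c = H #>\<^bsub>comp_group S\<^esub> a" using repr_independence[OF _ _ sg] cS by simp
      then show "X \<in> ?c ` D" unfolding coset a(2) using c(1) by blast
    qed
    then show "finite (rcosets\<^bsub>comp_group S\<^esub> H)" unfolding rc
      by (rule finite_subset[OF _ finite_imageI[OF D(2)]])
  qed
qed

lemma generate_comp_group:
  assumes F: "perm_closed F" "\<And>f. f \<in> F \<Longrightarrow> bij f" and "S \<subseteq> F"
  shows "generate (comp_group F) S = perm_closed hull S"
proof
  interpret group "comp_group F" using comp_group_group[OF F] .
  note K = perm_closedD[OF perm_closed_hull[of S]]
  show "generate (comp_group F) S \<subseteq> perm_closed hull S"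
  proof
    fix x assume "x \<in> generate (comp_group F) S"
    then show "x \<in> perm_closed hull S"
    proof (induction rule: generate.induct)
      case (inv h)
      have "inv\<^bsub>comp_group F\<^esub> h = inv' h" using inv assms(3) by (intro comp_group_inv[OF F]) blast+
      then show ?case using K(3)[OF hull_inc[OF inv]] by simp
    next
      case (eng h1 h2)
      then show ?case using K(2) by (simp only: comp_group_simps)
    qed (simp_all only: K(1) comp_group_simps hull_inc)
  qed
  have "subgroup (generate (comp_group F) S) (comp_group F)" using generate_is_subgroup assms(3) by simp
  then have "perm_closed (generate (comp_group F) S)" using comp_group_subgroup_iff[OF F] by blast
  moreover have "S \<subseteq> generate (comp_group F) S" by (rule subsetI) (rule generate.incl)
  ultimately show "perm_closed hull S \<subseteq> generate (comp_group F) S" by (rule perm_closed_hull_least[rotated])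
qed

lemma virtually_simple_comp_group:
  assumes S: "perm_closed S" "\<And>f. f \<in> S \<Longrightarrow> bij f"
  shows "virtually_simple (comp_group S) \<longleftrightarrow>
    (\<exists>H. H \<subseteq> S \<and> perm_closed H \<and> finite_over H S \<and> perm_simple H)"
    (is "_ \<longleftrightarrow> (\<exists>H. ?P H)")
proof -
  have "subgroup H (comp_group S) \<and> finite (rcosets\<^bsub>comp_group S\<^esub> H) \<and>
      abstractly_simple ((comp_group S)\<lparr>carrier := H\<rparr>) \<longleftrightarrow> ?P H" for H
  proof (cases "H \<subseteq> S \<and> perm_closed H")
    case True
    then have H: "H \<subseteq> S" "perm_closed H" "\<And>f. f \<in> H \<Longrightarrow> bij f" using S(2) by auto
    show ?thesis
      using True comp_group_subgroup_iff[OF S, of H] finite_rcosets_iff[OF S H(1,2)]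
        comp_group_normal_iff[OF H(2,3)] comp_group_group[OF H(2,3)]
      by (simp add: abstractly_simple_def perm_simple_def)
  next
    case False
    then show ?thesis using comp_group_subgroup_iff[OF S, of H] by auto
  qed
  then show ?thesis unfolding virtually_simple_def by simp
qed

section \<open>Permutation groups of the colors\<close>

lemma sym_group_comp_group: "sym_group d = comp_group {p. p permutes {1..d}}"
  by (simp add: sym_group_def comp_group_def)

lemma perm_group_comp_group: "perm_group d F = comp_group F"
  by (simp add: perm_group_def sym_group_comp_group)

lemma permutes_closed: "perm_closed {p. p permutes A}"
  by (rule perm_closedI) (auto simp: permutes_id permutes_compose permutes_inv)

lemma subgroup_sym_group_iff: "subgroup F (sym_group d) \<longleftrightarrow> F \<subseteq> {p. p permutes {1..d}} \<and> perm_closed F"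
  unfolding sym_group_comp_group
  by (rule comp_group_subgroup_iff[OF permutes_closed]) (auto intro: permutes_bij)

lemma stabilizer_perm_group:
  "i \<in> {1..d} \<Longrightarrow> stabilizer (perm_group d F) (nat_action d) i = {a \<in> F. a i = i}"
  by (simp add: stabilizer_def perm_group_comp_group nat_action_def)

lemma group_action_perm_group:
  assumes "subgroup F (sym_group d)"
  shows "group_action (perm_group d F) {1..d} (nat_action d)"
proof -
  have F: "F \<subseteq> {p. p permutes {1..d}}" "perm_closed F" using assms subgroup_sym_group_iff by auto
  have b: "bij f" if "f \<in> F" for f using F(1) that permutes_bij by blast
  have Bij: "nat_action d f \<in> Bij {1..d}" if "f \<in> F" for f
  proof -
    have "bij_betw f {1..d} {1..d}" using F(1) that permutes_imp_bij by blast
    then have "bij_betw (restrict f {1..d}) {1..d} {1..d}"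
      by (rule iffD1[OF bij_betw_cong, rotated]) (rule restrict_apply'[symmetric])
    then show ?thesis by (simp add: Bij_def nat_action_def)
  qed
  have "restrict (f \<circ> g) A = compose A (restrict f A) (restrict g A)"
    if "\<And>x. x \<in> A \<Longrightarrow> g x \<in> A" for f g :: "nat \<Rightarrow> nat" and A
    using that by (auto simp: compose_def restrict_def fun_eq_iff)
  then have "nat_action d (f \<circ> g) = compose {1..d} (nat_action d f) (nat_action d g)" if "g \<in> F" for f g
    unfolding nat_action_def using permutes_in_image[of g "{1..d}"] F(1) that by blast
  then have "nat_action d \<in> hom (comp_group F) (BijGroup {1..d})"
    using Bij by (intro homI) (simp_all add: BijGroup_def)
  then show ?thesis
    using comp_group_group[OF F(2) b] group_BijGroup
    by (intro group_action.intro group_hom.intro group_hom_axioms.intro) (simp_all add: perm_group_comp_group)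
qed

lemma acts_transitively_iff:
  assumes "subgroup F (sym_group d)"
  shows "acts_transitively d F \<longleftrightarrow> (\<forall>i\<in>{1..d}. \<forall>j\<in>{1..d}. \<exists>a\<in>F. a i = j)"
proof -
  have "acts_transitively d F \<longleftrightarrow>
      (\<forall>i j. i \<in> {1..d} \<longrightarrow> j \<in> {1..d} \<longrightarrow> (\<exists>a\<in>carrier (perm_group d F). nat_action d a i = j))"
    unfolding acts_transitively_def transitive_action_def transitive_action_axioms_def
    using group_action_perm_group[OF assms] by blast
  then show ?thesis
    by (auto simp: nat_action_def perm_group_comp_group simp del: One_nat_def atLeastAtMost_iff)
qed

lemma generated_iff:
  assumes "subgroup F (sym_group d)"
  shows "generated_by_point_stabilizers d F \<longleftrightarrow> F \<subseteq> perm_closed hull {a \<in> F. \<exists>i\<in>{1..d}. a i = i}"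
proof -
  have F: "F \<subseteq> {p. p permutes {1..d}}" "perm_closed F" using assms subgroup_sym_group_iff by auto
  have b: "bij f" if "f \<in> F" for f using F(1) that permutes_bij by blast
  let ?S = "{a \<in> F. \<exists>i\<in>{1..d}. a i = i}"
  have "(\<Union>i\<in>{1..d}. stabilizer (perm_group d F) (nat_action d) i) = ?S"
    by (auto simp: stabilizer_perm_group)
  then have "generated_by_point_stabilizers d F \<longleftrightarrow> perm_closed hull ?S = F"
    unfolding generated_by_point_stabilizers_def perm_group_comp_group
    using generate_comp_group[OF F(2) b, of ?S] by simp
  moreover have "perm_closed hull ?S \<subseteq> F" using F(2) by (intro perm_closed_hull_least) auto
  ultimately show ?thesis by blast
qed

lemma young_group_orbits:
  assumes "a \<in> young_group d F" "perm_closed F" "i \<in> {1..d}"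
  shows "\<exists>f\<in>F. f i = a i"
proof -
  let ?Y = "orbit (perm_group d F) (nat_action d) i"
  have Y: "?Y = {f i | f. f \<in> F}" using assms(3) by (simp add: orbit_def perm_group_comp_group nat_action_def)
  have "?Y \<in> orbits (perm_group d F) {1..d} (nat_action d)" using assms(3) by (auto simp: orbits_def)
  then have "a ` ?Y = ?Y" using assms(1) by (simp add: young_group_def)
  moreover have "i \<in> ?Y" unfolding Y using perm_closedD(1)[OF assms(2)] by (intro CollectI exI[of _ id]) simp
  ultimately have "a i \<in> ?Y" by blast
  then show ?thesis unfolding Y by force
qed

section \<open>Regular trees\<close>

locale regular_colored_tree =
  fixes d :: nat and T :: "'v pair_pre_digraph" and c :: "'v \<times> 'v \<Rightarrow> nat"
  assumes tree: "regular_tree d T" and legal: "legal_coloring d T c"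
begin

definition neighbor :: "'v \<Rightarrow> nat \<Rightarrow> 'v" where
  "neighbor v i = snd (inv_into (out_arcs (with_proj T) v) c i)"

lemma bidirected: "pair_bidirected_digraph T"
  using tree by (simp add: regular_tree_def undirected_tree_def)

lemma color_bij: "v \<in> pverts T \<Longrightarrow> bij_betw c (out_arcs (with_proj T) v) {1..d}"
  using legal by (simp add: legal_coloring_def coloring_def)

lemma arc_inv_into:
  assumes "v \<in> pverts T" "i \<in> {1..d}"
  shows "inv_into (out_arcs (with_proj T) v) c i = (v, neighbor v i)"
    and "(v, neighbor v i) \<in> parcs T" "c (v, neighbor v i) = i"
proof -
  let ?e = "inv_into (out_arcs (with_proj T) v) c i"
  have img: "i \<in> c ` out_arcs (with_proj T) v" using color_bij[OF assms(1)] assms(2) by (simp add: bij_betw_def)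
  have e: "?e \<in> out_arcs (with_proj T) v" using inv_into_into[OF img] .
  have "c ?e = i" using f_inv_into_f[OF img] .
  moreover have eq: "?e = (v, neighbor v i)" using e by (simp add: neighbor_def prod_eq_iff)
  ultimately show "c (v, neighbor v i) = i" "(v, neighbor v i) \<in> parcs T" using e by auto
  show "?e = (v, neighbor v i)" by (rule eq)
qed

lemma arc_neighbor:
  assumes "(v, u) \<in> parcs T"
  shows "c (v, u) \<in> {1..d}" "neighbor v (c (v, u)) = u" "v \<in> pverts T" "u \<in> pverts T"
proof -
  interpret pair_bidirected_digraph T by (rule bidirected)
  show v: "v \<in> pverts T" and "u \<in> pverts T" using in_arcsD1[OF assms] in_arcsD2[OF assms] by auto
  have e: "(v, u) \<in> out_arcs (with_proj T) v" using assms by simp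
  show "c (v, u) \<in> {1..d}" using bij_betwE[OF color_bij[OF v]] e by blast
  show "neighbor v (c (v, u)) = u"
    using inv_into_f_f[OF bij_betw_imp_inj_on[OF color_bij[OF v]] e] by (simp add: neighbor_def)
qed

lemma arc_sym: "(v, u) \<in> parcs T \<Longrightarrow> (u, v) \<in> parcs T \<and> c (u, v) = c (v, u)"
proof -
  interpret pair_bidirected_digraph T by (rule bidirected)
  assume *: "(v, u) \<in> parcs T"
  have "c (v, u) = c (prod.swap (v, u))" using legal * unfolding legal_coloring_def by blast
  then show ?thesis using arcs_symmetric[OF *] by simp
qed

lemma neighbor_mem: "v \<in> pverts T \<Longrightarrow> i \<in> {1..d} \<Longrightarrow> neighbor v i \<in> pverts T"
  using arc_inv_into(2) arc_neighbor(4) by blast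

lemma neighbor_neighbor: "v \<in> pverts T \<Longrightarrow> i \<in> {1..d} \<Longrightarrow> neighbor (neighbor v i) i = v"
  using arc_sym arc_inv_into arc_neighbor(2) by metis

lemma walk_mem: "v \<in> pverts T \<Longrightarrow> set w \<subseteq> {1..d} \<Longrightarrow> foldl neighbor v w \<in> pverts T"
  by (induction w arbitrary: v) (simp_all add: neighbor_mem)

lemma walk_exists:
  assumes "u \<in> pverts T" "v \<in> pverts T"
  shows "\<exists>w. set w \<subseteq> {1..d} \<and> foldl neighbor u w = v"
proof -
  have arcs: "parcs (mk_symmetric (with_proj T)) = parcs T"
    using arc_sym by (auto simp: mk_symmetric_def)
  have "(u, v) \<in> rtrancl_on (pverts T) (parcs T)"
    using tree assms arcs
    by (simp add: regular_tree_def undirected_tree_def connected_def strongly_connected_def reachable_def)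
  then show ?thesis
  proof (induction rule: rtrancl_on_induct)
    case base
    show ?case by (intro exI[of _ "[]"]) simp
  next
    case (step y z)
    then obtain w where "set w \<subseteq> {1..d}" "foldl neighbor u w = y" by blast
    then show ?case using arc_neighbor[OF step(2)] by (intro exI[of _ "w @ [c (y, z)]"]) auto
  qed
qed

text \<open>Walks are color words above and lists of arcs in the definition of a cycle.\<close>

primrec walk_arcs :: "'v \<Rightarrow> nat list \<Rightarrow> ('v \<times> 'v) list" where
  "walk_arcs v [] = []"
| "walk_arcs v (i # w) = (v, neighbor v i) # walk_arcs (neighbor v i) w"

lemma walk_arcs_awalk:
  "v \<in> pverts T \<Longrightarrow> set w \<subseteq> {1..d} \<Longrightarrow>
    set (walk_arcs v w) \<subseteq> parcs T \<and> pcas v (walk_arcs v w) (foldl neighbor v w)"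
  by (induction w arbitrary: v) (auto simp: arc_inv_into neighbor_mem)

lemma walk_arcs_verts:
  "pawalk_verts v (walk_arcs v w) = map (\<lambda>k. foldl neighbor v (take k w)) [0..<Suc (length w)]"
proof (induction w arbitrary: v)
  case (Cons i w)
  have "[0..<Suc (length (i # w))] = 0 # map Suc [0..<Suc (length w)]"
    by (simp add: map_Suc_upt upt_conv_Cons del: upt_Suc)
  then show ?case using Cons[of "neighbor v i"] by (simp add: o_def del: upt_Suc)
qed simp

lemma length_walk_arcs: "length (walk_arcs v w) = length w"
  by (induction w arbitrary: v) auto

text \<open>In a reduced closed walk of minimal length no vertex is repeated, so it would be a cycle. Length
  one is excluded because there are no loops, and length two because the walk is reduced.\<close>

lemma reduced_closed_walk_Nil:
  "v \<in> pverts T \<Longrightarrow> set w \<subseteq> {1..d} \<Longrightarrow> distinct_adj w \<Longrightarrow> foldl neighbor v w = v \<Longrightarrow> w = []"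
proof (induction "length w" arbitrary: v w rule: less_induct)
  case less
  note v = less.prems(1) and w = less.prems(2) and red = less.prems(3) and closed = less.prems(4)
  interpret pair_bidirected_digraph T by (rule bidirected)
  show ?case
  proof (rule ccontr)
    assume ne: "w \<noteq> []"
    let ?n = "length w" and ?x = "\<lambda>k. foldl neighbor v (take k w)"
    have xV: "?x k \<in> pverts T" for k using walk_mem[OF v] w set_take_subset[of k w] by blast
    have inj: "?x a \<noteq> ?x b" if ab: "0 < a" "a < b" "b \<le> ?n" for a b
    proof
      assume eq: "?x a = ?x b"
      let ?s = "drop a (take b w)"
      have app: "take b w = take a w @ ?s"
        using ab by (metis append_take_drop_id less_imp_le min.absorb1 take_take)
      have "foldl neighbor (?x a) ?s = ?x b" by (subst (2) app) simp
      moreover have "distinct_adj ?s"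
        using red app by (metis append_take_drop_id distinct_adj_append_iff)
      moreover have "set ?s \<subseteq> {1..d}" using w by (meson order_trans set_drop_subset set_take_subset)
      moreover have "length ?s < ?n" using ab by simp
      ultimately have "?s = []" using less.hyps xV eq by metis
      then show False using ab by simp
    qed
    let ?p = "walk_arcs v w"
    have verts: "pawalk_verts v ?p = map ?x [0..<Suc ?n]" by (rule walk_arcs_verts)
    have "tl (map ?x [0..<Suc ?n]) = map ?x [Suc 0..<Suc ?n]"
      by (simp add: upt_conv_Cons del: upt_Suc)
    moreover have "inj_on ?x {Suc 0..<Suc ?n}"
    proof (rule inj_onI)
      fix a b assume "a \<in> {Suc 0..<Suc ?n}" "b \<in> {Suc 0..<Suc ?n}" "?x a = ?x b"
      then show "a = b" using inj[of a b] inj[of b a] by (cases a b rule: linorder_cases) auto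
    qed
    ultimately have dist: "distinct (tl (pawalk_verts v ?p))"
      unfolding verts by (simp add: distinct_map del: upt_Suc)
    have aw: "awalk v ?p v"
      unfolding awalk_def using walk_arcs_awalk[OF v w] v closed by simp
    have pne: "?p \<noteq> []" using ne length_walk_arcs[of v w] by auto
    have "cycle ?p" unfolding cycle_def using aw dist pne by blast
    then have short: "?n < 3"
      using tree length_walk_arcs[of v w] unfolding regular_tree_def undirected_tree_def by force
    consider i where "w = [i]" | i j where "w = [i, j]"
    proof (cases w)
      case (Cons i w')
      show thesis
      proof (cases w')
        case Nil then show thesis using that Cons by simp
      next
        case (Cons j w'')
        then show thesis using that \<open>w = i # w'\<close> short by (cases w'') auto
      qed
    qed (use ne in simp)
    then show False
    proof cases
      case 1
      then have "(v, v) \<in> parcs T" using arc_inv_into(2)[OF v, of i] w closed by simp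
      then show False using pair_no_loops by fastforce
    next
      case 2
      then have ij: "i \<in> {1..d}" "j \<in> {1..d}" "neighbor (neighbor v i) j = v" "i \<noteq> j" using w closed red by auto
      have "neighbor v i = neighbor v j" using neighbor_neighbor[OF neighbor_mem[OF v ij(1)] ij(2)] ij(3) by simp
      then show False using arc_inv_into(3)[OF v ij(1)] arc_inv_into(3)[OF v ij(2)] ij(4) by metis
    qed
  qed
qed

sublocale colored_tree "pverts T" "{1..d}" neighbor
  using neighbor_mem neighbor_neighbor walk_exists reduced_closed_walk_Nil
  by unfold_locales auto

lemma arc_iff: "v \<in> pverts T \<Longrightarrow> (v, u) \<in> parcs T \<longleftrightarrow> (\<exists>i\<in>{1..d}. u = neighbor v i)"
  using arc_inv_into(2) arc_neighbor by metis

lemma tree_aut_eq: "tree_aut T = aut"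
proof
  show "tree_aut T \<subseteq> aut"
  proof
    fix g assume g: "g \<in> tree_aut T"
    then have p: "g permutes pverts T" by (simp add: tree_aut_def)
    have "\<exists>j\<in>{1..d}. g (neighbor v i) = neighbor (g v) j" if v: "v \<in> pverts T" and i: "i \<in> {1..d}" for v i
    proof -
      have "(g v, g (neighbor v i)) \<in> parcs T"
        using g v neighbor_mem[OF v i] arc_inv_into(2)[OF v i] by (simp add: tree_aut_def)
      moreover have "g v \<in> pverts T" using permutes_in_image[OF p] v by blast
      ultimately show ?thesis using arc_iff by blast
    qed
    then show "g \<in> aut" unfolding aut_def using p by blast
  qed
  show "aut \<subseteq> tree_aut T"
  proof
    fix g assume g: "g \<in> aut"
    have fwd: "(h u, h v) \<in> parcs T" if h: "h \<in> aut" and uv: "(u, v) \<in> parcs T" for h u v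
    proof -
      have u: "u \<in> pverts T" using arc_neighbor(3)[OF uv] .
      obtain i where i: "i \<in> {1..d}" "v = neighbor u i" using uv arc_iff[OF u] by blast
      have hu: "h u \<in> pverts T" using aut_mem[OF h] u by blast
      show ?thesis using loc_nb[OF h u i(1)] i(2) arc_iff[OF hu] by blast
    qed
    have "(g u, g v) \<in> parcs T \<longleftrightarrow> (u, v) \<in> parcs T" for u v
      using fwd[OF g, of u v] fwd[OF aut_inv[OF g], of "g u" "g v"] bij_inv_simps(1)[OF aut_bij[OF g]] by auto
    then show "g \<in> tree_aut T" using g unfolding tree_aut_def aut_def by blast
  qed
qed

lemma local_action_eq:
  assumes g: "g \<in> aut" and v: "v \<in> pverts T"
  shows "local_action d T c g v = loc g v"
proof
  fix i
  show "local_action d T c g v i = loc g v i"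
  proof (cases "i \<in> {1..d}")
    case True
    have gv: "g v \<in> pverts T" using aut_mem[OF g] v by blast
    have "local_action d T c g v i = c (g v, g (neighbor v i))"
      unfolding local_action_def using True arc_inv_into(1)[OF v True] by simp
    also have "\<dots> = loc g v i"
      unfolding loc_nb(2)[OF g v True] by (rule arc_inv_into(3)[OF gv loc_nb(1)[OF g v True]])
    finally show ?thesis .
  next
    case False
    then show ?thesis unfolding local_action_def loc_def by (simp only: if_False)
  qed
qed

lemma verts_nonempty: "pverts T \<noteq> {}"
  using tree by (simp add: regular_tree_def undirected_tree_def connected_def strongly_connected_def mk_symmetric_def)

end

theorem theorem1p2p8:
  fixes d :: nat
    and T :: "'v pair_pre_digraph"
    and c :: "'v \<times> 'v \<Rightarrow> nat"
    and F F' :: "(nat \<Rightarrow> nat) set"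
  assumes "d > 2"
    and "regular_tree d T"
    and "legal_coloring d T c"
    and "subgroup F (sym_group d)"
    and "subgroup F' (sym_group d)"
    and "\<not> acts_freely d F'"
    and "F \<subseteq> F'"
    and "F' \<subseteq> young_group d F"
  shows "virtually_simple (restricted_burger_mozes d T c F F') \<longleftrightarrow>
    acts_transitively d F' \<and> generated_by_point_stabilizers d F'"
proof -
  let ?C = "{1..d}"
  have F: "perm_closed F" and F': "F' \<subseteq> {p. p permutes ?C}" "perm_closed F'"
    using assms(4,5) subgroup_sym_group_iff by auto
  interpret regular_colored_tree d T c using assms(2,3) by unfold_locales
  interpret burger_mozes "pverts T" ?C neighbor F F'
  proof unfold_locales
    show "\<exists>f\<in>F. f i = a i" if "a \<in> F'" "i \<in> ?C" for a i
      using young_group_orbits[OF _ F that(2)] assms(8) that(1) by blast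
  qed (use F F' assms(7) in auto)
  have carrier: "restricted_burger_mozes d T c F F' = comp_group BM"
  proof -
    have "{v \<in> pverts T. local_action d T c g v \<notin> F} = sing g" if "g \<in> aut" for g
      unfolding sing_def by (intro Collect_cong conj_cong refl) (simp only: local_action_eq[OF that])
    moreover have "(\<forall>v\<in>pverts T. local_action d T c g v \<in> F') \<longleftrightarrow> (\<forall>v\<in>pverts T. loc g v \<in> F')"
      if "g \<in> aut" for g
      by (intro ball_cong refl) (simp only: local_action_eq[OF that])
    ultimately have "{g \<in> tree_aut T. (\<forall>v\<in>pverts T. local_action d T c g v \<in> F') \<and>
        finite {v \<in> pverts T. local_action d T c g v \<notin> F}} = BM"
      unfolding tree_aut_eq BM_def by (intro Collect_cong conj_cong refl) simp_all
    then show ?thesis by (simp add: restricted_burger_mozes_def tree_aut_group_def comp_group_def)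
  qed
  have nonfree: "\<exists>a\<in>F'. \<exists>i\<in>?C. a i = i \<and> a \<noteq> id"
  proof -
    obtain i where i: "i \<in> ?C" "stabilizer (perm_group d F') (nat_action d) i \<noteq> {id}"
      using assms(6) unfolding acts_freely_def by blast
    let ?S = "{a \<in> F'. a i = i}"
    have "?S \<noteq> {id}" using i(2) unfolding stabilizer_perm_group[OF i(1)] .
    moreover have "id \<in> ?S" using perm_closedD(1)[OF F'(2)] by simp
    ultimately obtain a where "a \<in> ?S" "a \<noteq> id" by blast
    then show ?thesis using i(1) by blast
  qed
  have vs: "virtually_simple (comp_group BM) \<longleftrightarrow>
      (\<exists>H. H \<subseteq> BM \<and> perm_closed H \<and> finite_over H BM \<and> perm_simple H)"
    by (rule virtually_simple_comp_group[OF BM_closed BM_bij])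
  show ?thesis
    unfolding carrier acts_transitively_iff[OF assms(5)] generated_iff[OF assms(5)]
  proof
    assume *: "(\<forall>i\<in>?C. \<forall>j\<in>?C. \<exists>a\<in>F'. a i = j) \<and> F' \<subseteq> perm_closed hull {a \<in> F'. \<exists>i\<in>?C. a i = i}"
    interpret burger_mozes_stabilizers "pverts T" ?C neighbor F F'
      using * nonfree verts_nonempty assms(1) by unfold_locales auto
    show "virtually_simple (comp_group BM)"
      unfolding vs
    proof (intro exI[of _ core] conjI)
      show "core \<subseteq> BM" using core_Gplus Gplus_BM by blast
    qed (rule core_closed BM_finite_over_core core_simple)+
  next
    assume "virtually_simple (comp_group BM)"
    then obtain H where H: "H \<subseteq> BM" "perm_closed H" "finite_over H BM" "perm_simple H"
      unfolding vs by blast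
    have trans: "\<exists>a\<in>stab_group. a i = j" if i: "i \<in> ?C" and j: "j \<in> ?C" for i j
    proof (rule ccontr)
      assume no: "\<not> (\<exists>a\<in>stab_group. a i = j)"
      let ?B = "(\<lambda>a. a i) ` stab_group"
      obtain v where v: "v \<in> pverts T" using verts_nonempty by blast
      interpret burger_mozes_fold "pverts T" ?C neighbor F F' ?B v
      proof
        show "?B \<subseteq> ?C"
        proof
          fix x assume "x \<in> ?B"
          then obtain a where "a \<in> stab_group" "x = a i" by blast
          then show "x \<in> ?C" using permutes_in_image[OF F'_permutes, of a i] stab_group_sub i by blast
        qed
        show "?B \<noteq> {}" using perm_closedD(1)[OF stab_group_closed] by blast
        show "?B \<noteq> ?C"
        proof
          assume eq: "?B = ?C"
          have "j \<in> ?B" unfolding eq by (rule j)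
          then show False using no by blast
        qed
        show "a k \<in> ?B \<longleftrightarrow> k \<in> ?B" if a: "a \<in> stab_group" for a k
          using stab_group_orbit_invariant[OF a] .
      qed (rule v nonfree)+
      show False using no_simple_finite_index[OF H(2,1,3,4)] .
    qed
    have ne: "?C \<noteq> {}" using assms(1) by auto
    show "(\<forall>i\<in>?C. \<forall>j\<in>?C. \<exists>a\<in>F'. a i = j) \<and> F' \<subseteq> perm_closed hull {a \<in> F'. \<exists>i\<in>?C. a i = i}"
      using trans stab_group_sub transitive_stab_group[OF trans ne] unfolding stab_group_def[symmetric] by blast
  qed
qed

end
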